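(* The following conclusions hold: (i) For $\mu>-\frac14$, $\mathcal H^1_{\mu,0}(B_1)=\mathcal H^1_0(B_1)$. (ii) $\mathcal H^1_0(B_1)\subsetneq\hat{\mathcal H}^1_0(B_1)$.
   Context: $B_1$ is the open unit ball centered at the origin in $\mathbb R^2$. For $\mu\geq-\frac14$, $\mathcal H^1_{\mu,0}(B_1)$ is the completion of $C_c^\infty(B_1)$ under the norm $$\|u\|_\mu=\Big(\int_{B_1}\Big(|\nabla u|^2+\mu\frac{u^2}{|x|^2(-\ln|x|)^2}\Big)dx\Big)^{1/2}.$$ Further, $\mathcal H^1_0(B_1)=\mathcal H^1_{0,0}(B_1)$ (the case $\mu=0$) and $\hat{\mathcal H}^1_0(B_1)=\mathcal H^1_{-1/4,0}(B_1)$ (the case $\mu=-\frac14$). *)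

theory Defs
  imports "HOL-Analysis.Analysis"
begin

definition partial :: "2 \<Rightarrow> (real^2 \<Rightarrow> real) \<Rightarrow> real^2 \<Rightarrow> real" where
  "partial i u x = frechet_derivative u (at x) (axis i 1)"

definition grad :: "(real^2 \<Rightarrow> real) \<Rightarrow> real^2 \<Rightarrow> real^2" where
  "grad u x = (\<chi> i. partial i u x)"

fun C_diff :: "nat \<Rightarrow> (real^2 \<Rightarrow> real) \<Rightarrow> bool" where
  "C_diff 0 u \<longleftrightarrow> continuous_on UNIV u"
| "C_diff (Suc k) u \<longleftrightarrow> (\<forall>x. u differentiable (at x)) \<and> (\<forall>i. C_diff k (partial i u))"

(* The elements of C_c^infinity(B_1), extended by zero to the whole plane. *)
definition test_functions :: "(real^2 \<Rightarrow> real) set" where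
  "test_functions = {u. (\<forall>k. C_diff k u) \<and>
     compact (closure {x. u x \<noteq> 0}) \<and> closure {x. u x \<noteq> 0} \<subseteq> ball 0 1}"

definition hardy_norm :: "real \<Rightarrow> (real^2 \<Rightarrow> real) \<Rightarrow> real" where
  "hardy_norm \<mu> u = sqrt (LINT x:ball 0 1|lborel.
     (norm (grad u x))\<^sup>2 + \<mu> * ((u x)\<^sup>2 / ((norm x)\<^sup>2 * (- ln (norm x))\<^sup>2)))"

definition Cauchy_seqs :: "real \<Rightarrow> (nat \<Rightarrow> real^2 \<Rightarrow> real) set" where
  "Cauchy_seqs \<mu> = {s. (\<forall>n. s n \<in> test_functions) \<and>
     (\<forall>e>0. \<exists>N. \<forall>m\<ge>N. \<forall>n\<ge>N. hardy_norm \<mu> (\<lambda>x. s m x - s n x) < e)}"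

definition null_rel :: "real \<Rightarrow> ((nat \<Rightarrow> real^2 \<Rightarrow> real) \<times> (nat \<Rightarrow> real^2 \<Rightarrow> real)) set" where
  "null_rel \<mu> = {(s, t). s \<in> Cauchy_seqs \<mu> \<and> t \<in> Cauchy_seqs \<mu> \<and>
     (\<lambda>n. hardy_norm \<mu> (\<lambda>x. s n x - t n x)) \<longlonglongrightarrow> 0}"

(* The completion is the space of classes of Cauchy sequences modulo null sequences. It is not
   replaced by a space of functions: for \<mu> = -1/4 there are test functions converging locally
   uniformly on the punctured ball to sqrt (-ln |x|) whose norms tend to 0, so that elements of
   the completion are not determined by a limit function. *)
definition H1_mu :: "real \<Rightarrow> (nat \<Rightarrow> real^2 \<Rightarrow> real) set set" where
  "H1_mu \<mu> = Cauchy_seqs \<mu> // null_rel \<mu>"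

definition H1_zero :: "(nat \<Rightarrow> real^2 \<Rightarrow> real) set set" where
  "H1_zero = H1_mu 0"

definition H1_hat :: "(nat \<Rightarrow> real^2 \<Rightarrow> real) set set" where
  "H1_hat = H1_mu (-1/4)"

(* Sends the class of s in one completion to the class of the same s in the completion for \<nu>:
   the extension of the identity map of the test functions. *)
definition canonical :: "real \<Rightarrow> (nat \<Rightarrow> real^2 \<Rightarrow> real) set \<Rightarrow> (nat \<Rightarrow> real^2 \<Rightarrow> real) set" where
  "canonical \<nu> C = null_rel \<nu> `` C"

(* Inclusion of completions of the same space for two different norms: the identity map of the
   test functions extends to the completions (Cauchy sequences stay Cauchy, by reflexivity of the
   relations, and equivalent ones stay equivalent), and the extension is injective. *)
definition canonically_included :: "real \<Rightarrow> real \<Rightarrow> bool" where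
  "canonically_included \<mu> \<nu> \<longleftrightarrow>
     null_rel \<mu> \<subseteq> null_rel \<nu> \<and> inj_on (canonical \<nu>) (H1_mu \<mu>) \<and>
     canonical \<nu> ` H1_mu \<mu> \<subseteq> H1_mu \<nu>"

end

theory Submission
  imports Defs
begin

text \<open>
  Write \<open>r = |x|\<close>, \<open>\<tau> = - ln r\<close>, \<open>V = 1 / (r^2 \<tau>^2)\<close> for the Hardy weight and \<open>F = x / (r^2 \<tau>)\<close>.
  Then \<open>|F|^2 = V\<close> and, away from the origin, \<open>div F = V\<close>. Since the flux of \<open>F\<close> through small
  circles tends to \<open>0\<close>, integrating \<open>div (u^2 F)\<close> gives the ground state representation
  \<open>\<integral> |\<nabla>u|^2 - 1/4 \<integral> V u^2 = \<integral> |\<nabla>u + u F / 2|^2\<close> for test functions \<open>u\<close>. Hence the square of the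
  norm with parameter \<open>\<mu>\<close> is \<open>q(u) + (\<mu> + 1/4) v(u)\<close>, where \<open>q(u)\<close> is the right-hand side and
  \<open>v(u) = \<integral> V u^2\<close> (lemma \<open>hardy_norm_eq\<close>).

  For \<open>\<mu> > -1/4\<close> this norm controls the seminorms of \<open>q\<close> and \<open>v\<close> together, whatever the value of
  \<open>\<mu>\<close>; so Cauchy sequences, null sequences and the completion do not depend on \<open>\<mu>\<close>.

  For \<open>\<mu> = -1/4\<close> only \<open>q\<close> is left. In the coordinate \<open>s = ln \<tau>\<close>, for radial
  \<open>u = sqrt \<tau> * w(s)\<close>, the forms \<open>q\<close> and \<open>v\<close> are multiples of \<open>\<integral> w'^2 ds\<close> and \<open>\<integral> w^2 ds\<close> over
  the whole line. There \<open>0\<close> is a point of the spectrum of \<open>-d^2/ds^2\<close> but not an eigenvalue, and both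
  halves of this remark are used.

  No eigenvalue: the interpolation inequality \<open>sup w^2 \<le> 2 |w| |w'|\<close> (norms in \<open>L^2\<close>) has a two
  dimensional version, \<open>interpolation_inequality\<close>. It shows that a \<open>v\<close>-bounded sequence which is
  \<open>q\<close>-null is weakly null for \<open>v\<close> (\<open>weight_form_control\<close>). So a sequence that is Cauchy for the
  Dirichlet norm and null for \<open>q\<close> is null for the Dirichlet norm (\<open>closable\<close>), which is the
  injectivity of the map between the completions.

  Point of the spectrum: wide bumps \<open>w(s) = exp (-1 / (1 - (s/l)^2))\<close> make \<open>q / v\<close> as small as
  desired (\<open>no_spectral_gap\<close>). By a Baire category argument there is then a \<open>q\<close>-Cauchy sequence
  that no \<open>v\<close>-bounded sequence approaches in \<open>q\<close> (\<open>not_surjective\<close>), so the inclusion is strict.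
\<close>

section \<open>Calculus of smooth functions\<close>

lemma partial_eqI:
  assumes "(u has_derivative u') (at x)"
  shows "partial i u x = u' (axis i 1)"
  using frechet_derivative_at[OF assms] by (simp add: partial_def)

lemma C_diff_SucI:
  assumes "\<And>x. (u has_derivative u' x) (at x)"
    and "\<And>i. C_diff k (\<lambda>x. u' x (axis i 1))"
  shows "C_diff (Suc k) u"
proof -
  have "partial i u = (\<lambda>x. u' x (axis i 1))" for i
    using partial_eqI[OF assms(1)] by blast
  then show ?thesis
    using assms by (auto simp: differentiable_def)
qed

lemma C_diff_imp_continuous:
  assumes "C_diff k u"
  shows "continuous_on UNIV u"
proof (cases k)
  case (Suc k)
  then have "u differentiable_on UNIV"
    using assms by (simp add: differentiable_on_def)
  then show ?thesis by (rule differentiable_imp_continuous_on)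
qed (use assms in simp)

lemma C_diff_SucD: "C_diff (Suc k) u \<Longrightarrow> C_diff k u"
proof (induction k arbitrary: u)
  case 0
  then show ?case using C_diff_imp_continuous[of "Suc 0" u]
    by (simp del: C_diff.simps(2))
next
  case (Suc k)
  then show ?case unfolding C_diff.simps(2) by blast
qed

lemma C_diff_has_derivative:
  "C_diff (Suc k) u \<Longrightarrow> (u has_derivative frechet_derivative u (at x)) (at x)"
  by (simp add: frechet_derivative_works)

lemma C_diff_const: "C_diff k (\<lambda>x. c)"
proof (induction k arbitrary: c)
  case (Suc k)
  show ?case by (rule C_diff_SucI[where u'="\<lambda>x h. 0"]) (auto intro: Suc)
qed simp

lemma C_diff_coordinate: "C_diff k (\<lambda>x. x $ i)"
proof (cases k)
  case (Suc k)
  show ?thesis unfolding Suc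
    by (rule C_diff_SucI[where u'="\<lambda>x h. h $ i"])
      (auto intro!: C_diff_const bounded_linear_imp_has_derivative bounded_linear_vec_nth)
qed (auto intro!: continuous_intros)

lemma C_diff_add: "C_diff k u \<Longrightarrow> C_diff k w \<Longrightarrow> C_diff k (\<lambda>x. u x + w x)"
proof (induction k arbitrary: u w)
  case (Suc k)
  show ?case
  proof (rule C_diff_SucI)
    fix x show "((\<lambda>x. u x + w x) has_derivative
      (\<lambda>h. frechet_derivative u (at x) h + frechet_derivative w (at x) h)) (at x)"
      using Suc.prems by (intro derivative_intros C_diff_has_derivative)
  next
    fix i
    have "C_diff k (partial i u)" "C_diff k (partial i w)" using Suc.prems by auto
    then have "C_diff k (\<lambda>x. partial i u x + partial i w x)" by (rule Suc.IH)
    then show "C_diff k (\<lambda>x. frechet_derivative u (at x) (axis i 1)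
        + frechet_derivative w (at x) (axis i 1))"
      by (simp add: partial_def)
  qed
qed (auto intro!: continuous_intros)

lemma C_diff_mult: "C_diff k u \<Longrightarrow> C_diff k w \<Longrightarrow> C_diff k (\<lambda>x. u x * w x)"
proof (induction k arbitrary: u w)
  case (Suc k)
  show ?case
  proof (rule C_diff_SucI)
    fix x show "((\<lambda>x. u x * w x) has_derivative
      (\<lambda>h. u x * frechet_derivative w (at x) h + frechet_derivative u (at x) h * w x)) (at x)"
      using Suc.prems by (intro has_derivative_mult C_diff_has_derivative)
  next
    fix i
    have "C_diff k (partial i u)" "C_diff k (partial i w)" using Suc.prems by auto
    then have "C_diff k (\<lambda>x. u x * partial i w x + partial i u x * w x)"
      by (intro C_diff_add Suc.IH C_diff_SucD[OF Suc.prems(1)] C_diff_SucD[OF Suc.prems(2)])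
    then show "C_diff k (\<lambda>x. u x * frechet_derivative w (at x) (axis i 1)
        + frechet_derivative u (at x) (axis i 1) * w x)"
      by (simp add: partial_def)
  qed
qed (auto intro!: continuous_intros)

text \<open>Unlike \<open>C_diff\<close>, the derivative is existentially quantified, so that an explicit formula for it
can be supplied.\<close>

fun smooth_upto :: "nat \<Rightarrow> (real \<Rightarrow> real) \<Rightarrow> bool" where
  "smooth_upto 0 f \<longleftrightarrow> continuous_on UNIV f"
| "smooth_upto (Suc k) f \<longleftrightarrow>
     (\<exists>f'. (\<forall>t. (f has_real_derivative f' t) (at t)) \<and> smooth_upto k f')"

lemma smooth_upto_imp_continuous:
  assumes "smooth_upto k f"
  shows "continuous_on UNIV f"
proof (cases k)
  case (Suc k)
  then obtain f' where "\<And>t. (f has_real_derivative f' t) (at t)" using assms by auto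
  then show ?thesis using DERIV_continuous_on[of UNIV f f'] by simp
qed (use assms in simp)

lemma smooth_upto_SucI:
  assumes "\<And>t. (f has_real_derivative f' t) (at t)" "smooth_upto k f'"
  shows "smooth_upto (Suc k) f"
  using assms by auto

lemma smooth_upto_SucD: "smooth_upto (Suc k) f \<Longrightarrow> smooth_upto k f"
proof (induction k arbitrary: f)
  case 0
  then show ?case using smooth_upto_imp_continuous[of "Suc 0" f]
    by (simp del: smooth_upto.simps(2))
next
  case (Suc k)
  from Suc.prems obtain f' where "\<And>t. (f has_real_derivative f' t) (at t)" "smooth_upto (Suc k) f'"
    unfolding smooth_upto.simps(2)[of "Suc k"] by blast
  then show ?case using Suc.IH by (intro smooth_upto_SucI[where f'=f'])
qed

lemma smooth_upto_const: "smooth_upto k (\<lambda>t. c)"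
proof (induction k arbitrary: c)
  case (Suc k)
  show ?case by (rule smooth_upto_SucI[OF DERIV_const Suc])
qed simp

lemma smooth_upto_ident: "smooth_upto k (\<lambda>t. t)"
proof (cases k)
  case (Suc k)
  show ?thesis unfolding Suc
    by (rule smooth_upto_SucI[where f'="\<lambda>t. 1"]) (auto intro: smooth_upto_const)
qed simp

lemma smooth_upto_exp: "smooth_upto k exp"
proof (induction k)
  case (Suc k)
  show ?case by (rule smooth_upto_SucI[OF DERIV_exp Suc])
qed (auto intro: continuous_intros)

lemma smooth_upto_add:
  "smooth_upto k f \<Longrightarrow> smooth_upto k g \<Longrightarrow> smooth_upto k (\<lambda>t. f t + g t)"
proof (induction k arbitrary: f g)
  case (Suc k)
  from Suc.prems obtain f' g' where "\<And>t. (f has_real_derivative f' t) (at t)" "smooth_upto k f'"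
    "\<And>t. (g has_real_derivative g' t) (at t)" "smooth_upto k g'"
    unfolding smooth_upto.simps(2) by blast
  then show ?case
    by (intro smooth_upto_SucI[where f'="\<lambda>t. f' t + g' t"] derivative_intros Suc.IH)
qed (auto intro!: continuous_intros)

lemma smooth_upto_mult:
  "smooth_upto k f \<Longrightarrow> smooth_upto k g \<Longrightarrow> smooth_upto k (\<lambda>t. f t * g t)"
proof (induction k arbitrary: f g)
  case (Suc k)
  from Suc.prems obtain f' g' where *: "\<And>t. (f has_real_derivative f' t) (at t)" "smooth_upto k f'"
    "\<And>t. (g has_real_derivative g' t) (at t)" "smooth_upto k g'"
    unfolding smooth_upto.simps(2) by blast
  have "smooth_upto k (\<lambda>t. f' t * g t + g' t * f t)"
    by (intro smooth_upto_add Suc.IH * smooth_upto_SucD[OF Suc.prems(1)]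
        smooth_upto_SucD[OF Suc.prems(2)])
  then show ?case
    by (rule smooth_upto_SucI[rotated]) (rule DERIV_mult[OF *(1) *(3)])
qed (auto intro!: continuous_intros)

lemma smooth_upto_compose:
  "smooth_upto k f \<Longrightarrow> smooth_upto k g \<Longrightarrow> smooth_upto k (\<lambda>t. f (g t))"
proof (induction k arbitrary: f g)
  case 0
  then show ?case
    using continuous_on_compose2[of UNIV f UNIV g] by simp
next
  case (Suc k)
  from Suc.prems obtain f' g' where *: "\<And>t. (f has_real_derivative f' t) (at t)" "smooth_upto k f'"
    "\<And>t. (g has_real_derivative g' t) (at t)" "smooth_upto k g'"
    unfolding smooth_upto.simps(2) by blast
  have "smooth_upto k (\<lambda>t. f' (g t) * g' t)"
    by (rule smooth_upto_mult[OF Suc.IH[OF *(2) smooth_upto_SucD[OF Suc.prems(2)]] *(4)])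
  then show ?case
    by (rule smooth_upto_SucI[rotated]) (rule DERIV_chain2[where f=f, OF *(1) *(3)])
qed

lemma radial_has_derivative:
  fixes x :: "'a::euclidean_space"
  assumes "(h has_real_derivative d) (at (x \<bullet> x))"
  shows "((\<lambda>x. h (x \<bullet> x)) has_derivative (\<lambda>y. (2 * d) *\<^sub>R x \<bullet> y)) (at x)"
proof -
  have "(h has_derivative (\<lambda>t. d * t)) (at (x \<bullet> x))"
    using assms by (simp add: has_field_derivative_def)
  moreover have "((\<lambda>x. x \<bullet> x) has_derivative (\<lambda>y. 2 * (x \<bullet> y))) (at x)"
    by (auto intro!: derivative_eq_intros simp: inner_commute)
  ultimately have "((\<lambda>x. h (x \<bullet> x)) has_derivative (\<lambda>y. d * (2 * (x \<bullet> y)))) (at x)"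
    by (rule has_derivative_compose[rotated])
  then show ?thesis by (simp add: mult_ac)
qed

text \<open>The chain rule with \<open>|x|^2\<close>, a polynomial, reduces smoothness of radial functions, at the
origin too, to one variable.\<close>

lemma C_diff_radial: "smooth_upto k h \<Longrightarrow> C_diff k (\<lambda>x. h (x \<bullet> x))"
proof (induction k arbitrary: h)
  case 0
  then show ?case
    using continuous_on_compose2[of UNIV h UNIV "\<lambda>x::real^2. x \<bullet> x"]
    by (simp add: continuous_on_inner continuous_on_id)
next
  case (Suc k)
  from Suc.prems obtain h' where h': "\<And>t. (h has_real_derivative h' t) (at t)" "smooth_upto k h'"
    unfolding smooth_upto.simps(2) by blast
  show ?case
  proof (rule C_diff_SucI)
    show "((\<lambda>x. h (x \<bullet> x)) has_derivative (\<lambda>y. (2 * h' (x \<bullet> x)) *\<^sub>R x \<bullet> y)) (at x)" for x :: "real^2"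
      by (rule radial_has_derivative[OF h'(1)])
    fix i :: 2
    have "C_diff k (\<lambda>x. (2 * h' (x \<bullet> x)) * x $ i)"
      by (intro C_diff_mult C_diff_const C_diff_coordinate Suc.IH h')
    then show "C_diff k (\<lambda>x. (2 * h' (x \<bullet> x)) *\<^sub>R x \<bullet> axis i 1)"
      by (simp add: inner_axis)
  qed
qed

section \<open>Pairs of quadratic forms\<close>

text \<open>Semidefiniteness is enough: Cauchy sequences modulo null sequences make sense for a seminorm.\<close>

locale semi_inner_product =
  fixes E :: "('a \<Rightarrow> real) set" and B :: "('a \<Rightarrow> real) \<Rightarrow> ('a \<Rightarrow> real) \<Rightarrow> real"
  assumes add_closed: "u \<in> E \<Longrightarrow> w \<in> E \<Longrightarrow> (\<lambda>x. u x + w x) \<in> E"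
    and scale_closed: "u \<in> E \<Longrightarrow> (\<lambda>x. c * u x) \<in> E"
    and form_add: "u \<in> E \<Longrightarrow> w \<in> E \<Longrightarrow> z \<in> E \<Longrightarrow> B (\<lambda>x. u x + w x) z = B u z + B w z"
    and form_scale: "u \<in> E \<Longrightarrow> z \<in> E \<Longrightarrow> B (\<lambda>x. c * u x) z = c * B u z"
    and form_sym: "u \<in> E \<Longrightarrow> w \<in> E \<Longrightarrow> B u w = B w u"
    and form_nonneg: "u \<in> E \<Longrightarrow> 0 \<le> B u u"
begin

definition seminorm :: "('a \<Rightarrow> real) \<Rightarrow> real" where
  "seminorm u = sqrt (B u u)"

lemma diff_closed: "u \<in> E \<Longrightarrow> w \<in> E \<Longrightarrow> (\<lambda>x. u x - w x) \<in> E"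
  using add_closed[OF _ scale_closed[of w "-1"], of u] by simp

lemma form_diff:
  "u \<in> E \<Longrightarrow> w \<in> E \<Longrightarrow> z \<in> E \<Longrightarrow> B (\<lambda>x. u x - w x) z = B u z - B w z"
  using form_add[OF _ scale_closed[of w "-1"], of u z] form_scale[of w z "-1"] by simp

lemma form_diff_right:
  "u \<in> E \<Longrightarrow> w \<in> E \<Longrightarrow> z \<in> E \<Longrightarrow> B z (\<lambda>x. u x - w x) = B z u - B z w"
  using form_diff[of u w z] form_sym diff_closed by simp

lemma seminorm_nonneg: "0 \<le> seminorm u" if "u \<in> E"
  using form_nonneg[OF that] by (simp add: seminorm_def)

lemma seminorm_square: "u \<in> E \<Longrightarrow> (seminorm u)\<^sup>2 = B u u"
  by (simp add: seminorm_def form_nonneg)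

lemma form_add_scaled:
  assumes "u \<in> E" "w \<in> E"
  shows "B (\<lambda>x. u x + c * w x) (\<lambda>x. u x + c * w x) = B u u + 2 * c * B u w + c\<^sup>2 * B w w"
proof -
  let ?z = "\<lambda>x. u x + c * w x"
  have z: "?z \<in> E" using assms by (intro add_closed scale_closed)
  have *: "B ?z y = B u y + c * B w y" if "y \<in> E" for y
    using that assms by (simp add: form_add[OF _ scale_closed] form_scale)
  have "B ?z ?z = B ?z u + c * B ?z w"
    using *[OF z] form_sym[OF _ z] assms by simp
  also have "\<dots> = B u u + 2 * c * B u w + c\<^sup>2 * B w w"
    using * form_sym assms by (simp add: algebra_simps power2_eq_square)
  finally show ?thesis .
qed

text \<open>The quadratic polynomial \<open>c \<mapsto> B (u + c w) (u + c w)\<close> is nonnegative; it is evaluated at its minimum,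
or, when its leading coefficient vanishes, at a point where a nonzero slope would make it negative.\<close>

lemma Cauchy_Schwarz:
  assumes "u \<in> E" "w \<in> E"
  shows "(B u w)\<^sup>2 \<le> B u u * B w w"
proof -
  have *: "0 \<le> B u u + 2 * c * B u w + c\<^sup>2 * B w w" for c
    using form_nonneg[OF add_closed[OF assms(1) scale_closed[OF assms(2)]], of c]
      form_add_scaled[OF assms, of c] by simp
  show ?thesis
  proof (cases "B w w = 0")
    case True
    have "B u w = 0"
    proof (rule ccontr)
      assume "B u w \<noteq> 0"
      then show False
        using *[of "- (B u u + 1) / (2 * B u w)"] True by (simp add: field_simps)
    qed
    then show ?thesis using True by simp
  next
    case False
    then have "0 < B w w" using form_nonneg[OF assms(2)] by simp
    then show ?thesis
      using *[of "- B u w / B w w"] by (simp add: field_simps power2_eq_square)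
  qed
qed

lemma abs_form_le: "u \<in> E \<Longrightarrow> w \<in> E \<Longrightarrow> \<bar>B u w\<bar> \<le> seminorm u * seminorm w"
  using real_sqrt_le_mono[OF Cauchy_Schwarz] by (simp add: seminorm_def real_sqrt_mult)

lemma seminorm_scale: "u \<in> E \<Longrightarrow> seminorm (\<lambda>x. c * u x) = \<bar>c\<bar> * seminorm u"
  using form_scale[of u _ c] form_sym scale_closed[of u c]
  by (simp add: seminorm_def real_sqrt_mult power2_eq_square[symmetric] mult.assoc[symmetric])

lemma seminorm_triangle:
  assumes "u \<in> E" "w \<in> E"
  shows "seminorm (\<lambda>x. u x + w x) \<le> seminorm u + seminorm w"
proof (rule power2_le_imp_le)
  have "(seminorm (\<lambda>x. u x + w x))\<^sup>2 = B u u + 2 * B u w + B w w"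
    using form_add_scaled[OF assms, of 1] by (simp add: seminorm_square add_closed assms)
  also have "\<dots> \<le> (seminorm u + seminorm w)\<^sup>2"
    using abs_form_le[OF assms] assms by (simp add: power2_sum seminorm_square)
  finally show "(seminorm (\<lambda>x. u x + w x))\<^sup>2 \<le> (seminorm u + seminorm w)\<^sup>2" .
qed (simp add: seminorm_nonneg assms)

lemma seminorm_minus_commute:
  "u \<in> E \<Longrightarrow> w \<in> E \<Longrightarrow> seminorm (\<lambda>x. u x - w x) = seminorm (\<lambda>x. w x - u x)"
  using seminorm_scale[OF diff_closed, of u w "-1"] by simp

lemma seminorm_diff_triangle:
  "u \<in> E \<Longrightarrow> w \<in> E \<Longrightarrow> z \<in> E \<Longrightarrow>
    seminorm (\<lambda>x. u x - z x) \<le> seminorm (\<lambda>x. u x - w x) + seminorm (\<lambda>x. w x - z x)"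
  using seminorm_triangle[OF diff_closed diff_closed, of u w w z] by simp

lemma seminorm_diff_le:
  "u \<in> E \<Longrightarrow> w \<in> E \<Longrightarrow> seminorm (\<lambda>x. u x - w x) \<le> seminorm u + seminorm w"
  using seminorm_triangle[OF _ scale_closed[of w "-1"], of u] seminorm_scale[of w "-1"] by simp

lemma seminorm_le_diff:
  "u \<in> E \<Longrightarrow> w \<in> E \<Longrightarrow> seminorm u \<le> seminorm w + seminorm (\<lambda>x. u x - w x)"
  using seminorm_triangle[OF _ diff_closed, of w u w] by simp

definition Cauchy_seq :: "(nat \<Rightarrow> 'a \<Rightarrow> real) \<Rightarrow> bool" where
  "Cauchy_seq s \<longleftrightarrow> (\<forall>e>0. \<exists>N. \<forall>m\<ge>N. \<forall>n\<ge>N. seminorm (\<lambda>x. s m x - s n x) < e)"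

lemma Cauchy_seq_bounded:
  assumes s: "\<And>n. s n \<in> E" and "Cauchy_seq s"
  obtains M where "\<And>n. seminorm (s n) \<le> M"
proof -
  obtain N where N: "\<And>m n. N \<le> m \<Longrightarrow> N \<le> n \<Longrightarrow> seminorm (\<lambda>x. s m x - s n x) < 1"
    using assms(2) zero_less_one unfolding Cauchy_seq_def by meson
  define M where "M = Max ((\<lambda>n. seminorm (s n)) ` {..N}) + 1"
  have "seminorm (s n) \<le> M" for n
  proof (cases "n \<le> N")
    case True
    then have "seminorm (s n) \<le> Max ((\<lambda>n. seminorm (s n)) ` {..N})" by (intro Max_ge) auto
    then show ?thesis by (simp add: M_def)
  next
    case False
    have "seminorm (s n) \<le> seminorm (s N) + seminorm (\<lambda>x. s n x - s N x)"
      by (intro seminorm_le_diff s)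
    moreover have "seminorm (s N) \<le> Max ((\<lambda>n. seminorm (s n)) ` {..N})" by (intro Max_ge) auto
    ultimately show ?thesis using N[of n N] False unfolding M_def by linarith
  qed
  then show ?thesis using that by blast
qed

lemma Cauchy_seq_diff:
  assumes s: "\<And>n. s n \<in> E" and t: "\<And>n. t n \<in> E" and "Cauchy_seq s" "Cauchy_seq t"
  shows "Cauchy_seq (\<lambda>n x. s n x - t n x)"
  unfolding Cauchy_seq_def
proof (intro allI impI)
  fix e :: real assume "0 < e"
  then have "0 < e / 2" by simp
  then obtain N1 N2
    where N1: "\<And>m n. N1 \<le> m \<Longrightarrow> N1 \<le> n \<Longrightarrow> seminorm (\<lambda>x. s m x - s n x) < e / 2"
      and N2: "\<And>m n. N2 \<le> m \<Longrightarrow> N2 \<le> n \<Longrightarrow> seminorm (\<lambda>x. t m x - t n x) < e / 2"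
    using assms(3,4) unfolding Cauchy_seq_def by meson
  show "\<exists>N. \<forall>m\<ge>N. \<forall>n\<ge>N. seminorm (\<lambda>x. s m x - t m x - (s n x - t n x)) < e"
  proof (intro exI allI impI)
    fix m n assume mn: "max N1 N2 \<le> m" "max N1 N2 \<le> n"
    have "seminorm (\<lambda>x. s m x - t m x - (s n x - t n x))
        = seminorm (\<lambda>x. (s m x - s n x) - (t m x - t n x))"
      by (intro arg_cong[where f=seminorm]) (auto simp: algebra_simps)
    also have "\<dots> \<le> seminorm (\<lambda>x. s m x - s n x) + seminorm (\<lambda>x. t m x - t n x)"
      by (intro seminorm_diff_le diff_closed s t)
    also have "\<dots> < e" using N1[of m n] N2[of m n] mn by simp
    finally show "seminorm (\<lambda>x. s m x - t m x - (s n x - t n x)) < e" .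
  qed
qed

lemma seminorm_zero: "u \<in> E \<Longrightarrow> seminorm (\<lambda>x. 0) = 0"
  using seminorm_scale[of u 0] by simp

lemma null_diff_sym:
  assumes "\<And>n. s n \<in> E" "\<And>n. t n \<in> E" "(\<lambda>n. seminorm (\<lambda>x. s n x - t n x)) \<longlonglongrightarrow> 0"
  shows "(\<lambda>n. seminorm (\<lambda>x. t n x - s n x)) \<longlonglongrightarrow> 0"
  using assms(3) seminorm_minus_commute[OF assms(1,2)] by simp

lemma null_diff_trans:
  assumes "\<And>n. r n \<in> E" "\<And>n. s n \<in> E" "\<And>n. t n \<in> E"
    and "(\<lambda>n. seminorm (\<lambda>x. r n x - s n x)) \<longlonglongrightarrow> 0" "(\<lambda>n. seminorm (\<lambda>x. s n x - t n x)) \<longlonglongrightarrow> 0"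
  shows "(\<lambda>n. seminorm (\<lambda>x. r n x - t n x)) \<longlonglongrightarrow> 0"
proof (rule Lim_null_comparison)
  show "\<forall>\<^sub>F n in sequentially. norm (seminorm (\<lambda>x. r n x - t n x))
      \<le> seminorm (\<lambda>x. r n x - s n x) + seminorm (\<lambda>x. s n x - t n x)"
    using seminorm_diff_triangle[OF assms(1,2,3)] seminorm_nonneg[OF diff_closed[OF assms(1,3)]]
    by (intro always_eventually allI) simp
  show "(\<lambda>n. seminorm (\<lambda>x. r n x - s n x) + seminorm (\<lambda>x. s n x - t n x)) \<longlonglongrightarrow> 0"
    using tendsto_add[OF assms(4,5)] by simp
qed

end

text \<open>The situation at the critical parameter: \<open>q\<close> does not dominate \<open>v\<close> (\<open>no_gap\<close>), but smallness of
\<open>q\<close> forces weak smallness for \<open>v\<close> on \<open>v\<close>-bounded sets (\<open>weak_control\<close>).\<close>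

locale degenerate_form_pair =
  q: semi_inner_product E q + v: semi_inner_product E v
  for E :: "('a \<Rightarrow> real) set" and q v +
  assumes weak_control: "\<psi> \<in> E \<Longrightarrow>
      \<exists>K. \<forall>u\<in>E. (v u \<psi>)\<^sup>2 \<le> K * (v.seminorm u * q.seminorm u)"
    and no_gap: "0 < \<delta> \<Longrightarrow> \<exists>\<phi>\<in>E. v \<phi> \<phi> > 0 \<and> q \<phi> \<phi> \<le> \<delta> * v \<phi> \<phi>"
begin

lemma weak_null:
  assumes u: "\<And>n. u n \<in> E" and "\<psi> \<in> E" and M: "\<And>n. v.seminorm (u n) \<le> M"
    and lim: "(\<lambda>n. q.seminorm (u n)) \<longlonglongrightarrow> 0"
  shows "(\<lambda>n. v (u n) \<psi>) \<longlonglongrightarrow> 0"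
proof -
  obtain K where K: "\<And>u. u \<in> E \<Longrightarrow> (v u \<psi>)\<^sup>2 \<le> K * (v.seminorm u * q.seminorm u)"
    using weak_control[OF \<open>\<psi> \<in> E\<close>] by blast
  have "0 \<le> M" using v.seminorm_nonneg[OF u, of 0] M[of 0] by linarith
  have "(v (u n) \<psi>)\<^sup>2 \<le> \<bar>K\<bar> * (M * q.seminorm (u n))" for n
  proof -
    have "(v (u n) \<psi>)\<^sup>2 \<le> K * (v.seminorm (u n) * q.seminorm (u n))" by (intro K u)
    also have "\<dots> \<le> \<bar>K\<bar> * (M * q.seminorm (u n))"
      using M u \<open>0 \<le> M\<close> by (intro mult_mono) (auto intro!: mult_nonneg_nonneg
        q.seminorm_nonneg v.seminorm_nonneg mult_right_mono)
    finally show ?thesis .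
  qed
  moreover have "(\<lambda>n. \<bar>K\<bar> * (M * q.seminorm (u n))) \<longlonglongrightarrow> 0"
    using tendsto_mult_left[OF tendsto_mult_left[OF lim], of "\<bar>K\<bar>" M] by simp
  ultimately have "(\<lambda>n. (v (u n) \<psi>)\<^sup>2) \<longlonglongrightarrow> 0"
    by - (rule Lim_null_comparison[where g="\<lambda>n. \<bar>K\<bar> * (M * q.seminorm (u n))"],
        simp_all)
  then show ?thesis
    using tendsto_real_sqrt[of "\<lambda>n. (v (u n) \<psi>)\<^sup>2" 0] tendsto_rabs_zero_iff by auto
qed

text \<open>Being \<open>v\<close>-Cauchy, the sequence is \<open>v\<close>-close to one of its own members \<open>s N\<close>, while \<open>v (s n) (s N)\<close> tends
to \<open>0\<close> because weak limits are \<open>0\<close>. So \<open>v (s n) (s n)\<close> tends to \<open>0\<close>.\<close>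

lemma closable:
  assumes s: "\<And>n. s n \<in> E" and "v.Cauchy_seq s" and lim: "(\<lambda>n. q.seminorm (s n)) \<longlonglongrightarrow> 0"
  shows "(\<lambda>n. v.seminorm (s n)) \<longlonglongrightarrow> 0"
proof -
  obtain M where M: "\<And>n. v.seminorm (s n) \<le> M" using v.Cauchy_seq_bounded[OF assms(1,2)] by blast
  have "0 \<le> M" using M[of 0] v.seminorm_nonneg[OF s, of 0] by linarith
  have "(\<lambda>n. v (s n) (s n)) \<longlonglongrightarrow> 0"
  proof (rule LIMSEQ_I)
    fix e :: real assume "0 < e"
    define d where "d = e / (2 * (M + 1))"
    have "0 < d" using \<open>0 < e\<close> \<open>0 \<le> M\<close> by (simp add: d_def)
    then obtain N where N: "\<And>m n. N \<le> m \<Longrightarrow> N \<le> n \<Longrightarrow> v.seminorm (\<lambda>x. s m x - s n x) < d"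
      using assms(2) unfolding v.Cauchy_seq_def by meson
    have "(\<lambda>n. v (s n) (s N)) \<longlonglongrightarrow> 0" by (rule weak_null[OF s s M lim])
    then obtain N' where N': "\<And>n. N' \<le> n \<Longrightarrow> \<bar>v (s n) (s N)\<bar> < e / 2"
      using \<open>0 < e\<close> LIMSEQ_D[of "\<lambda>n. v (s n) (s N)" 0 "e/2"] by auto
    have "norm (v (s n) (s n) - 0) < e" if n: "max N N' \<le> n" for n
    proof -
      have "v (s n) (s n) = v (s n) (s N) + v (s n) (\<lambda>x. s n x - s N x)"
        using v.form_diff_right[OF s s s, of n n N] by simp
      also have "\<dots> < e / 2 + M * d"
      proof (intro add_less_le_mono)
        show "v (s n) (s N) < e / 2" using N'[of n] n by simp
        have "v (s n) (\<lambda>x. s n x - s N x) \<le> v.seminorm (s n) * v.seminorm (\<lambda>x. s n x - s N x)"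
          using v.abs_form_le[OF s v.diff_closed[OF s s], of n n N] by simp
        also have "\<dots> \<le> M * d"
          using M N[of n N] n \<open>0 \<le> M\<close> v.seminorm_nonneg[OF v.diff_closed[OF s s]]
          by (intro mult_mono) auto
        finally show "v (s n) (\<lambda>x. s n x - s N x) \<le> M * d" .
      qed
      also have "\<dots> \<le> e" using \<open>0 \<le> M\<close> \<open>0 < e\<close> by (simp add: d_def field_simps)
      finally show ?thesis using v.form_nonneg[OF s] by simp
    qed
    then show "\<exists>no. \<forall>n\<ge>no. norm (v (s n) (s n) - 0) < e" by blast
  qed
  then show ?thesis
    using tendsto_real_sqrt[of "\<lambda>n. v (s n) (s n)" 0] by (simp add: v.seminorm_def)
qed

text \<open>The elements of the open \<open>q\<close>-ball of radius \<open>\<delta>\<close> around \<open>u\<close> all have \<open>v\<close>-seminorm above \<open>M\<close>. In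
terms of completions: the ball misses the image of the \<open>v\<close>-ball of radius \<open>M\<close>.\<close>

definition repels :: "real \<Rightarrow> real \<Rightarrow> ('a \<Rightarrow> real) \<Rightarrow> bool" where
  "repels M \<delta> u \<longleftrightarrow> (\<forall>w\<in>E. q.seminorm (\<lambda>x. u x - w x) < \<delta> \<longrightarrow> M < v.seminorm w)"

text \<open>Images of \<open>v\<close>-balls are nowhere dense. If neither \<open>u\<close> nor \<open>u + \<phi>\<close> had a repelling ball, both would be
\<open>q\<close>-limits of sequences with \<open>v\<close>-seminorm at most \<open>M\<close>, hence \<open>\<phi>\<close> would be a \<open>q\<close>-limit of a sequence with
\<open>v\<close>-seminorm at most \<open>2 M\<close>. By weak control the seminorm of \<open>\<phi>\<close> cannot exceed \<open>2 M\<close> either; but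
there are \<open>\<phi>\<close> with large \<open>v\<close>-seminorm and \<open>q\<close>-seminorm at most \<open>\<eta>\<close>.\<close>

lemma repels_dense:
  assumes "u \<in> E" "0 < \<eta>"
  obtains u' \<delta> where "u' \<in> E" "0 < \<delta>" "q.seminorm (\<lambda>x. u' x - u x) \<le> \<eta>" "repels M \<delta> u'"
proof (cases "\<exists>\<delta>>0. repels M \<delta> u")
  case True
  have "q.seminorm (\<lambda>x. u x - u x) \<le> \<eta>"
    using q.seminorm_scale[OF assms(1), of 0] assms by simp
  then show ?thesis using True that assms by blast
next
  case False
  \<comment> \<open>the \<open>v\<close>-seminorm of the perturbation \<open>\<phi>\<close>, chosen to exceed \<open>2 M\<close>\<close>
  define R where "R = 2 * \<bar>M\<bar> + 1"
  have "0 < R" by (simp add: R_def)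
  obtain \<xi> where \<xi>: "\<xi> \<in> E" "0 < v \<xi> \<xi>" "q \<xi> \<xi> \<le> (\<eta> / R)\<^sup>2 * v \<xi> \<xi>"
    using no_gap[of "(\<eta> / R)\<^sup>2"] \<open>0 < \<eta>\<close> \<open>0 < R\<close> by auto
  define \<phi> where "\<phi> = (\<lambda>x. R / v.seminorm \<xi> * \<xi> x)"
  have pos: "0 < v.seminorm \<xi>" using \<xi> by (simp add: v.seminorm_def)
  have \<phi>: "\<phi> \<in> E" unfolding \<phi>_def by (intro q.scale_closed \<xi>)
  have v\<phi>: "v.seminorm \<phi> = R"
    unfolding \<phi>_def v.seminorm_scale[OF \<xi>(1)] using pos \<open>0 < R\<close> by simp
  have "q.seminorm \<xi> \<le> \<eta> / R * v.seminorm \<xi>"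
    using real_sqrt_le_mono[OF \<xi>(3)] \<open>0 < \<eta>\<close> \<open>0 < R\<close>
    by (simp add: q.seminorm_def v.seminorm_def real_sqrt_mult)
  then have q\<phi>: "q.seminorm \<phi> \<le> \<eta>"
    unfolding \<phi>_def q.seminorm_scale[OF \<xi>(1)] using pos \<open>0 < R\<close> by (simp add: field_simps)
  define u' where "u' = (\<lambda>x. u x + \<phi> x)"
  have u': "u' \<in> E" unfolding u'_def by (intro q.add_closed \<phi> assms)
  have near: "q.seminorm (\<lambda>x. u' x - u x) \<le> \<eta>" using q\<phi> by (simp add: u'_def)
  have "\<exists>\<delta>>0. repels M \<delta> u'"
  proof (rule ccontr)
    assume no: "\<not> ?thesis"
    have "\<exists>w\<in>E. q.seminorm (\<lambda>x. u x - w x) < 1 / real (Suc n) \<and> v.seminorm w \<le> M" for n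
      using False unfolding repels_def by (meson divide_pos_pos not_less of_nat_0_less_iff
        zero_less_Suc zero_less_one)
    then obtain a where a: "\<And>n. a n \<in> E" "\<And>n. q.seminorm (\<lambda>x. u x - a n x) < 1 / real (Suc n)"
      "\<And>n. v.seminorm (a n) \<le> M" by metis
    have "\<exists>w\<in>E. q.seminorm (\<lambda>x. u' x - w x) < 1 / real (Suc n) \<and> v.seminorm w \<le> M" for n
      using no unfolding repels_def by (meson divide_pos_pos not_less of_nat_0_less_iff
        zero_less_Suc zero_less_one)
    then obtain b where b: "\<And>n. b n \<in> E" "\<And>n. q.seminorm (\<lambda>x. u' x - b n x) < 1 / real (Suc n)"
      "\<And>n. v.seminorm (b n) \<le> M" by metis
    define z where "z n = (\<lambda>x. (u' x - b n x) - (u x - a n x))" for n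
    have z: "z n \<in> E" for n unfolding z_def by (intro q.diff_closed a b u' assms)
    have z_eq: "z n = (\<lambda>x. \<phi> x - (b n x - a n x))" for n
      by (auto simp: z_def u'_def)
    have ba: "(\<lambda>x. b n x - a n x) \<in> E" for n by (intro q.diff_closed a b)
    have vba: "v.seminorm (\<lambda>x. b n x - a n x) \<le> 2 * M" for n
      using v.seminorm_diff_le[OF b(1) a(1), of n n] a(3)[of n] b(3)[of n] by simp
    have "q.seminorm (z n) \<le> 2 * inverse (real (Suc n))" for n
      using q.seminorm_diff_le[OF q.diff_closed[OF u' b(1)] q.diff_closed[OF assms(1) a(1)], of n n]
        a(2)[of n] b(2)[of n] by (simp add: z_def inverse_eq_divide)
    moreover have "(\<lambda>n. 2 * inverse (real (Suc n))) \<longlonglongrightarrow> 0"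
      using tendsto_mult_left[OF LIMSEQ_inverse_real_of_nat, of 2] by simp
    ultimately have "(\<lambda>n. q.seminorm (z n)) \<longlonglongrightarrow> 0"
      using q.seminorm_nonneg[OF z]
      by - (rule Lim_null_comparison[where g="\<lambda>n. 2 * inverse (real (Suc n))"],
          simp_all)
    moreover have "v.seminorm (z n) \<le> R + 2 * M" for n
      using v.seminorm_diff_le[OF \<phi> ba, of n] vba[of n] v\<phi> by (simp add: z_eq)
    ultimately have "(\<lambda>n. v (z n) \<phi>) \<longlonglongrightarrow> 0" by (intro weak_null[OF z \<phi>])
    moreover have "R \<le> v (z n) \<phi>" for n
    proof -
      have "v (\<lambda>x. b n x - a n x) \<phi> \<le> 2 * M * R"
        using v.abs_form_le[OF ba \<phi>, of n] mult_right_mono[OF vba[of n], of R] \<open>0 < R\<close>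
        unfolding v\<phi> by linarith
      moreover have "v (z n) \<phi> = R * R - v (\<lambda>x. b n x - a n x) \<phi>"
        unfolding z_eq v.form_diff[OF \<phi> ba \<phi>]
        using v.seminorm_square[OF \<phi>] by (simp add: v\<phi> power2_eq_square)
      moreover have "R * 1 \<le> R * (R - 2 * M)"
        using \<open>0 < R\<close> by (intro mult_left_mono) (auto simp: R_def)
      then have "R \<le> R * R - 2 * M * R" by (simp add: algebra_simps)
      ultimately show ?thesis by simp
    qed
    ultimately show False using \<open>0 < R\<close> LIMSEQ_le_const[of _ 0 R] by fastforce
  qed
  then show ?thesis using that u' near by blast
qed

text \<open>A Baire category argument, carried out on test functions: nested
\<open>q\<close>-balls are chosen so that the one with index \<open>n\<close> repels at level \<open>n\<close>. Their centres form a
\<open>q\<close>-Cauchy sequence, and a sequence approaching it in \<open>q\<close> enters every ball.\<close>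

lemma not_surjective:
  obtains s where "\<And>n. s n \<in> E" "q.Cauchy_seq s"
    "\<And>t M. (\<And>n. t n \<in> E) \<Longrightarrow> (\<And>n. v.seminorm (t n) \<le> M) \<Longrightarrow>
       \<not> (\<lambda>n. q.seminorm (\<lambda>x. s n x - t n x)) \<longlonglongrightarrow> 0"
proof -
  define good where "good n p \<longleftrightarrow> fst p \<in> E \<and> 0 < snd p \<and> snd p \<le> inverse (real (Suc n))
    \<and> repels (real n) (snd p) (fst p)" for n and p :: "('a \<Rightarrow> real) \<times> real"
  define step where "step p p' \<longleftrightarrow>
    q.seminorm (\<lambda>x. fst p' x - fst p x) + snd p' \<le> snd p / 2" for p p' :: "('a \<Rightarrow> real) \<times> real"
  have ex: "\<exists>p'. good n p' \<and> step p p'" if p: "fst p \<in> E" "0 < snd p" for n p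
  proof -
    have "0 < snd p / 4" using p by simp
    then obtain u' \<delta> where *: "u' \<in> E" "0 < \<delta>" "q.seminorm (\<lambda>x. u' x - fst p x) \<le> snd p / 4"
        "repels (real n) \<delta> u'"
      using repels_dense[OF p(1), of "snd p / 4" "real n"] by blast
    define \<delta>' where "\<delta>' = min \<delta> (min (snd p / 4) (inverse (real (Suc n))))"
    have "good n (u', \<delta>')" "step p (u', \<delta>')"
      using * p by (auto simp: good_def step_def \<delta>'_def repels_def)
    then show ?thesis by blast
  qed
  obtain \<xi> where \<xi>: "\<xi> \<in> E" using no_gap[of 1] by auto
  have "\<exists>f. \<forall>n. good n (f n) \<and> step (f n) (f (Suc n))"
  proof (rule dependent_nat_choice)
    show "\<exists>p. good 0 p" using ex[of "(\<xi>, 1)" 0] \<xi> by auto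
    show "\<exists>p'. good (Suc n) p' \<and> step p p'" if "good n p" for p n
      using ex[of p "Suc n"] that by (auto simp: good_def)
  qed
  then obtain f where f: "\<And>n. good n (f n)" "\<And>n. step (f n) (f (Suc n))" by blast
  define s where "s n = fst (f n)" for n
  define \<delta> where "\<delta> n = snd (f n)" for n
  have s: "s n \<in> E" and \<delta>: "0 < \<delta> n" "\<delta> n \<le> inverse (real (Suc n))" "repels (real n) (\<delta> n) (s n)" for n
    using f(1)[of n] by (auto simp: good_def s_def \<delta>_def)
  have step: "q.seminorm (\<lambda>x. s (Suc n) x - s n x) + \<delta> (Suc n) \<le> \<delta> n / 2" for n
    using f(2)[of n] by (simp add: step_def s_def \<delta>_def)
  have nested: "q.seminorm (\<lambda>x. s (k + j) x - s k x) + \<delta> (k + j) \<le> \<delta> k" for k j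
  proof (induction j)
    case 0
    show ?case using q.seminorm_scale[OF s, of 0] by simp
  next
    case (Suc j)
    have "q.seminorm (\<lambda>x. s (Suc (k + j)) x - s k x)
        \<le> q.seminorm (\<lambda>x. s (Suc (k + j)) x - s (k + j) x) + q.seminorm (\<lambda>x. s (k + j) x - s k x)"
      by (intro q.seminorm_diff_triangle s)
    then show ?case using Suc step[of "k + j"] \<delta>(1)[of "k + j"] by simp
  qed
  have half: "q.seminorm (\<lambda>x. s n x - s k x) \<le> \<delta> k / 2" if "k < n" for k n
  proof -
    obtain j where n: "n = Suc k + j" using \<open>k < n\<close> by (metis add_Suc less_imp_Suc_add)
    have "q.seminorm (\<lambda>x. s n x - s k x)
        \<le> q.seminorm (\<lambda>x. s n x - s (Suc k) x) + q.seminorm (\<lambda>x. s (Suc k) x - s k x)"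
      by (intro q.seminorm_diff_triangle s)
    then show ?thesis using nested[of "Suc k" j] step[of k] \<delta>(1)[of n] by (simp add: n)
  qed
  have "q.Cauchy_seq s"
    unfolding q.Cauchy_seq_def
  proof (intro allI impI)
    fix e :: real assume "0 < e"
    then obtain k where k: "inverse (real (Suc k)) < e"
      using reals_Archimedean by blast
    show "\<exists>N. \<forall>m\<ge>N. \<forall>n\<ge>N. q.seminorm (\<lambda>x. s m x - s n x) < e"
    proof (intro exI allI impI)
      fix m n assume mn: "Suc k \<le> m" "Suc k \<le> n"
      have "q.seminorm (\<lambda>x. s m x - s n x)
          \<le> q.seminorm (\<lambda>x. s m x - s k x) + q.seminorm (\<lambda>x. s k x - s n x)"
        by (intro q.seminorm_diff_triangle s)
      also have "\<dots> \<le> \<delta> k / 2 + \<delta> k / 2"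
        using half[of k m] half[of k n] mn q.seminorm_minus_commute[OF s s, of k n] by simp
      also have "\<dots> < e" using k \<delta>(2)[of k] by simp
      finally show "q.seminorm (\<lambda>x. s m x - s n x) < e" .
    qed
  qed
  moreover have "\<not> (\<lambda>n. q.seminorm (\<lambda>x. s n x - t n x)) \<longlonglongrightarrow> 0"
    if t: "\<And>n. t n \<in> E" and M: "\<And>n. v.seminorm (t n) \<le> M" for t M
  proof
    assume lim: "(\<lambda>n. q.seminorm (\<lambda>x. s n x - t n x)) \<longlonglongrightarrow> 0"
    obtain k where k: "M \<le> real k" using real_arch_simple by blast
    obtain N where N: "\<And>n. N \<le> n \<Longrightarrow> q.seminorm (\<lambda>x. s n x - t n x) < \<delta> k / 2"
      using LIMSEQ_D[OF lim, of "\<delta> k / 2"] \<delta>(1)[of k] q.seminorm_nonneg[OF q.diff_closed[OF s t]]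
      by auto
    define n where "n = max N (Suc k)"
    have "q.seminorm (\<lambda>x. s k x - t n x)
        \<le> q.seminorm (\<lambda>x. s k x - s n x) + q.seminorm (\<lambda>x. s n x - t n x)"
      by (intro q.seminorm_diff_triangle s t)
    also have "\<dots> < \<delta> k"
      using half[of k n] N[of n] q.seminorm_minus_commute[OF s s, of k n]
      by (simp add: n_def less_max_iff_disj)
    finally have "real k < v.seminorm (t n)" using \<delta>(3)[of k] t by (simp add: repels_def)
    then show False using M[of n] k by simp
  qed
  ultimately show ?thesis using that s by blast
qed

end

section \<open>Fluxes of radial vector fields\<close>

lemma integrable_continuous_bounded_support:
  fixes f :: "'a::euclidean_space \<Rightarrow> real"
  assumes "continuous_on UNIV f" "\<And>x. R < norm x \<Longrightarrow> f x = 0"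
  shows "integrable lborel f"
proof -
  have "compact (f ` cball 0 R)"
    by (intro compact_continuous_image continuous_on_subset[OF assms(1)]) auto
  then obtain B where B: "\<And>x. x \<in> cball 0 R \<Longrightarrow> norm (f x) \<le> B"
    using compact_imp_bounded[of "f ` cball 0 R"] by (force simp: bounded_iff)
  show ?thesis
  proof (rule integrableI_bounded_set[where A="cball 0 R" and B=B])
    show "f \<in> borel_measurable lborel"
      using assms(1) by (simp add: borel_measurable_continuous_onI)
    show "emeasure lborel (cball (0::'a) R) < \<infinity>"
      by (intro emeasure_bounded_finite bounded_cball)
  qed (use B assms(2) in auto)
qed

lemma has_derivative_zero_outside:
  fixes f :: "'a::euclidean_space \<Rightarrow> real"
  assumes "(f has_derivative f') (at x)" "\<And>x. R < norm x \<Longrightarrow> f x = 0" "R < norm x"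
  shows "f' = (\<lambda>h. 0)"
proof -
  have "open {x. R < norm (x::'a)}" by (intro open_Collect_less continuous_intros)
  then have "(f has_derivative (\<lambda>h. 0)) (at x)"
    using assms by (intro has_derivative_transform_within_open[OF has_derivative_const]) auto
  then show ?thesis using assms(1) has_derivative_unique by blast
qed

text \<open>By translation invariance of Lebesgue measure the difference quotients of \<open>f\<close> in direction \<open>e\<close> have
integral \<open>0\<close>. They are uniformly bounded and supported in a fixed ball, so dominated convergence
carries this over to the derivative.\<close>

lemma integral_directional_derivative:
  fixes f :: "'a::euclidean_space \<Rightarrow> real"
  assumes deriv: "\<And>x. (f has_derivative f' x) (at x)"
    and cont: "continuous_on UNIV (\<lambda>x. f' x e)"
    and supp: "\<And>x. R < norm x \<Longrightarrow> f x = 0"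
  shows "integrable lborel (\<lambda>x. f' x e)" and "(\<integral>x. f' x e \<partial>lborel) = 0"
proof -
  have supp': "f' x e = 0" if "R < norm x" for x
    using has_derivative_zero_outside[OF deriv supp that] by metis
  then show int': "integrable lborel (\<lambda>x. f' x e)"
    by (rule integrable_continuous_bounded_support[OF cont])
  have cf: "continuous_on UNIV f"
    using deriv by (intro has_derivative_continuous_on[where f'=f'])
  then have int: "integrable lborel f"
    by (rule integrable_continuous_bounded_support[OF _ supp])
  have [measurable]: "f \<in> borel_measurable borel"
    using cf by (rule borel_measurable_continuous_onI)
  have "compact ((\<lambda>x. f' x e) ` cball 0 R)"
    by (intro compact_continuous_image continuous_on_subset[OF cont]) auto
  then obtain B where B: "\<And>x. x \<in> cball 0 R \<Longrightarrow> \<bar>f' x e\<bar> \<le> B"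
    using compact_imp_bounded[of "(\<lambda>x. f' x e) ` cball 0 R"] by (force simp: bounded_iff)
  have bound: "\<bar>f' x e\<bar> \<le> \<bar>B\<bar>" for x
    using B[of x] supp'[of x] by (cases "R < norm x") auto
  have along: "((\<lambda>t. f (x + t *\<^sub>R e)) has_real_derivative f' (x + t *\<^sub>R e) e) (at t)" for x t
  proof -
    have "((\<lambda>t. x + t *\<^sub>R e) has_derivative (\<lambda>h. h *\<^sub>R e)) (at t)"
      by (auto intro!: derivative_eq_intros)
    from has_derivative_compose[OF this deriv]
    have "((\<lambda>t. f (x + t *\<^sub>R e)) has_derivative (\<lambda>h. f' (x + t *\<^sub>R e) (h *\<^sub>R e))) (at t)" .
    moreover have "(\<lambda>h. f' (x + t *\<^sub>R e) (h *\<^sub>R e)) = (*) (f' (x + t *\<^sub>R e) e)"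
      using linear_cmul[OF has_derivative_linear[OF deriv]] by (auto simp: fun_eq_iff)
    ultimately show ?thesis by (simp add: has_field_derivative_def)
  qed
  define h where "h n = inverse (real (Suc n))" for n
  have h: "0 < h n" "h n \<le> 1" for n by (auto simp: h_def divide_simps)
  have h0: "h \<longlonglongrightarrow> 0" unfolding h_def by (rule LIMSEQ_inverse_real_of_nat)
  define D where "D n x = (f (h n *\<^sub>R e + x) - f x) / h n" for n x
  have lim: "(\<lambda>n. D n x) \<longlonglongrightarrow> f' x e" for x
  proof -
    have "(\<lambda>t. (f (x + t *\<^sub>R e) - f (x + 0 *\<^sub>R e)) / (t - 0)) \<midarrow>0\<rightarrow> f' x e"
      using along[of x 0] by (simp add: has_field_derivative_iff)
    moreover have "filterlim h (at 0) sequentially"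
      using h0 h by (auto simp: filterlim_at intro!: always_eventually less_imp_neq[symmetric])
    ultimately have "(\<lambda>n. (f (x + h n *\<^sub>R e) - f (x + 0 *\<^sub>R e)) / (h n - 0)) \<longlonglongrightarrow> f' x e"
      by (rule filterlim_compose)
    then show ?thesis by (simp add: D_def add.commute)
  qed
  have Dbound: "\<bar>D n x\<bar> \<le> \<bar>B\<bar>" for n x
  proof -
    obtain z where "f (x + h n *\<^sub>R e) - f (x + 0 *\<^sub>R e) = (h n - 0) * f' (x + z *\<^sub>R e) e"
      using MVT2[of 0 "h n" "\<lambda>t. f (x + t *\<^sub>R e)" "\<lambda>t. f' (x + t *\<^sub>R e) e"] along h(1)[of n] by blast
    then show ?thesis using bound h(1)[of n] by (simp add: D_def add.commute)
  qed
  have Dsupp: "D n x = 0" if "\<bar>R\<bar> + norm e < norm x" for n x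
  proof -
    have "norm x \<le> norm (h n *\<^sub>R e + x) + norm (h n *\<^sub>R e)"
      using norm_triangle_ineq4[of "h n *\<^sub>R e + x" "h n *\<^sub>R e"] by simp
    moreover have "norm (h n *\<^sub>R e) \<le> 1 * norm e"
      unfolding norm_scaleR using h[of n] by (intro mult_right_mono) auto
    ultimately have "R < norm (h n *\<^sub>R e + x)" "R < norm x"
      using that norm_ge_zero[of e] by linarith+
    then show ?thesis using supp by (simp add: D_def)
  qed
  have [measurable]: "D n \<in> borel_measurable borel" for n
    unfolding D_def by measurable
  have shift: "integrable lborel (\<lambda>x. f (c + x)) \<and> (\<integral>x. f (c + x) \<partial>lborel) = (\<integral>x. f x \<partial>lborel)" for c
    using integrable_distr_eq[of "(+) c" lborel lborel f] integral_distr[of "(+) c" lborel lborel f] int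
    by (simp add: lborel_distr_plus cong: distr_cong)
  have zero: "(\<integral>x. D n x \<partial>lborel) = 0" for n
    unfolding D_def using shift[of "h n *\<^sub>R e"] int by simp
  have "(\<lambda>n. \<integral>x. D n x \<partial>lborel) \<longlonglongrightarrow> (\<integral>x. f' x e \<partial>lborel)"
  proof (rule integral_dominated_convergence)
    show "integrable lborel (\<lambda>x::'a. \<bar>B\<bar> * indicator (cball 0 (\<bar>R\<bar> + norm e)) x)"
      by (intro integrable_mult_right integrable_real_indicator) (auto simp: emeasure_bounded_finite[unfolded infinity_ennreal_def])
    show "(\<lambda>x. f' x e) \<in> borel_measurable lborel" using int' by simp
    show "AE x in lborel. norm (D n x) \<le> \<bar>B\<bar> * indicator (cball 0 (\<bar>R\<bar> + norm e)) x" for n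
      using Dbound Dsupp by (auto simp: indicator_def not_le)
  qed (use lim in auto)
  then show "(\<integral>x. f' x e \<partial>lborel) = 0"
    by (simp add: zero LIMSEQ_const_iff)
qed

text \<open>This is the divergence theorem for the vector field \<open>\<phi>(x) g(|x|^2) x\<close>, whose divergence is
\<open>A + D\<close>. As \<open>g\<close> is differentiable on a neighbourhood of \<open>0\<close>, there is no singularity here.\<close>

lemma radial_flux:
  fixes \<phi> :: "'a::euclidean_space \<Rightarrow> real"
  assumes g: "\<And>\<rho>. \<rho> < 1 \<Longrightarrow> (g has_real_derivative g' \<rho>) (at \<rho>)"
    and g': "continuous_on {..<1} g'"
    and \<phi>: "\<And>x. (\<phi> has_derivative \<phi>' x) (at x)"
    and \<phi>': "\<And>b. b \<in> Basis \<Longrightarrow> continuous_on UNIV (\<lambda>x. \<phi>' x b)"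
    and supp: "\<And>x. R < norm x \<Longrightarrow> \<phi> x = 0" and "R < 1"
  defines "A \<equiv> \<lambda>x. g (x \<bullet> x) * \<phi>' x x"
    and "D \<equiv> \<lambda>x. \<phi> x * (real DIM('a) * g (x \<bullet> x) + 2 * (x \<bullet> x) * g' (x \<bullet> x))"
  shows "integrable lborel A" "integrable lborel D" "(\<integral>x. A x + D x \<partial>lborel) = 0"
proof -
  have supp': "\<phi>' x = (\<lambda>h. 0)" if "R < norm x" for x
    using has_derivative_zero_outside[OF \<phi> supp that] .
  have inside: "x \<bullet> x < 1" if "norm x < 1" for x :: 'a
    using that power_strict_mono[of "norm x" 1 2] by (simp add: power2_norm_eq_inner)
  have c\<phi>: "continuous_on UNIV \<phi>"
    using \<phi> by (intro has_derivative_continuous_on[where f'=\<phi>'])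
  have cg: "continuous_on {..<1} g"
    using g by (auto intro!: DERIV_continuous_on intro: has_field_derivative_at_within)
  have cg1: "continuous_on (ball 0 1) (\<lambda>x::'a. g (x \<bullet> x))"
    using inside by (intro continuous_on_compose2[OF cg]) (auto intro!: continuous_intros)
  have cg2: "continuous_on (ball 0 1) (\<lambda>x::'a. g' (x \<bullet> x))"
    using inside by (intro continuous_on_compose2[OF g']) (auto intro!: continuous_intros)
  have glue: "continuous_on UNIV k"
    if "continuous_on (ball 0 1) k" "\<And>x. R < norm x \<Longrightarrow> k x = 0" for k :: "'a \<Rightarrow> real"
  proof -
    have "open {x. R < norm (x::'a)}" by (intro open_Collect_less continuous_intros)
    moreover have "continuous_on {x. R < norm x} k"
      using that(2) by (intro continuous_on_eq[OF continuous_on_const[of _ 0]]) auto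
    ultimately have "continuous_on (ball 0 1 \<union> {x. R < norm x}) k"
      using that(1) by (intro continuous_on_open_Un) auto
    moreover have "ball 0 1 \<union> {x. R < norm x} = (UNIV :: 'a set)" using \<open>R < 1\<close> by auto
    ultimately show ?thesis by simp
  qed
  have lin: "linear (\<phi>' x)" for x using \<phi> has_derivative_linear by blast
  have expand: "\<phi>' x x = (\<Sum>b\<in>Basis. (x \<bullet> b) * \<phi>' x b)" for x
  proof -
    have "\<phi>' x x = \<phi>' x (\<Sum>b\<in>Basis. (x \<bullet> b) *\<^sub>R b)" by (simp add: euclidean_representation)
    also have "\<dots> = (\<Sum>b\<in>Basis. (x \<bullet> b) * \<phi>' x b)"
      by (simp only: linear_sum[OF lin] linear_cmul[OF lin]) simp
    finally show ?thesis .
  qed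
  define F where "F b x h = \<phi>' x h * (g (x \<bullet> x) * (x \<bullet> b))
     + \<phi> x * (g' (x \<bullet> x) * (2 * (x \<bullet> h)) * (x \<bullet> b) + g (x \<bullet> x) * (h \<bullet> b))" for b x h
  have F: "((\<lambda>x. \<phi> x * (g (x \<bullet> x) * (x \<bullet> b))) has_derivative F b x) (at x)" for b x
  proof (cases "norm x < 1")
    case True
    have gd: "((\<lambda>x. g (x \<bullet> x)) has_derivative (\<lambda>y. (2 * g' (x \<bullet> x)) *\<^sub>R x \<bullet> y)) (at x)"
      by (rule radial_has_derivative[OF g[OF inside[OF True]]])
    show ?thesis unfolding F_def
      by (rule derivative_eq_intros \<phi> gd refl)+ (auto simp: fun_eq_iff algebra_simps)
  next
    case False
    then have "R < norm x" using \<open>R < 1\<close> by simp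
    then have F0: "F b x = (\<lambda>h. 0)" using supp supp' by (auto simp: F_def)
    have "open {x. R < norm (x::'a)}" by (intro open_Collect_less continuous_intros)
    then show ?thesis
      unfolding F0
      by (rule has_derivative_transform_within_open[OF has_derivative_const])
        (use supp \<open>R < norm x\<close> in auto)
  qed
  have cF: "continuous_on UNIV (\<lambda>x. F b x b)" if "b \<in> Basis" for b
  proof (rule glue)
    show "continuous_on (ball 0 1) (\<lambda>x. F b x b)"
      unfolding F_def using \<phi>'[OF that] c\<phi>
      by (intro continuous_intros cg1 cg2) (auto elim: continuous_on_subset)
  qed (use supp supp' in \<open>auto simp: F_def\<close>)
  have intF: "integrable lborel (\<lambda>x. F b x b)" "(\<integral>x. F b x b \<partial>lborel) = 0" if "b \<in> Basis" for b
    using integral_directional_derivative[OF F cF[OF that], of R] supp by auto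
  have sumF: "A x + D x = (\<Sum>b\<in>Basis. F b x b)" for x
  proof -
    have "(\<Sum>b\<in>Basis. F b x b) = (\<Sum>b\<in>Basis. g (x \<bullet> x) * ((x \<bullet> b) * \<phi>' x b)
        + (\<phi> x * (2 * g' (x \<bullet> x))) * ((x \<bullet> b) * (x \<bullet> b)) + \<phi> x * g (x \<bullet> x))"
      by (intro sum.cong) (auto simp: F_def algebra_simps)
    also have "\<dots> = g (x \<bullet> x) * \<phi>' x x + (\<phi> x * (2 * g' (x \<bullet> x))) * (x \<bullet> x)
        + real DIM('a) * (\<phi> x * g (x \<bullet> x))"
      by (simp add: sum.distrib sum_distrib_left[symmetric] expand[symmetric]
          euclidean_inner[symmetric])
    finally show ?thesis by (simp add: A_def D_def algebra_simps)
  qed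
  have cA: "continuous_on (ball 0 1) A"
    unfolding A_def expand
    by (intro continuous_intros cg1 continuous_on_subset[OF \<phi>']) auto
  have A0: "A x = 0" and D0: "D x = 0" if "R < norm x" for x
    using that by (simp_all add: A_def D_def supp supp')
  show "integrable lborel A"
    by (rule integrable_continuous_bounded_support[OF glue[OF cA A0] A0])
  have cD: "continuous_on (ball 0 1) D"
    unfolding D_def by (intro continuous_intros cg1 cg2 continuous_on_subset[OF c\<phi>]) auto
  show "integrable lborel D"
    by (rule integrable_continuous_bounded_support[OF glue[OF cD D0] D0])
  show "(\<integral>x. A x + D x \<partial>lborel) = 0"
    unfolding sumF using intF by (subst Bochner_Integration.integral_sum) auto
qed

section \<open>Radial fields that are singular at the origin\<close>

lemma max_square_has_derivative:
  "((\<lambda>z::real. (max 0 z)\<^sup>2) has_real_derivative 2 * max 0 z) (at z)"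
proof -
  consider "z < 0" | "z = 0" | "0 < z" by linarith
  then show ?thesis
  proof cases
    case 1
    have "((\<lambda>z::real. (max 0 z)\<^sup>2) has_real_derivative 0) (at z)"
      by (rule has_field_derivative_transform_within_open[where S="{..<0}" and f="\<lambda>_. 0"])
        (use 1 in auto)
    then show ?thesis using 1 by simp
  next
    case 2
    have "((\<lambda>h::real. max 0 h) \<longlongrightarrow> max 0 0) (at 0)"
      by (intro tendsto_intros)
    moreover have "\<forall>\<^sub>F h in at (0::real). max 0 h = ((max 0 h)\<^sup>2 - (max 0 0)\<^sup>2) / (h - 0)"
      by (auto simp: eventually_at_filter max_def power2_eq_square)
    ultimately have "((\<lambda>h::real. ((max 0 h)\<^sup>2 - (max 0 0)\<^sup>2) / (h - 0)) \<longlongrightarrow> max 0 0) (at 0)"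
      by (rule Lim_transform_eventually)
    then show ?thesis using 2 by (simp add: has_field_derivative_iff)
  next
    case 3
    have "((\<lambda>z::real. (max 0 z)\<^sup>2) has_real_derivative 2 * z) (at z)"
      by (rule has_field_derivative_transform_within_open[where S="{0<..}" and f="\<lambda>z. z\<^sup>2"])
        (use 3 in \<open>auto intro!: derivative_eq_intros\<close>)
    then show ?thesis using 3 by simp
  qed
qed

text \<open>The truncations \<open>cut \<epsilon> y\<close> are continuously differentiable, vanish for \<open>y \<le> \<epsilon>\<close>, stay below \<open>y\<close>, have
slope at most \<open>1\<close>, and converge to \<open>y\<close> together with their slopes (for \<open>y > 0\<close>, as \<open>\<epsilon>\<close> tends to \<open>0\<close>). Cutting off the values of a profile,
rather than its argument, keeps the derivative below that of the profile.\<close>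

definition cut :: "real \<Rightarrow> real \<Rightarrow> real" where
  "cut \<epsilon> y = (max 0 (y - \<epsilon>))\<^sup>2 / y"

definition cut_deriv :: "real \<Rightarrow> real \<Rightarrow> real" where
  "cut_deriv \<epsilon> y = max 0 (y - \<epsilon>) * (2 * y - max 0 (y - \<epsilon>)) / y\<^sup>2"

lemma cut_has_derivative:
  assumes "0 < y"
  shows "(cut \<epsilon> has_real_derivative cut_deriv \<epsilon> y) (at y)"
proof -
  have "((\<lambda>y. (max 0 (y - \<epsilon>))\<^sup>2) has_real_derivative 2 * max 0 (y - \<epsilon>) * 1) (at y)"
    by (rule DERIV_chain2[OF max_square_has_derivative]) (auto intro!: derivative_eq_intros)
  from DERIV_divide[OF this DERIV_ident] assms
  have "((\<lambda>y. (max 0 (y - \<epsilon>))\<^sup>2 / y) has_real_derivative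
      (2 * max 0 (y - \<epsilon>) * 1 * y - (max 0 (y - \<epsilon>))\<^sup>2 * 1) / (y * y)) (at y)" by simp
  then show ?thesis
    by (simp add: cut_def[abs_def] cut_deriv_def algebra_simps power2_eq_square)
qed

lemma cut_deriv_continuous: "continuous_on {0<..} (cut_deriv \<epsilon>)"
  unfolding cut_deriv_def by (intro continuous_intros) auto

lemma cut_bounds:
  assumes "0 < \<epsilon>" "0 < y"
  shows "0 \<le> cut \<epsilon> y" "cut \<epsilon> y \<le> y" "0 \<le> cut_deriv \<epsilon> y" "cut_deriv \<epsilon> y \<le> 1"
proof -
  define m where "m = max 0 (y - \<epsilon>)"
  have m: "0 \<le> m" "m \<le> y" using assms by (auto simp: m_def)
  then have "m\<^sup>2 \<le> y * y" unfolding power2_eq_square by (intro mult_mono) auto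
  then show "0 \<le> cut \<epsilon> y" "cut \<epsilon> y \<le> y"
    using assms by (auto simp: cut_def m_def[symmetric] divide_simps)
  have "m * (2 * y - m) = y\<^sup>2 - (y - m)\<^sup>2" by (simp add: power2_eq_square algebra_simps)
  also have "\<dots> \<le> y\<^sup>2" by simp
  finally have "m * (2 * y - m) \<le> y\<^sup>2" .
  then show "0 \<le> cut_deriv \<epsilon> y" "cut_deriv \<epsilon> y \<le> 1"
    using assms m by (auto simp: cut_deriv_def m_def[symmetric] divide_simps)
qed

lemma cut_small: "y \<le> \<epsilon> \<Longrightarrow> cut \<epsilon> y = 0" "y \<le> \<epsilon> \<Longrightarrow> cut_deriv \<epsilon> y = 0"
  by (auto simp: cut_def cut_deriv_def)

lemma cut_limits:
  assumes "0 < y" "e \<longlonglongrightarrow> 0"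
  shows "(\<lambda>n. cut (e n) y) \<longlonglongrightarrow> y" "(\<lambda>n. cut_deriv (e n) y) \<longlonglongrightarrow> 1"
proof -
  have "(\<lambda>n. max 0 (y - e n)) \<longlonglongrightarrow> max 0 (y - 0)"
    by (intro tendsto_intros assms)
  then have m: "(\<lambda>n. max 0 (y - e n)) \<longlonglongrightarrow> y" using assms by simp
  have "(\<lambda>n. cut (e n) y) \<longlonglongrightarrow> y\<^sup>2 / y"
    unfolding cut_def using assms by (intro tendsto_intros m) auto
  then show "(\<lambda>n. cut (e n) y) \<longlonglongrightarrow> y" using assms by (simp add: power2_eq_square)
  have "(\<lambda>n. cut_deriv (e n) y) \<longlonglongrightarrow> y * (2 * y - y) / y\<^sup>2"
    unfolding cut_deriv_def using assms by (intro tendsto_intros m) auto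
  then show "(\<lambda>n. cut_deriv (e n) y) \<longlonglongrightarrow> 1" using assms by (simp add: power2_eq_square)
qed

text \<open>A vector field \<open>b(|x|^2) x / |x|^2\<close> in the plane has flux \<open>2 \<pi> b(\<rho>)\<close> through the circle
\<open>|x|^2 = \<rho>\<close>. The condition \<open>vanish\<close> says that no flux enters from the origin, and its divergence
away from the origin is \<open>2 b'(|x|^2)\<close>.\<close>

locale increasing_profile =
  fixes b b' :: "real \<Rightarrow> real"
  assumes pos: "0 < \<rho> \<Longrightarrow> \<rho> < 1 \<Longrightarrow> 0 < b \<rho>"
    and deriv: "0 < \<rho> \<Longrightarrow> \<rho> < 1 \<Longrightarrow> (b has_real_derivative b' \<rho>) (at \<rho>)"
    and nonneg: "0 < \<rho> \<Longrightarrow> \<rho> < 1 \<Longrightarrow> 0 \<le> b' \<rho>"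
    and cont: "continuous_on {0<..<1} b'"
    and vanish: "(b \<longlongrightarrow> 0) (at_right 0)"
begin

lemma mono:
  assumes "0 < \<rho>" "\<rho> \<le> \<sigma>" "\<sigma> < 1"
  shows "b \<rho> \<le> b \<sigma>"
proof (rule DERIV_nonneg_imp_nondecreasing[OF assms(2)])
  fix x assume "\<rho> \<le> x" "x \<le> \<sigma>"
  then show "\<exists>y. (b has_real_derivative y) (at x) \<and> 0 \<le> y"
    using deriv[of x] nonneg[of x] assms by auto
qed

text \<open>Since \<open>b\<close> vanishes at \<open>0\<close>, the truncated field is zero near the origin. In \<open>D\<close> the origin is
excluded because \<open>b\<close> and \<open>b'\<close> are arbitrary at \<open>0\<close>.\<close>

lemma truncated_identity:
  fixes \<phi> :: "real^2 \<Rightarrow> real"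
  assumes "0 < \<epsilon>"
    and \<phi>: "\<And>x. (\<phi> has_derivative \<phi>' x) (at x)"
    and \<phi>': "\<And>i. continuous_on UNIV (\<lambda>x. \<phi>' x (axis i 1))"
    and supp: "\<And>x. R < norm x \<Longrightarrow> \<phi> x = 0" and "R < 1"
  defines "A \<equiv> \<lambda>x. cut \<epsilon> (b (x \<bullet> x)) / (x \<bullet> x) * \<phi>' x x"
    and "D \<equiv> \<lambda>x. if x = 0 then 0
      else 2 * (\<phi> x * (cut_deriv \<epsilon> (b (x \<bullet> x)) * b' (x \<bullet> x)))"
  shows "integrable lborel A" "integrable lborel D" "(\<integral>x. A x + D x \<partial>lborel) = 0"
proof -
  have "\<forall>\<^sub>F \<rho> in at_right 0. b \<rho> < \<epsilon>"
    using vanish \<open>0 < \<epsilon>\<close> by (rule order_tendstoD)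
  then obtain d where d: "0 < d" "\<And>\<rho>. 0 < \<rho> \<Longrightarrow> \<rho> < d \<Longrightarrow> b \<rho> < \<epsilon>"
    by (auto simp: eventually_at_right_field)
  define g where "g \<rho> = (if 0 < \<rho> then cut \<epsilon> (b \<rho>) / \<rho> else 0)" for \<rho>
  define g' where "g' \<rho> = (if 0 < \<rho>
    then (cut_deriv \<epsilon> (b \<rho>) * b' \<rho> * \<rho> - cut \<epsilon> (b \<rho>)) / \<rho>\<^sup>2 else 0)" for \<rho>
  have near: "g \<rho> = 0" "g' \<rho> = 0" if "\<rho> < d" for \<rho>
    using d(2)[of \<rho>] that by (auto simp: g_def g'_def cut_small)
  have g: "(g has_real_derivative g' \<rho>) (at \<rho>)" if "\<rho> < 1" for \<rho>
  proof (cases "0 < \<rho>")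
    case True
    have "((\<lambda>\<rho>. cut \<epsilon> (b \<rho>)) has_real_derivative cut_deriv \<epsilon> (b \<rho>) * b' \<rho>) (at \<rho>)"
      using True that by (intro DERIV_chain2[OF cut_has_derivative] pos deriv)
    from DERIV_divide[OF this DERIV_ident] True
    have "((\<lambda>\<rho>. cut \<epsilon> (b \<rho>) / \<rho>) has_real_derivative g' \<rho>) (at \<rho>)"
      by (simp add: g'_def power2_eq_square)
    then show ?thesis
      by (rule has_field_derivative_transform_within_open[where S="{0<..}"])
        (use True in \<open>auto simp: g_def\<close>)
  next
    case False
    have "(g has_real_derivative 0) (at \<rho>)"
      by (rule has_field_derivative_transform_within_open[where S="{..<d}" and f="\<lambda>_. 0"])
        (use False d(1) near in auto)
    then show ?thesis using near(2)[of \<rho>] False d(1) by simp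
  qed
  have g': "continuous_on {..<1} g'"
  proof -
    have cb: "continuous_on {0<..<1} b"
      by (rule DERIV_continuous_on[where D=b']) (auto intro: has_field_derivative_at_within deriv)
    have cut: "continuous_on {0<..} (cut \<epsilon>)"
      by (rule DERIV_continuous_on[where D="cut_deriv \<epsilon>"])
        (auto intro: has_field_derivative_at_within cut_has_derivative)
    have "continuous_on {0<..<1} (\<lambda>\<rho>. (cut_deriv \<epsilon> (b \<rho>) * b' \<rho> * \<rho> - cut \<epsilon> (b \<rho>)) / \<rho>\<^sup>2)"
      by (intro continuous_intros cont continuous_on_compose2[OF cut_deriv_continuous cb]
          continuous_on_compose2[OF cut cb]) (auto intro: pos)
    then have "continuous_on {0<..<1} g'"
      by (rule continuous_on_eq) (auto simp: g'_def)
    moreover have "continuous_on {..<d} g'"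
      by (rule continuous_on_eq[OF continuous_on_const[of _ 0]]) (simp add: near)
    ultimately have "continuous_on ({0<..<1} \<union> {..<d}) g'"
      by (intro continuous_on_open_Un) auto
    then show ?thesis by (rule continuous_on_subset) (use d(1) in auto)
  qed
  have ax: "continuous_on UNIV (\<lambda>x. \<phi>' x e)" if "e \<in> Basis" for e
    using that \<phi>' by (auto simp: Basis_vec_def)
  note flux = radial_flux[of g g', OF g g' \<phi> ax supp \<open>R < 1\<close>]
  have A: "g (x \<bullet> x) * \<phi>' x x = A x" for x by (auto simp: g_def A_def)
  have D: "\<phi> x * (real DIM(real^2) * g (x \<bullet> x) + 2 * (x \<bullet> x) * g' (x \<bullet> x)) = D x" for x
    by (auto simp: D_def g_def g'_def field_simps power2_eq_square)
  show "integrable lborel A" "integrable lborel D" "(\<integral>x. A x + D x \<partial>lborel) = 0"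
    using flux unfolding A D by auto
qed

text \<open>Dominated convergence in the truncated identities; term by term the
truncated integrands are bounded by those of the limit.\<close>

lemma limit_identity:
  fixes \<phi> :: "real^2 \<Rightarrow> real"
  assumes \<phi>: "\<And>x. (\<phi> has_derivative \<phi>' x) (at x)"
    and \<phi>': "\<And>i. continuous_on UNIV (\<lambda>x. \<phi>' x (axis i 1))"
    and supp: "\<And>x. R < norm x \<Longrightarrow> \<phi> x = 0" and "R < 1"
    and int: "integrable lborel (\<lambda>x. b (x \<bullet> x) / (x \<bullet> x) * \<phi>' x x)"
      "integrable lborel (\<lambda>x. \<phi> x * b' (x \<bullet> x))"
  shows "(\<integral>x. b (x \<bullet> x) / (x \<bullet> x) * \<phi>' x x + 2 * (\<phi> x * b' (x \<bullet> x)) \<partial>lborel) = 0"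
proof -
  define e where "e n = inverse (real (Suc n))" for n
  have e: "0 < e n" for n by (simp add: e_def)
  have e0: "e \<longlonglongrightarrow> 0" unfolding e_def by (rule LIMSEQ_inverse_real_of_nat)
  define A where "A n x = cut (e n) (b (x \<bullet> x)) / (x \<bullet> x) * \<phi>' x x" for n x
  define D where "D n x = (if x = 0 then 0
      else 2 * (\<phi> x * (cut_deriv (e n) (b (x \<bullet> x)) * b' (x \<bullet> x))))" for n x
  note trunc = truncated_identity[OF e \<phi> \<phi>' supp \<open>R < 1\<close>, folded A_def D_def]
  define f where "f x = b (x \<bullet> x) / (x \<bullet> x) * \<phi>' x x + 2 * (\<phi> x * b' (x \<bullet> x))" for x
  define w where "w x = \<bar>b (x \<bullet> x) / (x \<bullet> x) * \<phi>' x x\<bar> + 2 * \<bar>\<phi> x * b' (x \<bullet> x)\<bar>" for x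
  have cases: "x = 0 \<or> (0 < x \<bullet> x \<and> x \<bullet> x < 1) \<or> (\<phi> x = 0 \<and> \<phi>' x = (\<lambda>h. 0))" for x
  proof (cases "R < norm x")
    case True
    then show ?thesis using has_derivative_zero_outside[OF \<phi> supp True] supp by blast
  next
    case False
    then have "norm x < 1" using \<open>R < 1\<close> by simp
    then show ?thesis using power_strict_mono[of "norm x" 1 2] by (auto simp: power2_norm_eq_inner)
  qed
  have "(\<lambda>n. \<integral>x. A n x + D n x \<partial>lborel) \<longlonglongrightarrow> (\<integral>x. f x \<partial>lborel)"
  proof (rule integral_dominated_convergence)
    show "integrable lborel w" unfolding w_def
      by (intro Bochner_Integration.integrable_add integrable_abs integrable_mult_right int)
    show "f \<in> borel_measurable lborel"
      unfolding f_def using borel_measurable_integrable[OF int(1)]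
        borel_measurable_integrable[OF int(2)] by measurable
    show "(\<lambda>x. A n x + D n x) \<in> borel_measurable lborel" for n
      using trunc(1,2)[of n] by simp
    have "(\<lambda>n. A n x + D n x) \<longlonglongrightarrow> f x" if nz: "x \<noteq> 0" for x
    proof -
      consider "0 < x \<bullet> x" "x \<bullet> x < 1" | "\<phi> x = 0" "\<phi>' x = (\<lambda>h. 0)"
        using cases[of x] nz by auto
      then show ?thesis
      proof cases
        case 1
        have "(\<lambda>n. cut (e n) (b (x \<bullet> x)) / (x \<bullet> x) * \<phi>' x x
            + 2 * (\<phi> x * (cut_deriv (e n) (b (x \<bullet> x)) * b' (x \<bullet> x))))
            \<longlonglongrightarrow> b (x \<bullet> x) / (x \<bullet> x) * \<phi>' x x + 2 * (\<phi> x * (1 * b' (x \<bullet> x)))"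
          using 1 by (intro tendsto_intros cut_limits pos e0) auto
        then show ?thesis using nz by (simp add: A_def D_def f_def)
      next
        case 2
        then show ?thesis using nz by (simp add: A_def D_def f_def)
      qed
    qed
    then show "AE x in lborel. (\<lambda>n. A n x + D n x) \<longlonglongrightarrow> f x"
      using AE_lborel_singleton[of 0] by (auto elim: eventually_mono)
    have "norm (A n x + D n x) \<le> w x" for n x
    proof -
      consider "x = 0" | "x \<noteq> 0" "0 < x \<bullet> x" "x \<bullet> x < 1" | "\<phi> x = 0" "\<phi>' x = (\<lambda>h. 0)"
        using cases[of x] by auto
      then show ?thesis
      proof cases
        case 2
        then have *: "0 < b (x \<bullet> x)" using pos by simp
        have "\<bar>A n x\<bar> \<le> \<bar>b (x \<bullet> x) / (x \<bullet> x) * \<phi>' x x\<bar>"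
          unfolding A_def abs_mult using cut_bounds[OF e *, of n] 2 *
          by (intro mult_right_mono) (auto simp: divide_right_mono)
        moreover have "\<bar>cut_deriv (e n) (b (x \<bullet> x))\<bar> * \<bar>\<phi> x * b' (x \<bullet> x)\<bar> \<le> 1 * \<bar>\<phi> x * b' (x \<bullet> x)\<bar>"
          using cut_bounds[OF e *, of n] by (intro mult_right_mono) auto
        then have "\<bar>D n x\<bar> \<le> 2 * \<bar>\<phi> x * b' (x \<bullet> x)\<bar>"
          using 2 by (simp add: D_def abs_mult mult_ac)
        ultimately show ?thesis unfolding w_def real_norm_def by linarith
      qed (auto simp: A_def D_def w_def)
    qed
    then show "AE x in lborel. norm (A n x + D n x) \<le> w x" for n by simp
  qed
  then have "(\<integral>x. f x \<partial>lborel) = 0" by (simp add: trunc(3) LIMSEQ_const_iff)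
  then show ?thesis by (simp add: f_def)
qed

text \<open>Test with \<open>\<phi> = (S - |x|^2)^2\<close> on \<open>|x|^2 < S\<close>: then \<open>x \<bullet> \<nabla>\<phi>\<close> is of order \<open>|x|^2\<close>, which cancels the
singularity of the field, so the first terms of the truncated identities are bounded. This bounds
\<open>\<integral> \<phi> b'\<close> along the truncations, and Fatou's lemma applies as \<open>b' \<ge> 0\<close>.\<close>

lemma derivative_integrable:
  assumes "0 < R" "R < 1"
  shows "integrable lborel (\<lambda>x::real^2. indicator (ball 0 R - {0}) x * b' (x \<bullet> x))"
proof -
  \<comment> \<open>any value strictly between \<open>R^2\<close> and \<open>1\<close>\<close>
  define S where "S = (R\<^sup>2 + 1) / 2"
  have "R\<^sup>2 < 1" using assms power_strict_mono[of R 1 2] by simp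
  then have S: "R\<^sup>2 < S" "0 < S" "S < 1" using assms by (auto simp: S_def add_pos_pos)
  define m where "m x = max 0 (S - x \<bullet> x)" for x :: "real^2"
  define \<phi> where "\<phi> x = (m x)\<^sup>2" for x
  define \<phi>' where "\<phi>' x h = 2 * m x * - (2 * (x \<bullet> h))" for x h
  have \<phi>: "(\<phi> has_derivative \<phi>' x) (at x)" for x
  proof -
    have "((\<lambda>z. (max 0 z)\<^sup>2) has_derivative (\<lambda>h. 2 * m x * h)) (at (S - x \<bullet> x))"
      using max_square_has_derivative[of "S - x \<bullet> x"] by (simp add: has_field_derivative_def m_def)
    moreover have "((\<lambda>x. S - x \<bullet> x) has_derivative (\<lambda>h. - (2 * (x \<bullet> h)))) (at x)"
      by (auto intro!: derivative_eq_intros simp: inner_commute)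
    ultimately show ?thesis
      unfolding \<phi>_def[abs_def] \<phi>'_def m_def by (rule has_derivative_compose[rotated])
  qed
  have \<phi>': "continuous_on UNIV (\<lambda>x. \<phi>' x (axis i 1))" for i
    unfolding \<phi>'_def m_def by (intro continuous_intros)
  have out: "m x = 0" if "sqrt S < norm x" for x
    using real_sqrt_less_iff[of S "x \<bullet> x"] that by (simp add: m_def norm_eq_sqrt_inner)
  then have supp: "\<phi> x = 0" if "sqrt S < norm x" for x
    using that by (simp add: \<phi>_def)
  have "sqrt S < 1" using S by simp
  define e where "e n = inverse (real (Suc n))" for n
  have e: "0 < e n" for n by (simp add: e_def)
  have e0: "e \<longlonglongrightarrow> 0" unfolding e_def by (rule LIMSEQ_inverse_real_of_nat)
  define A where "A n x = cut (e n) (b (x \<bullet> x)) / (x \<bullet> x) * \<phi>' x x" for n x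
  define D where "D n x = (if x = 0 then 0
      else 2 * (\<phi> x * (cut_deriv (e n) (b (x \<bullet> x)) * b' (x \<bullet> x))))" for n x
  note trunc = truncated_identity[OF e \<phi> \<phi>' supp \<open>sqrt S < 1\<close>, folded A_def D_def]
  have inside: "0 < x \<bullet> x \<and> x \<bullet> x < S" if "x \<noteq> 0" "m x \<noteq> 0" for x
    using that by (auto simp: m_def max_def split: if_splits)
  have D_nonneg: "0 \<le> D n x" for n x
  proof (cases "x = 0 \<or> m x = 0")
    case False
    then have "0 < x \<bullet> x" "x \<bullet> x < 1" using inside[of x] S by auto
    then show ?thesis
      unfolding D_def using cut_bounds(3)[OF e pos] nonneg by (simp add: \<phi>_def)
  qed (auto simp: D_def \<phi>_def)
  define C where "C = 4 * (S * b S)"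
  have "0 < b S" using pos S by simp
  have A_le: "- A n x \<le> C * indicator (ball 0 1) x" for n x
  proof (cases "x = 0 \<or> m x = 0")
    case False
    then have x: "0 < x \<bullet> x" "x \<bullet> x < S" using inside[of x] by auto
    have "norm x < 1" using x S real_sqrt_less_iff[of "x \<bullet> x" 1] by (simp add: norm_eq_sqrt_inner)
    have "- A n x = 4 * (m x * cut (e n) (b (x \<bullet> x)))"
      using x by (simp add: A_def \<phi>'_def)
    also have "\<dots> \<le> 4 * (S * b S)"
    proof (intro mult_left_mono mult_mono)
      show "m x \<le> S" using x by (simp add: m_def)
      have "cut (e n) (b (x \<bullet> x)) \<le> b (x \<bullet> x)" using cut_bounds(2)[OF e pos] x S by simp
      also have "\<dots> \<le> b S" using mono x S by simp
      finally show "cut (e n) (b (x \<bullet> x)) \<le> b S" .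
      show "0 \<le> cut (e n) (b (x \<bullet> x))" using cut_bounds(1)[OF e pos] x S by simp
    qed (use S in auto)
    finally show ?thesis using \<open>norm x < 1\<close> by (simp add: C_def)
  next
    case True
    then show ?thesis using S \<open>0 < b S\<close> by (auto simp: A_def \<phi>'_def C_def indicator_def)
  qed
  have int_C: "integrable lborel (\<lambda>x::real^2. C * indicator (ball 0 1) x)"
    by (intro integrable_mult_right integrable_real_indicator)
      (auto simp: emeasure_bounded_finite[unfolded infinity_ennreal_def])
  define K where "K = integral\<^sup>L lborel (\<lambda>x::real^2. C * indicator (ball 0 1) x)"
  have D_le: "(\<integral>x. D n x \<partial>lborel) \<le> K" for n
  proof -
    have "(\<integral>x. D n x \<partial>lborel) = (\<integral>x. - A n x \<partial>lborel)"
      using trunc(3)[of n] trunc(1,2)[of n] by simp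
    also have "\<dots> \<le> K"
      unfolding K_def using trunc(1)[of n] by (intro integral_mono int_C A_le) simp
    finally show ?thesis .
  qed
  define L where "L x = (if x = 0 then 0 else 2 * (\<phi> x * b' (x \<bullet> x)))" for x
  have lim: "(\<lambda>n. D n x) \<longlonglongrightarrow> L x" for x
  proof (cases "x = 0 \<or> m x = 0")
    case False
    then have x: "0 < x \<bullet> x" "x \<bullet> x < 1" using inside[of x] S by auto
    have "(\<lambda>n. 2 * (\<phi> x * (cut_deriv (e n) (b (x \<bullet> x)) * b' (x \<bullet> x)))) \<longlonglongrightarrow> 2 * (\<phi> x * (1 * b' (x \<bullet> x)))"
      using x by (intro tendsto_intros cut_limits pos e0)
    then show ?thesis using False by (simp add: D_def L_def)
  qed (auto simp: D_def L_def \<phi>_def)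
  have D_meas: "D n \<in> borel_measurable lborel" for n using trunc(2)[of n] by simp
  have L_meas: "L \<in> borel_measurable lborel"
    by (rule borel_measurable_LIMSEQ_real[OF lim D_meas])
  have "(\<integral>\<^sup>+x. ennreal (L x) \<partial>lborel) = (\<integral>\<^sup>+x. liminf (\<lambda>n. ennreal (D n x)) \<partial>lborel)"
    using lim by (intro nn_integral_cong lim_imp_Liminf[symmetric] tendsto_ennrealI) auto
  also have "\<dots> \<le> liminf (\<lambda>n. \<integral>\<^sup>+x. ennreal (D n x) \<partial>lborel)"
    by (intro nn_integral_liminf measurable_compose[OF D_meas measurable_ennreal])
  also have "\<dots> \<le> ennreal K"
  proof (intro Liminf_le always_eventually allI)
    fix n
    have "(\<integral>\<^sup>+x. ennreal (D n x) \<partial>lborel) = ennreal (\<integral>x. D n x \<partial>lborel)"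
      by (intro nn_integral_eq_integral trunc(2) AE_I2 D_nonneg)
    then show "(\<integral>\<^sup>+x. ennreal (D n x) \<partial>lborel) \<le> ennreal K"
      using D_le[of n] by (simp add: ennreal_leI)
  qed simp
  finally have "(\<integral>\<^sup>+x. ennreal (L x) \<partial>lborel) \<le> ennreal K" .
  then have "(\<integral>\<^sup>+x. ennreal (L x) \<partial>lborel) < \<infinity>"
    using ennreal_less_top[of K] by (metis infinity_ennreal_def le_less_trans)
  moreover have "0 \<le> L x" for x
    using LIMSEQ_le_const[OF lim] D_nonneg by blast
  ultimately have int_L: "integrable lborel L"
    using L_meas by (intro integrableI_nonneg) auto
  define k where "k = 1 / (2 * (S - R\<^sup>2)\<^sup>2)"
  have eq: "indicator (ball 0 R - {0}) x * b' (x \<bullet> x) = indicator (ball 0 R - {0}) x * (L x / (2 * \<phi> x))"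
    and le: "indicator (ball 0 R - {0}) x * b' (x \<bullet> x) \<le> k * L x" for x
  proof -
    have *: "b' (x \<bullet> x) = L x / (2 * \<phi> x) \<and> b' (x \<bullet> x) \<le> k * L x" if x: "norm x < R" "x \<noteq> 0"
    proof -
      have "x \<bullet> x < R\<^sup>2"
        using power_strict_mono[of "norm x" R 2] x by (simp add: power2_norm_eq_inner)
      then have "S - R\<^sup>2 \<le> m x" "0 < S - R\<^sup>2" using S by (auto simp: m_def)
      then have \<phi>x: "(S - R\<^sup>2)\<^sup>2 \<le> \<phi> x" "0 < (S - R\<^sup>2)\<^sup>2"
        unfolding \<phi>_def by (auto intro: power_mono)
      then have "0 < \<phi> x" by linarith
      then have "b' (x \<bullet> x) = L x / (2 * \<phi> x)" using x by (simp add: L_def)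
      moreover have "L x / (2 * \<phi> x) \<le> L x / (2 * (S - R\<^sup>2)\<^sup>2)"
        using \<phi>x \<open>0 < \<phi> x\<close> \<open>\<And>x. 0 \<le> L x\<close> by (intro divide_left_mono) auto
      ultimately show ?thesis by (simp add: k_def)
    qed
    have "0 \<le> k * L x" using \<open>0 \<le> L x\<close> by (simp add: k_def)
    then show "indicator (ball 0 R - {0}) x * b' (x \<bullet> x) = indicator (ball 0 R - {0}) x * (L x / (2 * \<phi> x))"
      "indicator (ball 0 R - {0}) x * b' (x \<bullet> x) \<le> k * L x"
      using * by (auto simp: indicator_def)
  qed
  have nn: "0 \<le> indicator (ball 0 R - {0}) x * b' (x \<bullet> x)" for x :: "real^2"
  proof -
    have "0 < x \<bullet> x \<and> x \<bullet> x < 1" if "norm x < R" "x \<noteq> 0"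
      using that assms power_strict_mono[of "norm x" 1 2] by (simp add: power2_norm_eq_inner)
    then show ?thesis using nonneg by (auto simp: indicator_def)
  qed
  show ?thesis
  proof (rule Bochner_Integration.integrable_bound)
    show "integrable lborel (\<lambda>x. k * L x)" using int_L by simp
    have [measurable]: "\<phi> \<in> borel_measurable lborel" "ball 0 R - {0::real^2} \<in> sets lborel"
      unfolding \<phi>_def m_def by auto
    note [measurable] = L_meas
    show "(\<lambda>x::real^2. indicator (ball 0 R - {0}) x * b' (x \<bullet> x)) \<in> borel_measurable lborel"
      unfolding eq by measurable
    show "AE x in lborel. norm (indicator (ball 0 R - {0}) x * b' (x \<bullet> x)) \<le> norm (k * L x)"
      using nn le \<open>\<And>x. 0 \<le> L x\<close> by (intro AE_I2) (smt (verit) real_norm_def)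
  qed
qed

end

section \<open>Test functions\<close>

lemma test_functions_iff:
  "u \<in> test_functions \<longleftrightarrow> (\<forall>k. C_diff k u) \<and> (\<exists>R. 0 < R \<and> R < 1 \<and> (\<forall>x. R \<le> norm x \<longrightarrow> u x = 0))"
  (is "_ \<longleftrightarrow> _ \<and> ?supp")
proof -
  have "compact (closure {x. u x \<noteq> 0}) \<and> closure {x. u x \<noteq> 0} \<subseteq> ball 0 1 \<longleftrightarrow> ?supp" (is "?C \<longleftrightarrow> _")
  proof
    assume C: ?C
    let ?K = "closure {x. u x \<noteq> 0}"
    show ?supp
    proof (cases "?K = {}")
      case True
      then have "\<forall>x. u x = 0" using closure_subset[of "{x. u x \<noteq> 0}"] by auto
      then show ?thesis by (intro exI[of _ "1/2"]) auto
    next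
      case False
      then obtain y where y: "y \<in> ?K" "\<And>x. x \<in> ?K \<Longrightarrow> norm x \<le> norm y"
        using continuous_attains_sup[of ?K norm] C continuous_on_norm_id by blast
      then have "norm y < 1" using C by auto
      then show ?thesis
        using y(2) closure_subset[of "{x. u x \<noteq> 0}"]
        by (intro exI[of _ "(norm y + 1) / 2"]) (fastforce intro: add_nonneg_pos)
    qed
  next
    assume ?supp
    then obtain R where R: "R < 1" "\<And>x. R \<le> norm x \<Longrightarrow> u x = 0" by blast
    have "{x. u x \<noteq> 0} \<subseteq> cball 0 R" using R by force
    then have "closure {x. u x \<noteq> 0} \<subseteq> cball 0 R" by (simp add: closure_minimal)
    then show ?C
      using R(1) by (auto simp: compact_eq_bounded_closed intro: bounded_subset[OF bounded_cball])
  qed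
  then show ?thesis unfolding test_functions_def by simp
qed

lemma test_functions_supportE:
  assumes "u \<in> test_functions" "w \<in> test_functions"
  obtains R where "0 < R" "R < 1" "\<And>x. R \<le> norm x \<Longrightarrow> u x = 0" "\<And>x. R \<le> norm x \<Longrightarrow> w x = 0"
proof -
  obtain R S where "0 < R" "R < 1" "\<And>x. R \<le> norm x \<Longrightarrow> u x = 0"
    "0 < S" "S < 1" "\<And>x. S \<le> norm x \<Longrightarrow> w x = 0"
    using assms unfolding test_functions_iff by blast
  then show ?thesis by (intro that[of "max R S"]) auto
qed

lemma test_functions_add:
  assumes "u \<in> test_functions" "w \<in> test_functions"
  shows "(\<lambda>x. u x + w x) \<in> test_functions"
proof -
  obtain R where "0 < R" "R < 1" "\<And>x. R \<le> norm x \<Longrightarrow> u x = 0" "\<And>x. R \<le> norm x \<Longrightarrow> w x = 0"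
    using test_functions_supportE[OF assms] by blast
  then show ?thesis
    using assms unfolding test_functions_iff by (auto intro: C_diff_add)
qed

lemma test_functions_scale:
  assumes "u \<in> test_functions"
  shows "(\<lambda>x. c * u x) \<in> test_functions"
  using assms unfolding test_functions_iff by (force intro: C_diff_mult C_diff_const)

lemma test_functions_diff:
  assumes "u \<in> test_functions" "w \<in> test_functions"
  shows "(\<lambda>x. u x - w x) \<in> test_functions"
  using test_functions_add[OF assms(1) test_functions_scale[OF assms(2)], of "-1"] by simp

lemma has_derivative_grad:
  assumes "u differentiable (at x)"
  shows "(u has_derivative (\<lambda>h. grad u x \<bullet> h)) (at x)"
proof -
  let ?D = "frechet_derivative u (at x)"
  have D: "(u has_derivative ?D) (at x)" using assms by (simp add: frechet_derivative_works)
  then have lin: "linear ?D" by (rule has_derivative_linear)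
  have "?D h = grad u x \<bullet> h" for h
  proof -
    have "?D h = ?D (\<Sum>i\<in>UNIV. h $ i *\<^sub>R axis i 1)"
      by (simp add: basis_expansion[of h, unfolded scalar_mult_eq_scaleR])
    also have "\<dots> = (\<Sum>i\<in>UNIV. h $ i * ?D (axis i 1))"
      by (simp only: linear_sum[OF lin] linear_cmul[OF lin]) simp
    finally show ?thesis by (simp add: grad_def partial_def inner_vec_def mult.commute)
  qed
  then show ?thesis using D by (metis (no_types, lifting) ext)
qed

lemma grad_unique:
  assumes "(u has_derivative (\<lambda>h. v \<bullet> h)) (at x)"
  shows "grad u x = v"
  using partial_eqI[OF assms] by (simp add: grad_def vec_eq_iff inner_axis)

lemma test_functions_differentiable: "u \<in> test_functions \<Longrightarrow> u differentiable (at x)"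
  unfolding test_functions_iff using C_diff.simps(2)[of 0 u] by blast

lemmas test_functions_has_derivative = has_derivative_grad[OF test_functions_differentiable]

lemma test_functions_continuous: "u \<in> test_functions \<Longrightarrow> continuous_on UNIV u"
  unfolding test_functions_iff using C_diff.simps(1) by blast

lemma test_functions_grad_continuous:
  assumes "u \<in> test_functions"
  shows "continuous_on UNIV (grad u)"
proof -
  have "C_diff (Suc 0) u" using assms unfolding test_functions_iff by blast
  then have "continuous_on UNIV (partial i u)" for i by simp
  then show ?thesis unfolding grad_def by (intro continuous_intros) auto
qed

lemma grad_zero_outside:
  assumes "u \<in> test_functions" "\<And>x. R < norm x \<Longrightarrow> u x = 0" "R < norm x"
  shows "grad u x = 0"
proof -
  have "(\<lambda>h. grad u x \<bullet> h) = (\<lambda>h. 0)"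
    by (rule has_derivative_zero_outside[OF test_functions_has_derivative[OF assms(1)] assms(2,3)])
  then have "grad u x \<bullet> grad u x = 0" by (rule fun_cong)
  then show ?thesis by simp
qed

lemma grad_add:
  "u \<in> test_functions \<Longrightarrow> w \<in> test_functions \<Longrightarrow> grad (\<lambda>x. u x + w x) x = grad u x + grad w x"
  by (intro grad_unique)
    (auto simp: inner_add_left intro!: derivative_eq_intros test_functions_has_derivative)

lemma grad_scale:
  "u \<in> test_functions \<Longrightarrow> grad (\<lambda>x. c * u x) x = c *\<^sub>R grad u x"
  by (intro grad_unique) (auto intro!: derivative_eq_intros test_functions_has_derivative)

lemma test_functions_boundE:
  assumes "u \<in> test_functions"
  obtains R B where "0 < R" "R < 1" "0 \<le> B"
    "\<And>x. R \<le> norm x \<Longrightarrow> u x = 0" "\<And>x. R \<le> norm x \<Longrightarrow> grad u x = 0"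
    "\<And>x. \<bar>u x\<bar> \<le> B" "\<And>x. norm (grad u x) \<le> B"
proof -
  obtain S where S: "0 < S" "S < 1" "\<And>x. S \<le> norm x \<Longrightarrow> u x = 0"
    using assms unfolding test_functions_iff by blast
  define R where "R = (S + 1) / 2"
  have R: "0 < R" "R < 1" "S < R" using S by (auto simp: R_def)
  have 0: "u x = 0" "grad u x = 0" if "R \<le> norm x" for x
    using that R S grad_zero_outside[OF assms, of S] by auto
  have "bounded (u ` cball 0 R)" "bounded (grad u ` cball 0 R)"
    using assms test_functions_continuous test_functions_grad_continuous
    by (auto intro!: compact_imp_bounded compact_continuous_image intro: continuous_on_subset)
  then obtain B1 B2 where B1: "\<And>x. x \<in> cball 0 R \<Longrightarrow> \<bar>u x\<bar> \<le> B1"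
    and B2: "\<And>x. x \<in> cball 0 R \<Longrightarrow> norm (grad u x) \<le> B2"
    unfolding bounded_iff by (metis imageI real_norm_def)
  have "\<bar>u x\<bar> \<le> max 0 (max B1 B2)" "norm (grad u x) \<le> max 0 (max B1 B2)" for x
    using B1[of x] B2[of x] 0[of x] by (cases "R \<le> norm x"; force)+
  then show ?thesis using that[of R "max 0 (max B1 B2)"] R 0 by simp
qed

section \<open>The Hardy weight and its vector field\<close>

abbreviation log_height :: "real^2 \<Rightarrow> real" where
  "log_height x \<equiv> - ln (norm x)"

definition hardy_weight :: "real^2 \<Rightarrow> real" where
  "hardy_weight x = 1 / ((norm x)\<^sup>2 * (log_height x)\<^sup>2)"

text \<open>The logarithmic gradient of \<open>1 / (- ln |x|)\<close>. Half of its negative is the logarithmic gradient of the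
virtual ground state \<open>sqrt (- ln |x|)\<close>, the function annihilated by \<open>\<nabla> + F / 2\<close>.\<close>

definition ground_field :: "real^2 \<Rightarrow> real^2" where
  "ground_field x = (1 / ((norm x)\<^sup>2 * log_height x)) *\<^sub>R x"

lemma hardy_weight_measurable [measurable]: "hardy_weight \<in> borel_measurable borel"
  unfolding hardy_weight_def[abs_def] by measurable

lemma ground_field_measurable [measurable]: "ground_field \<in> borel_measurable borel"
  unfolding ground_field_def[abs_def] by measurable

lemma hardy_weight_nonneg: "0 \<le> hardy_weight x"
  by (simp add: hardy_weight_def)

lemma ground_field_square: "ground_field x \<bullet> ground_field x = hardy_weight x"
  by (simp add: ground_field_def hardy_weight_def power2_eq_square dot_square_norm)

lemma norm_ground_field: "norm (ground_field x) = sqrt (hardy_weight x)"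
  by (simp add: norm_eq_sqrt_inner ground_field_square)

lemma sqrt_le_one_plus: "0 \<le> a \<Longrightarrow> sqrt a \<le> 1 + a" for a :: real
  by (rule real_le_lsqrt) (auto simp: power2_eq_square algebra_simps)

lemma log_height_square: "- ln (x \<bullet> x) / 2 = log_height x"
  by (cases "x = 0") (simp_all add: dot_square_norm ln_realpow)

text \<open>Profiles given as functions of \<open>t = - ln |x|\<close>; with \<open>\<rho> = |x|^2\<close> one has \<open>t = - ln \<rho> / 2\<close>. Decrease in \<open>t\<close>
is increase in \<open>\<rho>\<close>.\<close>

lemma increasing_profile_log:
  assumes pos: "\<And>t. 0 < t \<Longrightarrow> 0 < \<beta> t"
    and deriv: "\<And>t. 0 < t \<Longrightarrow> (\<beta> has_real_derivative - \<gamma> t) (at t)"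
    and nonneg: "\<And>t. 0 < t \<Longrightarrow> 0 \<le> \<gamma> t"
    and cont: "continuous_on {0<..} \<gamma>"
    and lim: "(\<beta> \<longlongrightarrow> 0) at_top"
  shows "increasing_profile (\<lambda>\<rho>. \<beta> (- ln \<rho> / 2)) (\<lambda>\<rho>. \<gamma> (- ln \<rho> / 2) / (2 * \<rho>))"
proof
  fix \<rho> :: real assume \<rho>: "0 < \<rho>" "\<rho> < 1"
  then have T: "0 < - ln \<rho> / 2" by simp
  show "0 < \<beta> (- ln \<rho> / 2)" "0 \<le> \<gamma> (- ln \<rho> / 2) / (2 * \<rho>)"
    using pos[OF T] nonneg[OF T] \<rho> by auto
  have "((\<lambda>\<rho>. - ln \<rho> / 2) has_real_derivative - (1 / (2 * \<rho>))) (at \<rho>)"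
    using \<rho> by (auto intro!: derivative_eq_intros)
  from DERIV_chain2[OF deriv[OF T] this]
  show "((\<lambda>\<rho>. \<beta> (- ln \<rho> / 2)) has_real_derivative \<gamma> (- ln \<rho> / 2) / (2 * \<rho>)) (at \<rho>)"
    by simp
next
  have "continuous_on {0<..<1} (\<lambda>\<rho>::real. - ln \<rho> / 2)" by (intro continuous_intros) auto
  then show "continuous_on {0<..<1} (\<lambda>\<rho>. \<gamma> (- ln \<rho> / 2) / (2 * \<rho>))"
    by (intro continuous_intros continuous_on_compose2[OF cont]) auto
next
  have "filterlim (\<lambda>\<rho>::real. - ln \<rho> * (1/2)) at_top (at_right 0)"
    by (intro filterlim_at_top_mult_tendsto_pos[OF tendsto_const]
        filterlim_uminus_at_bot[THEN iffD1] ln_at_0) auto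
  then have "filterlim (\<lambda>\<rho>::real. - ln \<rho> / 2) at_top (at_right 0)" by simp
  then show "((\<lambda>\<rho>. \<beta> (- ln \<rho> / 2)) \<longlongrightarrow> 0) (at_right 0)"
    by (rule filterlim_compose[OF lim])
qed

text \<open>The profile \<open>t powr (-1/2)\<close>. This function is more singular at the origin than the Hardy weight; the
surplus is needed in \<open>weight_form_control\<close>.\<close>

lemma sqrt_log_integrable:
  assumes "0 < R" "R < 1"
  shows "integrable lborel (\<lambda>x. indicator (ball 0 R) x
    * (1 / ((norm x)\<^sup>2 * (log_height x * sqrt (log_height x)))))"
proof -
  interpret increasing_profile "\<lambda>\<rho>. 1 / sqrt (- ln \<rho> / 2)"
    "\<lambda>\<rho>. 1 / (2 * (- ln \<rho> / 2) * sqrt (- ln \<rho> / 2)) / (2 * \<rho>)"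
  proof (rule increasing_profile_log)
    show "((\<lambda>t. 1 / sqrt t) has_real_derivative - (1 / (2 * t * sqrt t))) (at t)" if "0 < t" for t
      using that by (auto intro!: derivative_eq_intros simp: field_simps)
    show "((\<lambda>t. 1 / sqrt t) \<longlongrightarrow> 0) at_top"
      by (intro tendsto_divide_0[OF tendsto_const] filterlim_at_top_imp_at_infinity sqrt_at_top)
  qed (auto intro!: continuous_intros)
  have "integrable lborel (\<lambda>x::real^2. 4 * (indicator (ball 0 R - {0}) x
      * (1 / (2 * (- ln (x \<bullet> x) / 2) * sqrt (- ln (x \<bullet> x) / 2)) / (2 * (x \<bullet> x)))))"
    by (intro integrable_mult_right derivative_integrable assms)
  also have "(\<lambda>x::real^2. 4 * (indicator (ball 0 R - {0}) x
      * (1 / (2 * (- ln (x \<bullet> x) / 2) * sqrt (- ln (x \<bullet> x) / 2)) / (2 * (x \<bullet> x)))))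
    = (\<lambda>x. indicator (ball 0 R) x * (1 / ((norm x)\<^sup>2 * (log_height x * sqrt (log_height x)))))"
    unfolding log_height_square by (auto simp: indicator_def dot_square_norm)
  finally show ?thesis .
qed

lemma hardy_weight_integrable:
  assumes "0 < R" "R < 1"
  shows "integrable lborel (\<lambda>x. indicator (ball 0 R) x * hardy_weight x)"
proof -
  define G where "G x = 1 / ((norm x)\<^sup>2 * (log_height x * sqrt (log_height x)))" for x
  show ?thesis
  proof (rule Bochner_Integration.integrable_bound[OF integrable_mult_right[OF sqrt_log_integrable[OF assms, folded G_def], of "1 / sqrt (- ln R)"]])
  have [measurable]: "ball (0::real^2) R \<in> sets borel" by simp
  show "(\<lambda>x. indicator (ball 0 R) x * hardy_weight x) \<in> borel_measurable lborel" by measurable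
  have "hardy_weight x \<le> 1 / sqrt (- ln R) * (1 / ((norm x)\<^sup>2 * (log_height x * sqrt (log_height x))))"
    if "norm x < R" "x \<noteq> 0" for x
  proof -
    have "0 < - ln R" "- ln R \<le> log_height x" using that assms by auto
    then have "sqrt (- ln R) \<le> sqrt (log_height x)" "0 < sqrt (- ln R)" by simp_all
    then have "1 / sqrt (log_height x) \<le> 1 / sqrt (- ln R)" by (intro divide_left_mono) auto
    then have "1 / sqrt (log_height x) * (1 / ((norm x)\<^sup>2 * (log_height x * sqrt (log_height x))))
      \<le> 1 / sqrt (- ln R) * (1 / ((norm x)\<^sup>2 * (log_height x * sqrt (log_height x))))"
      using that assms \<open>0 < - ln R\<close> \<open>- ln R \<le> log_height x\<close>
      by (intro mult_right_mono divide_nonneg_nonneg mult_nonneg_nonneg) auto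
    moreover have "hardy_weight x
        = 1 / sqrt (log_height x) * (1 / ((norm x)\<^sup>2 * (log_height x * sqrt (log_height x))))"
    proof -
      have *: "1 / (r * (t * t)) = 1 / sqrt t * (1 / (r * (t * sqrt t)))" if "0 < t" for r t :: real
        using that by (cases "r = 0") (simp_all add: field_simps)
      show ?thesis
        unfolding hardy_weight_def power2_eq_square using * \<open>0 < - ln R\<close> \<open>- ln R \<le> log_height x\<close>
        by (meson less_le_trans)
    qed
    ultimately show ?thesis by simp
  qed
  then have le: "hardy_weight x \<le> 1 / sqrt (- ln R) * G x" if "norm x < R" "x \<noteq> 0" for x
    using that unfolding G_def by blast
  have "\<bar>indicator (ball 0 R) x * hardy_weight x\<bar>
    \<le> \<bar>1 / sqrt (- ln R) * (indicator (ball 0 R) x * G x)\<bar>" for x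
  proof (cases "norm x < R \<and> x \<noteq> 0")
    case True
    then show ?thesis
      using order_trans[OF le[of x] abs_ge_self] hardy_weight_nonneg[of x] by simp
  qed (auto simp: hardy_weight_def)
  then show "AE x in lborel. norm (indicator (ball 0 R) x * hardy_weight x)
    \<le> norm (1 / sqrt (- ln R) * (indicator (ball 0 R) x * G x))"
    unfolding real_norm_def by (rule AE_I2)
  qed
qed

lemma test_functions_measurable:
  assumes "u \<in> test_functions"
  shows "u \<in> borel_measurable borel" "grad u \<in> borel_measurable borel"
  using assms by (auto intro!: borel_measurable_continuous_onI
      test_functions_continuous test_functions_grad_continuous)

lemma integrable_weighted_product:
  assumes "u \<in> test_functions" "w \<in> test_functions"
  shows "integrable lborel (\<lambda>x. hardy_weight x * (u x * w x))"
proof -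
  note [measurable] = test_functions_measurable[OF assms(1)] test_functions_measurable[OF assms(2)]
  obtain R B where R: "0 < R" "R < 1" "0 \<le> B" "\<And>x. R \<le> norm x \<Longrightarrow> u x = 0" "\<And>x. \<bar>u x\<bar> \<le> B"
    using test_functions_boundE[OF assms(1)] by metis
  obtain B' where B': "0 \<le> B'" "\<And>x. \<bar>w x\<bar> \<le> B'"
    using test_functions_boundE[OF assms(2)] by metis
  show ?thesis
  proof (rule Bochner_Integration.integrable_bound[OF integrable_mult_right[OF hardy_weight_integrable[OF R(1,2)], of "B * B'"]])
    show "(\<lambda>x. hardy_weight x * (u x * w x)) \<in> borel_measurable lborel" by measurable
    have "\<bar>hardy_weight x * (u x * w x)\<bar> \<le> \<bar>B * B' * (indicator (ball 0 R) x * hardy_weight x)\<bar>" for x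
    proof (cases "norm x < R")
      case True
      have "\<bar>u x * w x\<bar> \<le> B * B'" unfolding abs_mult using R B' by (intro mult_mono) auto
      then show ?thesis
        using True mult_left_mono[OF \<open>\<bar>u x * w x\<bar> \<le> B * B'\<close> hardy_weight_nonneg[of x]] R(3) B'(1)
        by (simp add: abs_mult mult_ac hardy_weight_nonneg)
    qed (use R in auto)
    then show "AE x in lborel. norm (hardy_weight x * (u x * w x))
        \<le> norm (B * B' * (indicator (ball 0 R) x * hardy_weight x))" by simp
  qed
qed

lemma integrable_grad_square:
  assumes "u \<in> test_functions"
  shows "integrable lborel (\<lambda>x. grad u x \<bullet> grad u x)"
proof -
  obtain R where R: "\<And>x. R \<le> norm x \<Longrightarrow> grad u x = 0"
    using test_functions_boundE[OF assms] by metis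
  show ?thesis
    by (rule integrable_continuous_bounded_support[where R=R])
      (use R in \<open>auto intro!: continuous_intros test_functions_grad_continuous assms\<close>)
qed

text \<open>The limit identity for \<open>\<phi> = u^2\<close>. The bounds on \<open>\<beta>\<close> and \<open>\<gamma>\<close> make the two integrands integrable: the
second is at most \<open>2 V u^2\<close>, and the first is bounded by a multiple of \<open>|F| = sqrt V \<le> 1 + V\<close>.\<close>

lemma square_flux:
  assumes u: "u \<in> test_functions"
    and profile: "increasing_profile (\<lambda>\<rho>. \<beta> (- ln \<rho> / 2)) (\<lambda>\<rho>. \<gamma> (- ln \<rho> / 2) / (2 * \<rho>))"
    and [measurable]: "\<beta> \<in> borel_measurable borel" "\<gamma> \<in> borel_measurable borel"
    and \<beta>: "\<And>t. 0 < t \<Longrightarrow> \<bar>\<beta> t\<bar> \<le> 1 / t" and \<gamma>: "\<And>t. 0 < t \<Longrightarrow> \<bar>\<gamma> t\<bar> \<le> 2 / t\<^sup>2"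
  defines "A \<equiv> \<lambda>x. \<beta> (log_height x) / (norm x)\<^sup>2 * (2 * u x * (grad u x \<bullet> x))"
    and "D \<equiv> \<lambda>x. \<gamma> (log_height x) / (norm x)\<^sup>2 * (u x)\<^sup>2"
  shows "integrable lborel A" "integrable lborel D" "(\<integral>x. A x + D x \<partial>lborel) = 0"
proof -
  note [measurable] = test_functions_measurable[OF u]
  interpret increasing_profile "\<lambda>\<rho>. \<beta> (- ln \<rho> / 2)" "\<lambda>\<rho>. \<gamma> (- ln \<rho> / 2) / (2 * \<rho>)" by (rule profile)
  obtain R B where R: "0 < R" "R < 1" "0 \<le> B" "\<And>x. R \<le> norm x \<Longrightarrow> u x = 0"
      "\<And>x. \<bar>u x\<bar> \<le> B" "\<And>x. norm (grad u x) \<le> B"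
    using test_functions_boundE[OF u] by metis
  have height: "0 < log_height x" if "norm x < R" "x \<noteq> 0" for x
    using that R(2) by simp
  show intA: "integrable lborel A"
  proof (rule Bochner_Integration.integrable_bound)
    show "integrable lborel (\<lambda>x. 2 * B\<^sup>2 * (indicator (ball 0 R) x * (1::real)
        + indicator (ball 0 R) x * hardy_weight x))"
      by (intro integrable_mult_right Bochner_Integration.integrable_add
          hardy_weight_integrable R integrable_mult_left integrable_real_indicator)
        (auto simp: emeasure_bounded_finite[unfolded infinity_ennreal_def])
    show "A \<in> borel_measurable lborel" unfolding A_def by measurable
    have "\<bar>A x\<bar> \<le> 2 * B\<^sup>2 * (indicator (ball 0 R) x * 1 + indicator (ball 0 R) x * hardy_weight x)" for x
    proof (cases "norm x < R \<and> x \<noteq> 0")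
      case True
      define t where "t = log_height x"
      have t: "0 < t" using height True by (simp add: t_def)
      have r: "0 < norm x" using True by simp
      have "\<bar>A x\<bar> = \<bar>\<beta> t\<bar> / (norm x)\<^sup>2 * (2 * \<bar>u x\<bar> * \<bar>grad u x \<bullet> x\<bar>)"
        by (simp add: A_def t_def abs_mult)
      also have "\<dots> \<le> (1 / t) / (norm x)\<^sup>2 * (2 * B * (B * norm x))"
      proof (intro mult_mono divide_right_mono \<beta> t R)
        have "\<bar>grad u x \<bullet> x\<bar> \<le> norm (grad u x) * norm x" by (rule Cauchy_Schwarz_ineq2)
        also have "\<dots> \<le> B * norm x" using R(6) by (intro mult_right_mono) auto
        finally show "\<bar>grad u x \<bullet> x\<bar> \<le> B * norm x" .
      qed (use R(3) t in auto)
      also have "\<dots> = 2 * B\<^sup>2 * (1 / (t * norm x))"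
        using r t by (simp add: power2_eq_square)
      also have "1 / (t * norm x) = sqrt (hardy_weight x)"
        using r t by (simp add: hardy_weight_def t_def[symmetric] real_sqrt_divide real_sqrt_mult mult.commute)
      also have "2 * B\<^sup>2 * sqrt (hardy_weight x) \<le> 2 * B\<^sup>2 * (1 + hardy_weight x)"
        by (intro mult_left_mono sqrt_le_one_plus hardy_weight_nonneg) auto
      finally show ?thesis using True by simp
    next
      case False
      then have "A x = 0" using R(4)[of x] by (auto simp: A_def)
      then show ?thesis by (auto simp: indicator_def hardy_weight_nonneg)
    qed
    then show "AE x in lborel. norm (A x) \<le> norm (2 * B\<^sup>2 * (indicator (ball 0 R) x * 1
        + indicator (ball 0 R) x * hardy_weight x))"
      by (intro AE_I2) (auto intro: order_trans[OF _ abs_ge_self])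
  qed
  show intD: "integrable lborel D"
  proof (rule Bochner_Integration.integrable_bound[OF integrable_mult_right[OF integrable_weighted_product[OF u u], of 2]])
    show "D \<in> borel_measurable lborel" unfolding D_def by measurable
    have "\<bar>D x\<bar> \<le> 2 * (hardy_weight x * (u x * u x))" for x
    proof (cases "norm x < R \<and> x \<noteq> 0")
      case True
      define t where "t = log_height x"
      have t: "0 < t" using height True by (simp add: t_def)
      have "\<bar>D x\<bar> = \<bar>\<gamma> t\<bar> / (norm x)\<^sup>2 * (u x)\<^sup>2" by (simp add: D_def t_def abs_mult)
      also have "\<dots> \<le> (2 / t\<^sup>2) / (norm x)\<^sup>2 * (u x)\<^sup>2"
        by (intro mult_right_mono divide_right_mono \<gamma> t) auto
      finally show ?thesis
        by (simp add: hardy_weight_def t_def power2_eq_square mult_ac)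
    next
      case False
      then have "D x = 0" using R(4)[of x] by (auto simp: D_def)
      then show ?thesis by (simp add: hardy_weight_nonneg)
    qed
    then show "AE x in lborel. norm (D x) \<le> norm (2 * (hardy_weight x * (u x * u x)))"
      by (intro AE_I2) (auto intro: order_trans[OF _ abs_ge_self])
  qed
  define \<phi>' where "\<phi>' x h = 2 * u x * (grad u x \<bullet> h)" for x h
  have \<phi>: "((\<lambda>x. (u x)\<^sup>2) has_derivative \<phi>' x) (at x)" for x
    unfolding \<phi>'_def using test_functions_has_derivative[OF u, of x]
    by (auto intro!: derivative_eq_intros)
  have \<phi>': "continuous_on UNIV (\<lambda>x. \<phi>' x (axis i 1))" for i
    unfolding \<phi>'_def by (intro continuous_intros test_functions_continuous test_functions_grad_continuous u)
  have A: "\<beta> (- ln (x \<bullet> x) / 2) / (x \<bullet> x) * \<phi>' x x = A x" for x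
    unfolding log_height_square by (simp add: A_def \<phi>'_def dot_square_norm)
  have D: "(u x)\<^sup>2 * (\<gamma> (- ln (x \<bullet> x) / 2) / (2 * (x \<bullet> x))) = D x / 2" for x
    unfolding log_height_square by (simp add: D_def dot_square_norm mult.commute)
  have "(\<integral>x. A x + 2 * (D x / 2) \<partial>lborel) = 0"
    using limit_identity[OF \<phi> \<phi>', of R] intA intD R unfolding A D by auto
  then show "(\<integral>x. A x + D x \<partial>lborel) = 0" by simp
qed

section \<open>The ground state representation and the interpolation inequality\<close>

definition ground_gradient :: "(real^2 \<Rightarrow> real) \<Rightarrow> real^2 \<Rightarrow> real^2" where
  "ground_gradient u x = grad u x + (u x / 2) *\<^sub>R ground_field x"

definition ground_form :: "(real^2 \<Rightarrow> real) \<Rightarrow> (real^2 \<Rightarrow> real) \<Rightarrow> real" where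
  "ground_form u w = (\<integral>x. ground_gradient u x \<bullet> ground_gradient w x \<partial>lborel)"

definition weight_form :: "(real^2 \<Rightarrow> real) \<Rightarrow> (real^2 \<Rightarrow> real) \<Rightarrow> real" where
  "weight_form u w = (\<integral>x. hardy_weight x * (u x * w x) \<partial>lborel)"

lemma ground_gradient_measurable:
  assumes "u \<in> test_functions"
  shows "ground_gradient u \<in> borel_measurable borel"
proof -
  note [measurable] = test_functions_measurable[OF assms]
  show ?thesis unfolding ground_gradient_def[abs_def] by measurable
qed

lemma integrable_ground_square:
  assumes "u \<in> test_functions"
  shows "integrable lborel (\<lambda>x. ground_gradient u x \<bullet> ground_gradient u x)"
proof (rule Bochner_Integration.integrable_bound)
  note [measurable] = ground_gradient_measurable[OF assms]
  show "integrable lborel (\<lambda>x. 2 * (grad u x \<bullet> grad u x) + hardy_weight x * (u x * u x))"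
    by (intro Bochner_Integration.integrable_add integrable_mult_right
        integrable_grad_square integrable_weighted_product assms)
  show "(\<lambda>x. ground_gradient u x \<bullet> ground_gradient u x) \<in> borel_measurable lborel" by measurable
  have "ground_gradient u x \<bullet> ground_gradient u x
      \<le> 2 * (grad u x \<bullet> grad u x) + hardy_weight x * (u x * u x)" for x
  proof -
    define a where "a = grad u x"
    define c where "c = (u x / 2) *\<^sub>R ground_field x"
    have "0 \<le> (a - c) \<bullet> (a - c)" by simp
    then have "(a + c) \<bullet> (a + c) \<le> 2 * (a \<bullet> a) + 2 * (c \<bullet> c)"
      by (simp add: inner_diff inner_add algebra_simps inner_commute)
    moreover have "c \<bullet> c = hardy_weight x * (u x * u x) / 4"
      by (simp add: c_def ground_field_square)
    moreover have "0 \<le> hardy_weight x * (u x * u x)" by (simp add: hardy_weight_nonneg)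
    ultimately have "(a + c) \<bullet> (a + c) \<le> 2 * (a \<bullet> a) + hardy_weight x * (u x * u x)" by linarith
    then show ?thesis by (simp only: ground_gradient_def a_def c_def)
  qed
  then show "AE x in lborel. norm (ground_gradient u x \<bullet> ground_gradient u x)
      \<le> norm (2 * (grad u x \<bullet> grad u x) + hardy_weight x * (u x * u x))"
    by (intro AE_I2) (auto intro: order_trans[OF _ abs_ge_self])
qed

lemma integrable_ground_product:
  assumes "u \<in> test_functions" "w \<in> test_functions"
  shows "integrable lborel (\<lambda>x. ground_gradient u x \<bullet> ground_gradient w x)"
proof (rule Bochner_Integration.integrable_bound)
  note [measurable] = ground_gradient_measurable[OF assms(1)] ground_gradient_measurable[OF assms(2)]
  show "integrable lborel (\<lambda>x. ground_gradient u x \<bullet> ground_gradient u x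
      + ground_gradient w x \<bullet> ground_gradient w x)"
    by (intro Bochner_Integration.integrable_add integrable_ground_square assms)
  show "(\<lambda>x. ground_gradient u x \<bullet> ground_gradient w x) \<in> borel_measurable lborel" by measurable
  have "\<bar>a \<bullet> c\<bar> \<le> a \<bullet> a + c \<bullet> c" for a c :: "real^2"
  proof -
    have "0 \<le> (a - c) \<bullet> (a - c)" "0 \<le> (a + c) \<bullet> (a + c)" "0 \<le> a \<bullet> a" "0 \<le> c \<bullet> c" by simp_all
    then show ?thesis by (simp add: inner_diff inner_add inner_commute abs_le_iff)
  qed
  then show "AE x in lborel. norm (ground_gradient u x \<bullet> ground_gradient w x)
      \<le> norm (ground_gradient u x \<bullet> ground_gradient u x + ground_gradient w x \<bullet> ground_gradient w x)"
    by (intro AE_I2) (auto intro: order_trans[OF _ abs_ge_self])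
qed

lemma ground_gradient_add:
  "u \<in> test_functions \<Longrightarrow> w \<in> test_functions \<Longrightarrow>
    ground_gradient (\<lambda>x. u x + w x) x = ground_gradient u x + ground_gradient w x"
  by (simp add: ground_gradient_def grad_add add_divide_distrib scaleR_add_left)

lemma ground_gradient_scale:
  "u \<in> test_functions \<Longrightarrow> ground_gradient (\<lambda>x. c * u x) x = c *\<^sub>R ground_gradient u x"
  by (simp add: ground_gradient_def grad_scale scaleR_add_right)

interpretation ground: semi_inner_product test_functions ground_form
proof
  fix u w z :: "real^2 \<Rightarrow> real" and c :: real
  assume u: "u \<in> test_functions"
  show "(\<lambda>x. c * u x) \<in> test_functions" by (rule test_functions_scale[OF u])
  show "0 \<le> ground_form u u" by (simp add: ground_form_def)
  {
    assume z: "z \<in> test_functions"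
    show "ground_form (\<lambda>x. c * u x) z = c * ground_form u z"
      using integrable_ground_product[OF u z] by (simp add: ground_form_def ground_gradient_scale u)
  }
  assume w: "w \<in> test_functions"
  show "(\<lambda>x. u x + w x) \<in> test_functions" by (rule test_functions_add[OF u w])
  show "ground_form u w = ground_form w u" by (simp add: ground_form_def inner_commute)
  assume z: "z \<in> test_functions"
  show "ground_form (\<lambda>x. u x + w x) z = ground_form u z + ground_form w z"
    using integrable_ground_product[OF u z] integrable_ground_product[OF w z]
    by (simp add: ground_form_def ground_gradient_add u w inner_add_left)
qed

interpretation weight: semi_inner_product test_functions weight_form
proof
  fix u w z :: "real^2 \<Rightarrow> real" and c :: real
  assume u: "u \<in> test_functions"
  show "(\<lambda>x. c * u x) \<in> test_functions" by (rule test_functions_scale[OF u])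
  show "0 \<le> weight_form u u" by (simp add: weight_form_def hardy_weight_nonneg)
  {
    assume z: "z \<in> test_functions"
    have "weight_form (\<lambda>x. c * u x) z = (\<integral>x. c * (hardy_weight x * (u x * z x)) \<partial>lborel)"
      unfolding weight_form_def by (intro Bochner_Integration.integral_cong) auto
    then show "weight_form (\<lambda>x. c * u x) z = c * weight_form u z"
      by (simp add: weight_form_def)
  }
  assume w: "w \<in> test_functions"
  show "(\<lambda>x. u x + w x) \<in> test_functions" by (rule test_functions_add[OF u w])
  show "weight_form u w = weight_form w u" by (simp add: weight_form_def mult.commute)
  assume z: "z \<in> test_functions"
  have "weight_form (\<lambda>x. u x + w x) z
      = (\<integral>x. hardy_weight x * (u x * z x) + hardy_weight x * (w x * z x) \<partial>lborel)"
    unfolding weight_form_def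
    by (intro Bochner_Integration.integral_cong) (auto simp: algebra_simps)
  then show "weight_form (\<lambda>x. u x + w x) z = weight_form u z + weight_form w z"
    using integrable_weighted_product[OF u z] integrable_weighted_product[OF w z]
    by (simp add: weight_form_def)
qed

text \<open>The square integrable functions with the integral of the product are one more instance of
\<open>semi_inner_product\<close>.\<close>

lemma integral_Cauchy_Schwarz:
  fixes f g :: "'a \<Rightarrow> real"
  assumes "f \<in> borel_measurable M" "g \<in> borel_measurable M"
    and "integrable M (\<lambda>x. (f x)\<^sup>2)" "integrable M (\<lambda>x. (g x)\<^sup>2)"
  shows "integrable M (\<lambda>x. f x * g x)"
    and "(\<integral>x. f x * g x \<partial>M)\<^sup>2 \<le> (\<integral>x. (f x)\<^sup>2 \<partial>M) * (\<integral>x. (g x)\<^sup>2 \<partial>M)"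
proof -
  define E where "E = {f \<in> borel_measurable M. integrable M (\<lambda>x. (f x)\<^sup>2 :: real)}"
  have prod: "integrable M (\<lambda>x. f x * g x)" if "f \<in> E" "g \<in> E" for f g
  proof (rule Bochner_Integration.integrable_bound)
    show "integrable M (\<lambda>x. (f x)\<^sup>2 + (g x)\<^sup>2)" using that by (simp add: E_def)
    show "(\<lambda>x. f x * g x) \<in> borel_measurable M"
      using that unfolding E_def by (auto intro: borel_measurable_times)
    have "\<bar>a * c\<bar> \<le> a\<^sup>2 + c\<^sup>2" for a c :: real
      using sum_squares_bound[of "\<bar>a\<bar>" "\<bar>c\<bar>"] mult_nonneg_nonneg[OF abs_ge_zero abs_ge_zero, of a c]
      unfolding abs_mult power2_abs by linarith
    then show "AE x in M. norm (f x * g x) \<le> norm ((f x)\<^sup>2 + (g x)\<^sup>2)" by simp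
  qed
  interpret semi_inner_product E "\<lambda>f g. \<integral>x. f x * g x \<partial>M"
  proof
    fix f g h c assume f: "f \<in> E"
    show "(\<lambda>x. c * f x) \<in> E"
      using f unfolding E_def by (auto simp: power_mult_distrib)
    show "0 \<le> (\<integral>x. f x * f x \<partial>M)" by simp
    show "(\<integral>x. c * f x * h x \<partial>M) = c * (\<integral>x. f x * h x \<partial>M)"
      by (simp add: mult.assoc)
    assume g: "g \<in> E"
    show "(\<integral>x. f x * g x \<partial>M) = (\<integral>x. g x * f x \<partial>M)" by (simp add: mult.commute)
    have "integrable M (\<lambda>x. (f x)\<^sup>2 + (g x)\<^sup>2 + 2 * (f x * g x))"
      using f g prod[OF f g] by (simp add: E_def)
    then show "(\<lambda>x. f x + g x) \<in> E"
      using f g unfolding E_def by (auto simp: power2_sum mult.assoc)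
    assume h: "h \<in> E"
    show "(\<integral>x. (f x + g x) * h x \<partial>M) = (\<integral>x. f x * h x \<partial>M) + (\<integral>x. g x * h x \<partial>M)"
      using prod[OF f h] prod[OF g h] by (simp add: distrib_right)
  qed
  have "f \<in> E" "g \<in> E" using assms by (auto simp: E_def)
  then show "integrable M (\<lambda>x. f x * g x)"
      "(\<integral>x. f x * g x \<partial>M)\<^sup>2 \<le> (\<integral>x. (f x)\<^sup>2 \<partial>M) * (\<integral>x. (g x)\<^sup>2 \<partial>M)"
    using prod Cauchy_Schwarz by (auto simp: power2_eq_square)
qed

text \<open>The flux of \<open>u^2 F\<close>, profile \<open>1 / t\<close>.\<close>

lemma hardy_identity:
  assumes u: "u \<in> test_functions"
  shows "integrable lborel (\<lambda>x. 2 * u x * (grad u x \<bullet> ground_field x))"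
    and "(\<integral>x. 2 * u x * (grad u x \<bullet> ground_field x) \<partial>lborel) = - weight_form u u"
proof -
  have profile: "increasing_profile (\<lambda>\<rho>. 1 / (- ln \<rho> / 2)) (\<lambda>\<rho>. 1 / (- ln \<rho> / 2)\<^sup>2 / (2 * \<rho>))"
  proof (rule increasing_profile_log)
    show "((\<lambda>t. 1 / t) has_real_derivative - (1 / t\<^sup>2)) (at t)" if "0 < t" for t :: real
      using that by (auto intro!: derivative_eq_intros simp: power2_eq_square)
    show "((\<lambda>t::real. 1 / t) \<longlongrightarrow> 0) at_top"
      by (intro tendsto_divide_0[OF tendsto_const] filterlim_at_top_imp_at_infinity filterlim_ident)
  qed (auto intro!: continuous_intros)
  note flux = square_flux[OF u, of "\<lambda>t. 1 / t" "\<lambda>t. 1 / t\<^sup>2", OF profile]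
  have A: "1 / log_height x / (norm x)\<^sup>2 * (2 * u x * (grad u x \<bullet> x))
      = 2 * u x * (grad u x \<bullet> ground_field x)" for x
    by (simp add: ground_field_def mult_ac)
  have D: "1 / (log_height x)\<^sup>2 / (norm x)\<^sup>2 * (u x)\<^sup>2 = hardy_weight x * (u x * u x)" for x
    by (simp add: hardy_weight_def power2_eq_square mult_ac)
  have "integrable lborel (\<lambda>x. 2 * u x * (grad u x \<bullet> ground_field x))"
    "(\<integral>x. 2 * u x * (grad u x \<bullet> ground_field x) + hardy_weight x * (u x * u x) \<partial>lborel) = 0"
    using flux unfolding A D by (auto simp: divide_right_mono)
  then show "integrable lborel (\<lambda>x. 2 * u x * (grad u x \<bullet> ground_field x))"
    "(\<integral>x. 2 * u x * (grad u x \<bullet> ground_field x) \<partial>lborel) = - weight_form u u"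
    using integrable_weighted_product[OF u u] by (auto simp: weight_form_def)
qed

text \<open>Expand the square \<open>|\<nabla>u + u F / 2|^2\<close> and replace the mixed term by the identity above. Hardy's
inequality with constant \<open>1/4\<close> is contained in this.\<close>

lemma dirichlet_eq:
  assumes u: "u \<in> test_functions"
  shows "(\<integral>x. grad u x \<bullet> grad u x \<partial>lborel) = ground_form u u + weight_form u u / 4"
proof -
  define p where "p x = 2 * u x * (grad u x \<bullet> ground_field x)" for x
  define w where "w x = hardy_weight x * (u x * u x)" for x
  have int: "integrable lborel p" "integrable lborel w"
    unfolding p_def[abs_def] w_def[abs_def]
    using hardy_identity(1)[OF u] integrable_weighted_product[OF u u] by auto
  have "ground_gradient u x \<bullet> ground_gradient u x = grad u x \<bullet> grad u x + (p x / 2 + w x / 4)" for x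
    by (simp add: ground_gradient_def inner_add ground_field_square inner_commute p_def w_def)
  then have "ground_form u u = (\<integral>x. grad u x \<bullet> grad u x \<partial>lborel)
      + ((\<integral>x. p x \<partial>lborel) / 2 + (\<integral>x. w x \<partial>lborel) / 4)"
    using integrable_grad_square[OF u] int by (simp add: ground_form_def)
  moreover have "(\<integral>x. p x \<partial>lborel) = - weight_form u u" "(\<integral>x. w x \<partial>lborel) = weight_form u u"
    using hardy_identity(2)[OF u] by (simp_all add: p_def w_def weight_form_def)
  ultimately show ?thesis by simp
qed

text \<open>Both \<open>u\<close> and its gradient vanish off the unit disc, so the integral can be taken over the plane.\<close>

lemma hardy_norm_eq:
  assumes u: "u \<in> test_functions"
  shows "hardy_norm \<mu> u = sqrt (ground_form u u + (\<mu> + 1/4) * weight_form u u)"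
proof -
  obtain R where R: "R < 1" "\<And>x. R \<le> norm x \<Longrightarrow> u x = 0" "\<And>x. R \<le> norm x \<Longrightarrow> grad u x = 0"
    using test_functions_boundE[OF u] by metis
  have "(LINT x:ball 0 1|lborel.
       (norm (grad u x))\<^sup>2 + \<mu> * ((u x)\<^sup>2 / ((norm x)\<^sup>2 * (- ln (norm x))\<^sup>2)))
    = (\<integral>x. grad u x \<bullet> grad u x + \<mu> * (hardy_weight x * (u x * u x)) \<partial>lborel)"
    unfolding set_lebesgue_integral_def
  proof (intro Bochner_Integration.integral_cong refl)
    fix x :: "real^2"
    have "u x = 0 \<and> grad u x = 0" if "x \<notin> ball 0 1"
      using that R by auto
    then show "indicat_real (ball 0 1) x *\<^sub>R
       ((norm (grad u x))\<^sup>2 + \<mu> * ((u x)\<^sup>2 / ((norm x)\<^sup>2 * (- ln (norm x))\<^sup>2)))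
      = grad u x \<bullet> grad u x + \<mu> * (hardy_weight x * (u x * u x))"
      by (cases "x \<in> ball 0 1")
        (auto simp: hardy_weight_def power2_norm_eq_inner power2_eq_square[of "u x"])
  qed
  also have "\<dots> = ground_form u u + (\<mu> + 1/4) * weight_form u u"
    using integrable_grad_square[OF u] integrable_weighted_product[OF u u] dirichlet_eq[OF u]
    by (simp add: weight_form_def algebra_simps)
  finally show ?thesis unfolding hardy_norm_def by (rule arg_cong)
qed

text \<open>The counterpart of \<open>w(s)^2 = -2 \<integral> w w'\<close> (integral from \<open>s\<close> to infinity), averaged over \<open>s\<close>. The flux of
\<open>u^2 A F\<close> with the bounded decreasing function \<open>A = 1 / (1 + sqrt \<tau>)\<close> has density
\<open>2 A u F \<bullet> (\<nabla>u + u F / 2) + c V u^2\<close>, where \<open>c = - \<tau> dA/d\<tau> > 0\<close>. As \<open>|A| \<le> 1\<close> and \<open>|F|^2 = V\<close>, the Cauchy-Schwarz inequality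
bounds \<open>\<integral> c V u^2\<close>.\<close>

lemma interpolation_inequality:
  assumes u: "u \<in> test_functions"
  defines "c \<equiv> \<lambda>x. sqrt (log_height x) / (2 * (1 + sqrt (log_height x))\<^sup>2)"
  shows "integrable lborel (\<lambda>x. c x * hardy_weight x * (u x)\<^sup>2)"
    and "(\<integral>x. c x * hardy_weight x * (u x)\<^sup>2 \<partial>lborel)
      \<le> 2 * (weight.seminorm u * ground.seminorm u)"
proof -
  note [measurable] = test_functions_measurable[OF u] ground_gradient_measurable[OF u]
  obtain R where R: "0 < R" "R < 1" "\<And>x. R \<le> norm x \<Longrightarrow> u x = 0" "\<And>x. R \<le> norm x \<Longrightarrow> grad u x = 0"
    using test_functions_boundE[OF u] by metis
  define \<beta> where "\<beta> t = 1 / (t * (1 + sqrt t))" for t :: real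
  \<comment> \<open>\<open>\<beta> = A / t\<close> and \<open>\<gamma> = - \<beta>'\<close>, so that \<open>\<gamma> / |x|^2 = (A + c) V\<close>\<close>
  define \<gamma> where "\<gamma> t = (1 + 3/2 * sqrt t) / (t\<^sup>2 * (1 + sqrt t)\<^sup>2)" for t :: real
  define A where "A x = 1 / (1 + sqrt (log_height x))" for x :: "real^2"
  have profile: "increasing_profile (\<lambda>\<rho>. \<beta> (- ln \<rho> / 2)) (\<lambda>\<rho>. \<gamma> (- ln \<rho> / 2) / (2 * \<rho>))"
  proof (rule increasing_profile_log)
    show "(\<beta> has_real_derivative - \<gamma> t) (at t)" if "0 < t" for t
    proof -
      have "((\<lambda>t. t * (1 + sqrt t)) has_real_derivative (1 + 3/2 * sqrt t)) (at t)"
        using that by (auto intro!: derivative_eq_intros simp: field_simps)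
      from DERIV_divide[OF DERIV_const[of 1] this] that
      have "((\<lambda>t. 1 / (t * (1 + sqrt t))) has_real_derivative
          (0 * (t * (1 + sqrt t)) - 1 * (1 + 3/2 * sqrt t)) / (t * (1 + sqrt t) * (t * (1 + sqrt t)))) (at t)"
        using add_pos_pos[of 1 "sqrt t"] by simp
      moreover have "(0 * (t * (1 + sqrt t)) - 1 * (1 + 3/2 * sqrt t)) / (t * (1 + sqrt t) * (t * (1 + sqrt t)))
          = - \<gamma> t"
      proof -
        have "t * (1 + sqrt t) * (t * (1 + sqrt t)) = t\<^sup>2 * (1 + sqrt t)\<^sup>2"
          by (simp add: power2_eq_square mult_ac)
        then show ?thesis
          unfolding \<gamma>_def by (simp only: mult_zero_left mult_1_left diff_0 minus_divide_left)
      qed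
      ultimately show ?thesis by (simp add: \<beta>_def[abs_def])
    qed
    have "((\<lambda>t::real. 1 / t * (1 / (1 + sqrt t))) \<longlongrightarrow> 0 * 0) at_top"
      by (intro tendsto_mult tendsto_divide_0[OF tendsto_const] filterlim_at_top_imp_at_infinity
          filterlim_ident filterlim_tendsto_add_at_top[OF tendsto_const] sqrt_at_top)
    then show "(\<beta> \<longlongrightarrow> 0) at_top" by (simp add: \<beta>_def[abs_def])
    show "continuous_on {0<..} \<gamma>"
      unfolding \<gamma>_def by (intro continuous_intros) (auto simp: add_pos_pos[THEN less_imp_neq[symmetric]])
  qed (auto simp: \<beta>_def \<gamma>_def add_pos_pos)
  have \<beta>: "\<bar>\<beta> t\<bar> \<le> 1 / t" if "0 < t" for t
    using that by (simp add: \<beta>_def divide_simps add_pos_pos)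
  have \<gamma>: "\<bar>\<gamma> t\<bar> \<le> 2 / t\<^sup>2" if "0 < t" for t
  proof -
    have "(1 + 3/2 * sqrt t) / (1 + sqrt t)\<^sup>2 \<le> 2"
      using that by (simp add: divide_simps add_pos_pos power2_eq_square; simp add: algebra_simps)
    then have "(1 + 3/2 * sqrt t) / (1 + sqrt t)\<^sup>2 / t\<^sup>2 \<le> 2 / t\<^sup>2" by (intro divide_right_mono) auto
    then show ?thesis using that by (simp add: \<gamma>_def mult.commute)
  qed
  have [measurable]: "\<beta> \<in> borel_measurable borel" "\<gamma> \<in> borel_measurable borel"
    unfolding \<beta>_def[abs_def] \<gamma>_def[abs_def] by measurable
  define P where "P x = \<beta> (log_height x) / (norm x)\<^sup>2 * (2 * u x * (grad u x \<bullet> x))" for x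
  define D where "D x = \<gamma> (log_height x) / (norm x)\<^sup>2 * (u x)\<^sup>2" for x
  note flux = square_flux[OF u profile \<open>\<beta> \<in> _\<close> \<open>\<gamma> \<in> _\<close> \<beta> \<gamma>, folded P_def D_def]
  have P: "P x = A x * (2 * u x * (grad u x \<bullet> ground_field x))" for x
    by (simp add: P_def \<beta>_def A_def ground_field_def mult_ac)
  have height: "0 < log_height x" if "norm x < R" "x \<noteq> 0" for x
    using that R(2) by simp
  have D: "D x = A x * (hardy_weight x * (u x * u x)) + c x * hardy_weight x * (u x)\<^sup>2" for x
  proof (cases "norm x < R \<and> x \<noteq> 0")
    case True
    define m where "m = sqrt (log_height x)"
    have m: "0 < m" "log_height x = m\<^sup>2" using height[of x] True by (simp_all add: m_def)
    have "(1 + 3/2 * m) / (1 + m)\<^sup>2 = 1 / (1 + m) + m / (2 * (1 + m)\<^sup>2)"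
      using m(1) by (simp add: divide_simps add_pos_pos power2_eq_square; simp add: algebra_simps)
    moreover have "D x = (1 + 3/2 * m) / (1 + m)\<^sup>2 * (hardy_weight x * (u x * u x))"
      by (simp add: D_def \<gamma>_def hardy_weight_def m_def power2_eq_square mult_ac)
    ultimately show ?thesis
      by (simp add: A_def c_def m_def[symmetric] distrib_right power2_eq_square)
  next
    case False
    then have "x = 0 \<or> u x = 0" using R(3)[of x] by auto
    then show ?thesis by (auto simp: D_def hardy_weight_def)
  qed
  have A_bound: "\<bar>A x\<bar> \<le> 1" if "norm x < R" for x
  proof -
    have "0 \<le> log_height x" using that R(2) by (cases "x = 0") auto
    then have "0 \<le> sqrt (log_height x)" by (rule real_sqrt_ge_zero)
    moreover have "\<bar>1 / (1 + a)\<bar> \<le> 1" if "0 \<le> a" for a :: real using that by simp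
    ultimately show ?thesis unfolding A_def by blast
  qed
  have int_AV: "integrable lborel (\<lambda>x. A x * (hardy_weight x * (u x * u x)))"
  proof (rule Bochner_Integration.integrable_bound[OF integrable_weighted_product[OF u u]])
    show "(\<lambda>x. A x * (hardy_weight x * (u x * u x))) \<in> borel_measurable lborel"
      unfolding A_def by measurable
    have "\<bar>A x * (hardy_weight x * (u x * u x))\<bar> \<le> \<bar>hardy_weight x * (u x * u x)\<bar>" for x
    proof (cases "norm x < R")
      case True
      then show ?thesis unfolding abs_mult[of "A x"]
        using A_bound by (intro mult_left_le_one_le) auto
    qed (use R(3) in simp)
    then show "AE x in lborel. norm (A x * (hardy_weight x * (u x * u x)))
        \<le> norm (hardy_weight x * (u x * u x))" by simp
  qed
  have c_eq: "c x * hardy_weight x * (u x)\<^sup>2 = D x - A x * (hardy_weight x * (u x * u x))" for x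
    by (simp add: D)
  show int_c: "integrable lborel (\<lambda>x. c x * hardy_weight x * (u x)\<^sup>2)"
    unfolding c_eq using flux(2) int_AV by simp
  define f where "f x = sqrt (hardy_weight x) * \<bar>u x\<bar>" for x
  define g where "g x = norm (ground_gradient u x)" for x
  have f2: "(f x)\<^sup>2 = hardy_weight x * (u x * u x)" for x
    by (simp add: f_def power_mult_distrib hardy_weight_nonneg power2_eq_square[of "u x"])
  have g2: "(g x)\<^sup>2 = ground_gradient u x \<bullet> ground_gradient u x" for x
    by (simp add: g_def power2_norm_eq_inner)
  have fg: "integrable lborel (\<lambda>x. f x * g x)"
    "(\<integral>x. f x * g x \<partial>lborel)\<^sup>2 \<le> weight_form u u * ground_form u u"
  proof -
    have m: "f \<in> borel_measurable lborel" "g \<in> borel_measurable lborel"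
      unfolding f_def[abs_def] g_def[abs_def] by measurable
    show "integrable lborel (\<lambda>x. f x * g x)"
      by (rule integral_Cauchy_Schwarz[OF m])
        (simp_all add: f2 g2 integrable_weighted_product integrable_ground_square u)
    have "(\<integral>x. f x * g x \<partial>lborel)\<^sup>2 \<le> (\<integral>x. (f x)\<^sup>2 \<partial>lborel) * (\<integral>x. (g x)\<^sup>2 \<partial>lborel)"
      by (rule integral_Cauchy_Schwarz[OF m])
        (simp_all add: f2 g2 integrable_weighted_product integrable_ground_square u)
    then show "(\<integral>x. f x * g x \<partial>lborel)\<^sup>2 \<le> weight_form u u * ground_form u u"
      by (simp add: f2 g2 weight_form_def ground_form_def)
  qed
  have nonneg: "0 \<le> (\<integral>x. f x * g x \<partial>lborel)"
    by (intro integral_nonneg_AE) (simp add: f_def g_def hardy_weight_nonneg)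
  have "(\<integral>x. c x * hardy_weight x * (u x)\<^sup>2 \<partial>lborel)
      = (\<integral>x. - (P x + A x * (hardy_weight x * (u x * u x))) \<partial>lborel)"
    unfolding c_eq using flux int_AV by simp
  also have "\<dots> \<le> (\<integral>x. 2 * (f x * g x) \<partial>lborel)"
  proof (rule integral_mono)
    show "integrable lborel (\<lambda>x. - (P x + A x * (hardy_weight x * (u x * u x))))"
      using flux(1) int_AV by simp
    show "integrable lborel (\<lambda>x. 2 * (f x * g x))" using fg(1) by simp
    show "- (P x + A x * (hardy_weight x * (u x * u x))) \<le> 2 * (f x * g x)" for x
    proof (cases "norm x < R")
      case True
      have "P x + A x * (hardy_weight x * (u x * u x))
          = A x * (2 * u x * (ground_field x \<bullet> ground_gradient u x))"
        by (simp add: P ground_gradient_def inner_add_right ground_field_square inner_commute algebra_simps)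
      then have "- (P x + A x * (hardy_weight x * (u x * u x)))
          \<le> \<bar>A x\<bar> * (2 * \<bar>u x\<bar> * \<bar>ground_field x \<bullet> ground_gradient u x\<bar>)"
        by (metis abs_ge_minus_self abs_mult abs_numeral)
      also have "\<dots> \<le> 1 * (2 * \<bar>u x\<bar> * (sqrt (hardy_weight x) * g x))"
        using Cauchy_Schwarz_ineq2[of "ground_field x" "ground_gradient u x"]
        by (intro mult_mono A_bound True) (auto simp: g_def norm_ground_field)
      finally show ?thesis by (simp add: f_def mult_ac)
    next
      case False
      then show ?thesis using R(3)[of x] by (simp add: P f_def)
    qed
  qed
  also have "\<dots> \<le> 2 * (weight.seminorm u * ground.seminorm u)"
    using real_le_rsqrt[OF fg(2)] by (simp add: weight.seminorm_def ground.seminorm_def real_sqrt_mult)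
  finally show "(\<integral>x. c x * hardy_weight x * (u x)\<^sup>2 \<partial>lborel)
      \<le> 2 * (weight.seminorm u * ground.seminorm u)" .
qed

text \<open>By Cauchy-Schwarz \<open>(\<integral> V u \<psi>)^2 \<le> \<integral> c V u^2 * \<integral> V \<psi>^2 / c\<close>. The function \<open>1 / c\<close> grows at the origin only
like \<open>sqrt \<tau>\<close>, so \<open>V / c\<close> is still integrable there, by \<open>sqrt_log_integrable\<close>; this is the reason for the
choice of \<open>A\<close> in the interpolation inequality. At the unit circle \<open>1 / c\<close> is unbounded, but \<open>\<psi>\<close> vanishes there.\<close>

lemma weight_form_control:
  assumes \<psi>: "\<psi> \<in> test_functions"
  shows "\<exists>K. \<forall>u\<in>test_functions.
    (weight_form u \<psi>)\<^sup>2 \<le> K * (weight.seminorm u * ground.seminorm u)"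
proof -
  define c where "c x = sqrt (log_height x) / (2 * (1 + sqrt (log_height x))\<^sup>2)" for x :: "real^2"
  obtain R B where R: "0 < R" "R < 1" "0 \<le> B" "\<And>x. R \<le> norm x \<Longrightarrow> \<psi> x = 0" "\<And>x. \<bar>\<psi> x\<bar> \<le> B"
    using test_functions_boundE[OF \<psi>] by metis
  define g where "g x = sqrt (hardy_weight x / c x) * \<psi> x" for x
  define G where "G x = 1 / ((norm x)\<^sup>2 * (log_height x * sqrt (log_height x)))" for x :: "real^2"
  note [measurable] = test_functions_measurable[OF \<psi>]
  have [measurable]: "c \<in> borel_measurable borel" unfolding c_def[abs_def] by measurable
  have g_meas: "g \<in> borel_measurable lborel" unfolding g_def[abs_def] by measurable
  have c_pos: "0 < c x" if "norm x < 1" "x \<noteq> 0" for x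
  proof -
    have "0 < sqrt (log_height x)" using that by simp
    then show ?thesis unfolding c_def by (intro divide_pos_pos mult_pos_pos zero_less_power) linarith+
  qed
  define L where "L = sqrt (- ln R)"
  have L: "0 < L" using R by (simp add: L_def)
  define k where "k = 2 * (1 + 1 / L)\<^sup>2 * B\<^sup>2"
  have int_g: "integrable lborel (\<lambda>x. (g x)\<^sup>2)"
  proof (rule Bochner_Integration.integrable_bound[OF
        integrable_mult_right[OF sqrt_log_integrable[OF R(1,2), folded G_def], of k]])
    show "(\<lambda>x. (g x)\<^sup>2) \<in> borel_measurable lborel" using g_meas by measurable
    have "(g x)\<^sup>2 \<le> \<bar>k * (indicator (ball 0 R) x * G x)\<bar>" for x
    proof (cases "norm x < R \<and> x \<noteq> 0")
      case True
      define m where "m = sqrt (log_height x)"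
      have "0 < - ln R" "- ln R \<le> log_height x" using True R by auto
      then have m: "L \<le> m" "log_height x = m\<^sup>2" by (simp_all add: m_def L_def)
      then have "0 < m" using L by simp
      have "1 + m \<le> (1 + 1 / L) * m" using m L by (simp add: field_simps)
      then have "(1 + m)\<^sup>2 \<le> ((1 + 1 / L) * m)\<^sup>2" using \<open>0 < m\<close> by (intro power_mono) auto
      have "(g x)\<^sup>2 = hardy_weight x / c x * (\<psi> x)\<^sup>2"
        using c_pos[of x] True R by (simp add: g_def power_mult_distrib hardy_weight_nonneg)
      also have "hardy_weight x / c x = 2 * (1 + m)\<^sup>2 / ((norm x)\<^sup>2 * m ^ 5)"
        using \<open>0 < m\<close> by (simp add: hardy_weight_def c_def m_def[symmetric] m(2) power2_eq_square
            eval_nat_numeral mult_ac)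
      also have "\<dots> * (\<psi> x)\<^sup>2 \<le> 2 * ((1 + 1 / L) * m)\<^sup>2 / ((norm x)\<^sup>2 * m ^ 5) * B\<^sup>2"
        using \<open>(1 + m)\<^sup>2 \<le> _\<close> \<open>0 < m\<close> power_mono[OF R(5)[of x], of 2]
        by (intro mult_mono divide_right_mono mult_left_mono) auto
      also have "\<dots> = k * G x"
        using \<open>0 < m\<close> True by (simp add: k_def G_def m_def[symmetric] m(2) power_mult_distrib
            eval_nat_numeral field_simps)
      finally show ?thesis using True by simp
    next
      case False
      then have "g x = 0" using R(4)[of x] by (auto simp: g_def hardy_weight_def)
      then show ?thesis by simp
    qed
    then show "AE x in lborel. norm ((g x)\<^sup>2) \<le> norm (k * (indicator (ball 0 R) x * G x))" by simp
  qed
  define K where "K = (\<integral>x. (g x)\<^sup>2 \<partial>lborel)"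
  have "(weight_form u \<psi>)\<^sup>2 \<le> 2 * K * (weight.seminorm u * ground.seminorm u)"
    if u: "u \<in> test_functions" for u
  proof -
    note [measurable] = test_functions_measurable[OF u]
    obtain S where S: "S < 1" "\<And>x. S \<le> norm x \<Longrightarrow> u x = 0"
      using test_functions_boundE[OF u] by metis
    define f where "f x = sqrt (c x * hardy_weight x) * u x" for x
    have f_meas: "f \<in> borel_measurable lborel" unfolding f_def[abs_def] by measurable
    have inside: "x = 0 \<or> u x = 0 \<or> 0 < c x" for x
      using c_pos[of x] S by fastforce
    have f2: "(f x)\<^sup>2 = c x * hardy_weight x * (u x)\<^sup>2" for x
      using inside[of x] by (auto simp: f_def power_mult_distrib hardy_weight_nonneg hardy_weight_def)
    have fg: "f x * g x = hardy_weight x * (u x * \<psi> x)" for x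
    proof -
      have "x = 0 \<or> u x = 0 \<or> sqrt (c x * hardy_weight x) * sqrt (hardy_weight x / c x) = hardy_weight x"
        using inside[of x] hardy_weight_nonneg[of x]
        by (auto simp: real_sqrt_mult[symmetric] power2_eq_square[symmetric])
      then show ?thesis by (auto simp: f_def g_def hardy_weight_def mult_ac)
    qed
    have "(weight_form u \<psi>)\<^sup>2 = (\<integral>x. f x * g x \<partial>lborel)\<^sup>2" by (simp add: weight_form_def fg)
    also have "\<dots> \<le> (\<integral>x. (f x)\<^sup>2 \<partial>lborel) * K"
      unfolding K_def
      using integral_Cauchy_Schwarz[OF f_meas g_meas _ int_g] interpolation_inequality(1)[OF u]
      by (simp add: f2 c_def)
    also have "\<dots> \<le> 2 * (weight.seminorm u * ground.seminorm u) * K"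
      using interpolation_inequality(2)[OF u]
      by (intro mult_right_mono) (auto simp: f2 c_def K_def)
    finally show ?thesis by (simp add: mult_ac)
  qed
  then show ?thesis by blast
qed

section \<open>Slowly varying bumps\<close>

lemma poly_mult_exp_tendsto: "((\<lambda>z::real. poly p z * exp (- z)) \<longlongrightarrow> 0) at_top"
proof -
  have "((\<lambda>z. \<Sum>i\<le>degree p. coeff p i * (z ^ i / exp z)) \<longlongrightarrow> (\<Sum>i\<le>degree p. coeff p i * 0)) at_top"
    by (intro tendsto_sum tendsto_mult tendsto_const tendsto_power_div_exp_0)
  then show ?thesis
    by (simp add: poly_altdef sum_distrib_right exp_minus divide_inverse mult.assoc)
qed

text \<open>A family of functions vanishing to infinite order at \<open>0\<close> that is closed under differentiation; the
case \<open>p = 1\<close> is \<open>exp (-1/y)\<close>.\<close>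

definition flat :: "real poly \<Rightarrow> real \<Rightarrow> real" where
  "flat p y = (if 0 < y then poly p (1 / y) * exp (- (1 / y)) else 0)"

text \<open>For \<open>y > 0\<close> and \<open>z = 1/y\<close> the derivative of \<open>p(z) exp (-z)\<close> is \<open>z^2 (p(z) - p'(z)) exp (-z)\<close>; at \<open>0\<close>
exponential decay beats the polynomial in the difference quotient.\<close>

lemma flat_has_derivative:
  "(flat p has_real_derivative flat (pCons 0 (pCons 0 (p - pderiv p))) y) (at y)"
proof -
  consider "y < 0" | "y = 0" | "0 < y" by linarith
  then show ?thesis
  proof cases
    case 1
    have "(flat p has_real_derivative 0) (at y)"
      by (rule has_field_derivative_transform_within_open[where S="{..<0}" and f="\<lambda>_. 0"])
        (use 1 in \<open>auto simp: flat_def\<close>)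
    then show ?thesis using 1 by (simp add: flat_def)
  next
    case 2
    have "((\<lambda>h. flat p h / h) \<longlongrightarrow> 0) (at_left 0)"
      by (rule tendsto_eventually) (auto simp: flat_def eventually_at_filter)
    moreover have "((\<lambda>h. flat p h / h) \<longlongrightarrow> 0) (at_right 0)"
    proof -
      have "((\<lambda>h::real. poly (pCons 0 p) (inverse h) * exp (- inverse h)) \<longlongrightarrow> 0) (at_right 0)"
        by (rule filterlim_compose[OF poly_mult_exp_tendsto filterlim_inverse_at_top_right])
      moreover have "\<forall>\<^sub>F h in at_right 0. poly (pCons 0 p) (inverse h) * exp (- inverse h) = flat p h / h"
        by (auto simp: flat_def eventually_at_filter divide_inverse)
      ultimately show ?thesis by (rule Lim_transform_eventually)
    qed
    ultimately have "((\<lambda>h. flat p h / h) \<longlongrightarrow> 0) (at 0)" by (rule filterlim_split_at)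
    then show ?thesis using 2 by (simp add: has_field_derivative_iff flat_def)
  next
    case 3
    have "((\<lambda>y. poly p (1 / y) * exp (- (1 / y))) has_real_derivative
        poly (pderiv p) (1 / y) * (- (1 / y\<^sup>2)) * exp (- (1 / y))
        + exp (- (1 / y)) * (1 / y\<^sup>2) * poly p (1 / y)) (at y)"
      using 3 by (auto intro!: derivative_eq_intros DERIV_chain2[OF poly_DERIV]
          simp: power2_eq_square)
    also have "poly (pderiv p) (1 / y) * (- (1 / y\<^sup>2)) * exp (- (1 / y))
        + exp (- (1 / y)) * (1 / y\<^sup>2) * poly p (1 / y)
        = flat (pCons 0 (pCons 0 (p - pderiv p))) y"
      using 3 by (simp add: flat_def power2_eq_square field_simps)
    finally show ?thesis
      by (rule has_field_derivative_transform_within_open[where S="{0<..}"])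
        (use 3 in \<open>auto simp: flat_def\<close>)
  qed
qed

lemma smooth_upto_flat: "smooth_upto k (flat p)"
proof (induction k arbitrary: p)
  case 0
  have "continuous_on UNIV (flat p)"
    using DERIV_continuous_on[of UNIV "flat p"] flat_has_derivative by blast
  then show ?case by simp
next
  case (Suc k)
  show ?case by (rule smooth_upto_SucI[OF flat_has_derivative Suc])
qed

definition bump :: "real \<Rightarrow> real \<Rightarrow> real" where
  "bump l s = flat 1 (1 - (s / l)\<^sup>2)"

definition bump' :: "real \<Rightarrow> real \<Rightarrow> real" where
  "bump' l s = flat [:0, 0, 1:] (1 - (s / l)\<^sup>2) * (- 2 * s / l\<^sup>2)"

text \<open>With respect to \<open>y = 1 / m\<close> the first two derivatives of \<open>exp (-m)\<close> are \<open>m^2 exp (-m)\<close> and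
\<open>(m^4 - 2 m^3) exp (-m)\<close>; here \<open>y = 1 - (s/l)^2\<close>.\<close>

definition bump'' :: "real \<Rightarrow> real \<Rightarrow> real" where
  "bump'' l s = flat [:0, 0, 0, -2, 1:] (1 - (s / l)\<^sup>2) * (2 * s / l\<^sup>2)\<^sup>2
     - flat [:0, 0, 1:] (1 - (s / l)\<^sup>2) * 2 / l\<^sup>2"

lemma bump_has_derivative:
  assumes "l \<noteq> 0"
  shows "(bump l has_real_derivative bump' l s) (at s)"
    and "(bump' l has_real_derivative bump'' l s) (at s)"
proof -
  have y: "((\<lambda>s. 1 - (s / l)\<^sup>2) has_real_derivative (- 2 * s / l\<^sup>2)) (at s)"
    using assms by (auto intro!: derivative_eq_intros simp: power2_eq_square)
  have p: "pderiv [:0, 0, 1::real:] = [:0, 2:]" by (simp add: pderiv_pCons)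
  have "(flat 1 has_real_derivative flat [:0, 0, 1:] z) (at z)"
    and q: "(flat [:0, 0, 1:] has_real_derivative flat [:0, 0, 0, -2, 1:] z) (at z)" for z
    using flat_has_derivative[of 1 z] flat_has_derivative[of "[:0, 0, 1:]" z]
    by (simp_all add: p one_pCons)
  from DERIV_chain2[OF this(1) y] show "(bump l has_real_derivative bump' l s) (at s)"
    by (simp add: bump_def[abs_def] bump'_def)
  have "((\<lambda>s. - 2 * s / l\<^sup>2) has_real_derivative (- 2 * 1 / l\<^sup>2)) (at s)"
    by (intro DERIV_cdivide DERIV_cmult DERIV_ident)
  from DERIV_mult[OF DERIV_chain2[OF q y] this]
  have "(bump' l has_real_derivative
      flat [:0, 0, 0, -2, 1:] (1 - (s / l)\<^sup>2) * (- 2 * s / l\<^sup>2) * (- 2 * s / l\<^sup>2)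
      + - 2 / l\<^sup>2 * flat [:0, 0, 1:] (1 - (s / l)\<^sup>2)) (at s)"
    by (simp add: bump'_def[abs_def])
  then show "(bump' l has_real_derivative bump'' l s) (at s)"
    by (simp add: bump''_def power2_eq_square mult_ac)
qed

lemma bump_smooth: "smooth_upto k (bump l)" "smooth_upto k (bump' l)"
proof -
  have "smooth_upto k (\<lambda>s. s * (1 / l))" for k
    by (intro smooth_upto_mult smooth_upto_const smooth_upto_ident)
  then have y: "smooth_upto k (\<lambda>s. 1 + (-1) * ((s * (1 / l)) * (s * (1 / l))))" for k
    by (intro smooth_upto_add smooth_upto_mult smooth_upto_const smooth_upto_ident)
  show "smooth_upto k (bump l)"
    using smooth_upto_compose[OF smooth_upto_flat y] by (simp add: bump_def[abs_def] power2_eq_square)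
  have "smooth_upto k (\<lambda>s. flat [:0, 0, 1:] (1 + (-1) * ((s * (1 / l)) * (s * (1 / l)))) * (s * (- 2 / l\<^sup>2)))"
    by (intro smooth_upto_mult smooth_upto_const smooth_upto_ident smooth_upto_compose[OF smooth_upto_flat y])
  then show "smooth_upto k (bump' l)" by (simp add: bump'_def[abs_def] power2_eq_square mult_ac)
qed

lemma bump_support: "0 < l \<Longrightarrow> l < \<bar>s\<bar> \<Longrightarrow> bump l s = 0" "0 < l \<Longrightarrow> l < \<bar>s\<bar> \<Longrightarrow> bump' l s = 0"
proof -
  assume "0 < l" "l < \<bar>s\<bar>"
  then have "1 < \<bar>s / l\<bar>" by (simp add: field_simps)
  then have "1 < (s / l)\<^sup>2" by (metis one_less_power pos2 power2_abs)
  then show "bump l s = 0" "bump' l s = 0" by (simp_all add: bump_def bump'_def flat_def)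
qed

lemma bump_nonneg: "0 \<le> bump l s"
  by (simp add: bump_def flat_def)

text \<open>One computes \<open>bump'' = (4 m^4 - 12 m^3 + 6 m^2) exp (-m) / l^2\<close> for \<open>m = 1 / (1 - (s/l)^2)\<close>; the polynomial is
bounded below, since it is positive near the edge of the support, where \<open>m\<close> is large. This one-sided
bound replaces any computation of the energy of the bump.\<close>

lemma bump_supersolution:
  assumes "0 < l"
  shows "- bump'' l s \<le> 27 / l\<^sup>2 * bump l s"
proof (cases "0 < 1 - (s / l)\<^sup>2")
  case True
  define m where "m = 1 / (1 - (s / l)\<^sup>2)"
  have m: "0 < m" "(s / l)\<^sup>2 = 1 - 1 / m" using True by (simp_all add: m_def)
  \<comment> \<open>for \<open>m \<le> 3\<close> complete the square; the constant 27 is \<open>3 * 3^2\<close>\<close>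
  have "0 \<le> 4 * m ^ 4 - 12 * m ^ 3 + 6 * m ^ 2 + 27"
  proof (cases "m \<le> 3")
    case True
    then have "m\<^sup>2 \<le> 3\<^sup>2" using m by (intro power_mono) auto
    then have "m\<^sup>2 \<le> 9" by simp
    moreover have "4 * m ^ 4 - 12 * m ^ 3 + 6 * m ^ 2 + 27 = (2 * m\<^sup>2 - 3 * m)\<^sup>2 + (27 - 3 * m\<^sup>2)"
      by (simp add: power2_eq_square eval_nat_numeral algebra_simps)
    ultimately show ?thesis using zero_le_power2[of "2 * m\<^sup>2 - 3 * m"] by linarith
  next
    case False
    have "4 * m ^ 4 - 12 * m ^ 3 + 6 * m ^ 2 + 27 = 4 * m ^ 3 * (m - 3) + 6 * m\<^sup>2 + 27"
      by (simp add: power2_eq_square eval_nat_numeral algebra_simps)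
    then show ?thesis using m False by simp
  qed
  then have "0 \<le> (4 * m ^ 4 - 12 * m ^ 3 + 6 * m ^ 2 + 27) * (exp (- m) / l\<^sup>2)" by simp
  moreover have "bump'' l s = (4 * m ^ 4 - 12 * m ^ 3 + 6 * m ^ 2) * (exp (- m) / l\<^sup>2)"
  proof -
    have sq: "(2 * s / l\<^sup>2)\<^sup>2 = 4 * (s / l)\<^sup>2 / l\<^sup>2"
      by (simp add: power2_eq_square)
    have fl: "flat p (1 - (s / l)\<^sup>2) = poly p m * exp (- m)" for p
      using True by (simp add: flat_def m_def)
    have "bump'' l s = ((m ^ 4 - 2 * m ^ 3) * exp (- m)) * (4 * (1 - 1 / m) / l\<^sup>2)
        - m ^ 2 * exp (- m) * 2 / l\<^sup>2"
      unfolding bump''_def sq fl unfolding m(2) by (simp add: eval_nat_numeral algebra_simps)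
    also have "\<dots> = ((m ^ 4 - 2 * m ^ 3) * (4 * (1 - 1 / m)) - 2 * m ^ 2) * (exp (- m) / l\<^sup>2)"
      by (simp add: algebra_simps diff_divide_distrib)
    also have "(m ^ 4 - 2 * m ^ 3) * (4 * (1 - 1 / m)) - 2 * m ^ 2 = 4 * m ^ 4 - 12 * m ^ 3 + 6 * m ^ 2"
      using m(1) by (simp add: field_simps eval_nat_numeral)
    finally show ?thesis .
  qed
  moreover have "bump l s = exp (- m)" using True by (simp add: bump_def flat_def m_def)
  ultimately show ?thesis by (simp add: algebra_simps)
qed (simp add: bump''_def bump_def flat_def)

text \<open>The function \<open>f\<close> of the coordinate \<open>s = ln (- ln |x|)\<close>, as a function of \<open>\<rho> = |x|^2\<close>. Compact support of
\<open>f\<close> becomes compact support in \<open>0 < \<rho> < 1\<close>, which makes the extension by zero smooth.\<close>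

definition lift :: "(real \<Rightarrow> real) \<Rightarrow> real \<Rightarrow> real" where
  "lift f \<rho> = (if 0 < \<rho> \<and> \<rho> < 1 then f (ln (- ln \<rho> / 2)) else 0)"

text \<open>The derivative \<open>ds/d\<rho>\<close>, written as a function of \<open>s\<close>.\<close>

definition speed :: "real \<Rightarrow> real" where
  "speed s = - (1 / 2) * (exp (- s) * exp (2 * exp s))"

lemma lift_support:
  assumes "\<And>s. l < \<bar>s\<bar> \<Longrightarrow> f s = 0"
  shows "\<rho> < exp (- 2 * exp l) \<Longrightarrow> lift f \<rho> = 0" "exp (- 2 * exp (- l)) < \<rho> \<Longrightarrow> lift f \<rho> = 0"
proof -
  assume *: "\<rho> < exp (- 2 * exp l)"
  show "lift f \<rho> = 0"
  proof (cases "0 < \<rho> \<and> \<rho> < 1")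
    case True
    then have "ln \<rho> < - 2 * exp l" using * by (metis exp_less_cancel_iff exp_ln)
    then have "exp l < - ln \<rho> / 2" by simp
    then have "l < ln (- ln \<rho> / 2)" by (metis exp_gt_zero ln_exp ln_less_cancel_iff order_less_trans)
    then show ?thesis using assms True by (simp add: lift_def)
  qed (auto simp: lift_def)
next
  assume *: "exp (- 2 * exp (- l)) < \<rho>"
  show "lift f \<rho> = 0"
  proof (cases "0 < \<rho> \<and> \<rho> < 1")
    case True
    then have "- 2 * exp (- l) < ln \<rho>" using * by (metis exp_less_cancel_iff exp_ln)
    then have "- ln \<rho> / 2 < exp (- l)" "0 < - ln \<rho> / 2" using True by simp_all
    then have "ln (- ln \<rho> / 2) < - l" by (metis exp_gt_zero ln_exp ln_less_cancel_iff)
    then show ?thesis using assms True by (simp add: lift_def)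
  qed (auto simp: lift_def)
qed

lemma lift_has_derivative:
  assumes f: "\<And>s. (f has_real_derivative f' s) (at s)"
    and supp: "\<And>s. l < \<bar>s\<bar> \<Longrightarrow> f s = 0" "\<And>s. l < \<bar>s\<bar> \<Longrightarrow> f' s = 0"
  shows "(lift f has_real_derivative lift (\<lambda>s. f' s * speed s) \<rho>) (at \<rho>)"
proof (cases "0 < \<rho> \<and> \<rho> < 1")
  case True
  define T where "T = - ln \<rho> / 2"
  have T: "0 < T" using True by (simp add: T_def)
  have T': "((\<lambda>\<rho>. - ln \<rho> / 2) has_real_derivative - (1 / (2 * \<rho>))) (at \<rho>)"
    using True by (auto intro!: derivative_eq_intros)
  have "((\<lambda>\<rho>. ln (- ln \<rho> / 2)) has_real_derivative 1 / T * - (1 / (2 * \<rho>))) (at \<rho>)"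
    using T unfolding T_def by (intro DERIV_chain2[OF DERIV_ln_divide T'])
  from DERIV_chain2[OF f this]
  have "((\<lambda>\<rho>. f (ln (- ln \<rho> / 2))) has_real_derivative f' (ln T) * (1 / T * - (1 / (2 * \<rho>)))) (at \<rho>)"
    by (simp add: T_def)
  moreover have "speed (ln T) = 1 / T * - (1 / (2 * \<rho>))"
  proof -
    have "2 * T = - ln \<rho>" by (simp add: T_def)
    then have e1: "exp (2 * T) = inverse \<rho>" using True by (simp only: exp_minus exp_ln)
    have e2: "exp (- ln T) = inverse T" using T by (simp only: exp_minus exp_ln)
    show ?thesis unfolding speed_def exp_ln[OF T] e1 e2 using True T by (simp add: field_simps)
  qed
  then have "f' (ln T) * (1 / T * - (1 / (2 * \<rho>))) = lift (\<lambda>s. f' s * speed s) \<rho>"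
    using True by (simp add: lift_def T_def)
  ultimately have "((\<lambda>\<rho>. f (ln (- ln \<rho> / 2))) has_real_derivative lift (\<lambda>s. f' s * speed s) \<rho>) (at \<rho>)"
    by simp
  then show ?thesis
    by (rule has_field_derivative_transform_within_open[where S="{0<..<1}"])
      (use True in \<open>auto simp: lift_def\<close>)
next
  case False
  define S where "S = (if \<rho> \<le> 0 then {..<exp (- 2 * exp l)} else {exp (- 2 * exp (- l))<..})"
  have "\<rho> \<in> S"
  proof (cases "\<rho> \<le> 0")
    case True
    then show ?thesis using le_less_trans[OF True exp_gt_zero] by (simp add: S_def)
  next
    case \<rho>: False
    then have "1 \<le> \<rho>" using False by simp
    moreover have "exp (- 2 * exp (- l)) < 1" by simp
    ultimately have "exp (- 2 * exp (- l)) < \<rho>" by linarith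
    then show ?thesis using \<rho> by (simp add: S_def)
  qed
  moreover have "open S" by (simp add: S_def)
  moreover have "lift f \<sigma> = 0" if "\<sigma> \<in> S" for \<sigma>
    using that lift_support[of l f \<sigma>] supp(1) by (auto simp: S_def split: if_splits)
  ultimately have "(lift f has_real_derivative 0) (at \<rho>)"
    by - (rule has_field_derivative_transform_within_open[where S=S and f="\<lambda>_. 0"], simp_all)
  moreover have "lift (\<lambda>s. f' s * speed s) \<rho> = 0" using False by (auto simp: lift_def)
  ultimately show ?thesis by simp
qed

lemma derivative_support:
  assumes "\<And>s. (f has_real_derivative f' s) (at s)" "\<And>s. l < \<bar>s\<bar> \<Longrightarrow> f s = 0" "l < \<bar>s\<bar>"
  shows "f' s = 0"
proof -
  have "open {s. l < \<bar>s::real\<bar>}" by (intro open_Collect_less continuous_intros)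
  then have "(f has_real_derivative 0) (at s)"
    by (rule has_field_derivative_transform_within_open[where f="\<lambda>_. 0", rotated])
      (use assms in auto)
  then show ?thesis using assms(1) DERIV_unique by blast
qed

lemma speed_smooth: "smooth_upto k speed"
proof -
  have "smooth_upto k (\<lambda>s. - (1 / 2) * (exp ((-1) * s) * exp (2 * exp s)))"
    by (intro smooth_upto_mult smooth_upto_const smooth_upto_compose[OF smooth_upto_exp]
        smooth_upto_ident smooth_upto_exp)
  then show ?thesis by (simp add: speed_def[abs_def])
qed

text \<open>One order of smoothness is given away, so that continuity in the base case can be read off from
differentiability.\<close>

lemma lift_smooth:
  assumes "smooth_upto (Suc k) f" "\<And>s. l < \<bar>s\<bar> \<Longrightarrow> f s = 0"
  shows "smooth_upto k (lift f)"
  using assms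
proof (induction k arbitrary: f)
  case 0
  then obtain f' where f': "\<And>s. (f has_real_derivative f' s) (at s)" by auto
  have "(lift f has_real_derivative lift (\<lambda>s. f' s * speed s) \<rho>) (at \<rho>)" for \<rho>
    by (rule lift_has_derivative[OF f' "0.prems"(2) derivative_support[OF f' "0.prems"(2)]])
  then have "continuous_on UNIV (lift f)"
    using DERIV_continuous_on[of UNIV "lift f"] by blast
  then show ?case by simp
next
  case (Suc k)
  obtain f' where f': "\<And>s. (f has_real_derivative f' s) (at s)" "smooth_upto (Suc k) f'"
    using Suc.prems(1) unfolding smooth_upto.simps(2)[of "Suc k"] by blast
  have supp: "f' s = 0" if "l < \<bar>s\<bar>" for s
    using derivative_support[OF f'(1) Suc.prems(2) that] .
  show ?case
  proof (rule smooth_upto_SucI)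
    show "(lift f has_real_derivative lift (\<lambda>s. f' s * speed s) \<rho>) (at \<rho>)" for \<rho>
      by (rule lift_has_derivative[OF f'(1) Suc.prems(2) supp])
    show "smooth_upto k (lift (\<lambda>s. f' s * speed s))"
      by (rule Suc.IH[OF smooth_upto_mult[OF f'(2) speed_smooth]]) (simp add: supp)
  qed
qed

text \<open>The virtual ground state \<open>exp (s/2) = sqrt (- ln |x|)\<close>, modulated by a wide bump.\<close>

definition test_bump :: "real \<Rightarrow> real^2 \<Rightarrow> real" where
  "test_bump l x = lift (\<lambda>s. exp (s / 2) * bump l s) (x \<bullet> x)"

lemma half_exp_bump_derivative:
  assumes "l \<noteq> 0"
  shows "((\<lambda>s. exp (s / 2) * bump l s) has_real_derivative
    exp (s / 2) * (bump l s / 2 + bump' l s)) (at s)"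
  using bump_has_derivative(1)[OF assms, of s]
  by (auto intro!: derivative_eq_intros simp: algebra_simps)

lemma lift_outside_disc:
  assumes "\<And>s. l < \<bar>s\<bar> \<Longrightarrow> f s = 0" "sqrt (exp (- 2 * exp (- l))) < norm x"
  shows "lift f (x \<bullet> x) = 0"
proof (rule lift_support(2)[OF assms(1)])
  show "exp (- 2 * exp (- l)) < x \<bullet> x"
    using assms(2) by (simp add: norm_eq_sqrt_inner)
qed

lemma test_bump_in_test_functions:
  assumes "0 < l"
  shows "test_bump l \<in> test_functions"
  unfolding test_functions_iff
proof (intro conjI allI)
  have supp: "exp (s / 2) * bump l s = 0" if "l < \<bar>s\<bar>" for s
    using bump_support(1)[OF assms that] by simp
  have "smooth_upto k (\<lambda>s. exp (s * (1 / 2)) * bump l s)" for k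
    by (intro smooth_upto_mult bump_smooth smooth_upto_compose[OF smooth_upto_exp]
        smooth_upto_ident smooth_upto_const)
  then have "smooth_upto k (lift (\<lambda>s. exp (s / 2) * bump l s))" for k
    by (intro lift_smooth[where l=l] supp) simp_all
  then show "C_diff k (test_bump l)" for k
    unfolding test_bump_def[abs_def] by (rule C_diff_radial)
  define b where "b = sqrt (exp (- 2 * exp (- l)))"
  have b: "0 < b" "b < 1" by (simp_all add: b_def)
  have "test_bump l x = 0" if "(b + 1) / 2 \<le> norm x" for x
    unfolding test_bump_def
  proof (rule lift_outside_disc[OF supp])
    show "sqrt (exp (- 2 * exp (- l))) < norm x"
      unfolding b_def[symmetric] using that b by (simp add: field_simps)
  qed
  then show "\<exists>R>0. R < 1 \<and> (\<forall>x. R \<le> norm x \<longrightarrow> test_bump l x = 0)"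
    using b by (intro exI[of _ "(b + 1) / 2"]) auto
qed

lemma lift_at_log_height:
  assumes "x \<noteq> 0" "norm x < 1"
  shows "lift f (x \<bullet> x) = f (ln (log_height x))"
proof -
  have "x \<bullet> x < 1" using power_strict_mono[of "norm x" 1 2] assms by (simp add: power2_norm_eq_inner)
  then show ?thesis using assms unfolding lift_def log_height_square by simp
qed

lemma lift_off_disc: "x = 0 \<or> 1 \<le> norm x \<Longrightarrow> lift f (x \<bullet> x) = 0"
  using power_mono[of 1 "norm x" 2] by (auto simp: lift_def power2_norm_eq_inner)

lemma speed_log_height:
  assumes "x \<noteq> 0" "norm x < 1"
  shows "exp (2 * exp (ln (log_height x))) = 1 / (norm x)\<^sup>2"
    and "speed (ln (log_height x)) = - (1 / (2 * ((norm x)\<^sup>2 * log_height x)))"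
proof -
  have t: "0 < log_height x" using assms by simp
  have "exp (2 * log_height x) = exp (- ln (norm x)) * exp (- ln (norm x))"
    by (simp add: exp_add[symmetric])
  also have "exp (- ln (norm x)) = inverse (norm x)"
  proof -
    have "exp (ln (norm x)) = norm x" using assms by simp
    then show ?thesis by (simp only: exp_minus)
  qed
  finally have *: "exp (2 * log_height x) = 1 / (norm x)\<^sup>2"
    by (simp add: power2_eq_square field_simps)
  then show "exp (2 * exp (ln (log_height x))) = 1 / (norm x)\<^sup>2"
    by (simp only: exp_ln[OF t])
  have "exp (- ln (log_height x)) = inverse (log_height x)"
    by (simp only: exp_minus exp_ln[OF t])
  then show "speed (ln (log_height x)) = - (1 / (2 * ((norm x)\<^sup>2 * log_height x)))"
    unfolding speed_def exp_ln[OF t] * using t assms by (simp add: field_simps)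
qed

text \<open>The factor \<open>exp (s/2)\<close> is annihilated by \<open>\<nabla> + F / 2\<close>, so the ground gradient only sees the derivative
of the bump. With \<open>s\<close> and the polar angle \<open>\<theta>\<close> as coordinates the common
density \<open>1 / (|x|^2 (- ln |x|))\<close> becomes \<open>ds d\<theta>\<close>.\<close>

lemma test_bump_forms:
  assumes "0 < l"
  shows "(test_bump l x)\<^sup>2 * hardy_weight x = (lift (bump l) (x \<bullet> x))\<^sup>2 / ((norm x)\<^sup>2 * log_height x)"
    and "ground_gradient (test_bump l) x \<bullet> ground_gradient (test_bump l) x
      = (lift (bump' l) (x \<bullet> x))\<^sup>2 / ((norm x)\<^sup>2 * log_height x)"
proof -
  define f' where "f' s = exp (s / 2) * (bump l s / 2 + bump' l s)" for s
  have "((\<lambda>x. test_bump l x) has_derivative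
      (\<lambda>y. (2 * lift (\<lambda>s. f' s * speed s) (x \<bullet> x)) *\<^sub>R x \<bullet> y)) (at x)"
    unfolding test_bump_def
  proof (intro radial_has_derivative lift_has_derivative[where l=l])
    show "((\<lambda>s. exp (s / 2) * bump l s) has_real_derivative f' s) (at s)" for s
      unfolding f'_def using half_exp_bump_derivative assms by simp
  qed (use bump_support[OF assms] in \<open>auto simp: f'_def\<close>)
  then have grad: "grad (test_bump l) x = (2 * lift (\<lambda>s. f' s * speed s) (x \<bullet> x)) *\<^sub>R x"
    by (intro grad_unique) simp
  let ?N = "(norm x)\<^sup>2 * log_height x"
  let ?goal = "(test_bump l x)\<^sup>2 * hardy_weight x = (lift (bump l) (x \<bullet> x))\<^sup>2 / ?N
    \<and> ground_gradient (test_bump l) x \<bullet> ground_gradient (test_bump l) x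
      = (lift (bump' l) (x \<bullet> x))\<^sup>2 / ?N"
  have ?goal
  proof (cases "x = 0 \<or> 1 \<le> norm x")
    case True
    then show ?goal
      by (simp add: test_bump_def lift_off_disc ground_gradient_def grad)
  next
    case False
    then have x: "x \<noteq> 0" "norm x < 1" by auto
    define t where "t = log_height x"
    define s where "s = ln t"
    have t: "0 < t" using x by (simp add: t_def)
    have e: "(exp (s / 2))\<^sup>2 = t" using t by (simp add: s_def power2_eq_square exp_add[symmetric])
    note L = lift_at_log_height[OF x, folded t_def, folded s_def]
    have V: "hardy_weight x = 1 / ((norm x)\<^sup>2 * t) / t"
      by (simp add: hardy_weight_def t_def power2_eq_square)
    have "(test_bump l x)\<^sup>2 * hardy_weight x = t * (bump l s)\<^sup>2 * hardy_weight x"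
      by (simp add: test_bump_def L power_mult_distrib e)
    moreover have "t * hardy_weight x = 1 / ((norm x)\<^sup>2 * t)" using t by (simp add: V)
    ultimately have 1: "(test_bump l x)\<^sup>2 * hardy_weight x = (bump l s)\<^sup>2 / ((norm x)\<^sup>2 * t)"
      by (metis mult.commute mult.left_commute mult_1 times_divide_eq_right)
    have "2 * (f' s * speed s) = - f' s * (1 / ((norm x)\<^sup>2 * t))"
      using speed_log_height(2)[OF x] by (simp add: s_def t_def)
    then have "grad (test_bump l) x = - f' s *\<^sub>R ground_field x"
      by (simp add: grad L ground_field_def t_def)
    then have "ground_gradient (test_bump l) x = (- f' s + exp (s / 2) * bump l s / 2) *\<^sub>R ground_field x"
      by (simp add: ground_gradient_def test_bump_def L scaleR_left_diff_distrib)
    also have "- f' s + exp (s / 2) * bump l s / 2 = - (exp (s / 2) * bump' l s)"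
      by (simp add: f'_def algebra_simps)
    finally have "ground_gradient (test_bump l) x \<bullet> ground_gradient (test_bump l) x
        = (exp (s / 2))\<^sup>2 * (bump' l s)\<^sup>2 * hardy_weight x"
      by (simp add: ground_field_square[symmetric] power2_eq_square mult_ac)
    then have 2: "ground_gradient (test_bump l) x \<bullet> ground_gradient (test_bump l) x
        = (bump' l s)\<^sup>2 / ((norm x)\<^sup>2 * t)"
      unfolding e using t by (simp add: V)
    show ?goal
      using 1 2 by (simp add: L t_def)
  qed
  then show "(test_bump l x)\<^sup>2 * hardy_weight x = (lift (bump l) (x \<bullet> x))\<^sup>2 / ?N"
    "ground_gradient (test_bump l) x \<bullet> ground_gradient (test_bump l) x
      = (lift (bump' l) (x \<bullet> x))\<^sup>2 / ?N"
    by blast+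
qed

text \<open>Integration by parts \<open>\<integral> w'^2 ds = - \<integral> w w'' ds\<close> for \<open>w = bump l\<close>, as the flux of the field
\<open>w w' x / |x|^2\<close>, which is supported away from the origin.\<close>

lemma test_bump_flux:
  assumes "0 < l"
  defines "E \<equiv> \<lambda>x::real^2. (lift (bump' l) (x \<bullet> x))\<^sup>2 / ((norm x)\<^sup>2 * log_height x)"
    and "D \<equiv> \<lambda>x::real^2. lift (bump l) (x \<bullet> x) * lift (bump'' l) (x \<bullet> x) / ((norm x)\<^sup>2 * log_height x)"
  shows "integrable lborel D" "(\<integral>x. E x + D x \<partial>lborel) = 0"
proof -
  \<comment> \<open>\<open>exp (2 * exp s) = 1 / \<rho>\<close>, so \<open>lift q\<close> is \<open>w' / \<rho>\<close>\<close>
  define q where "q s = bump' l s * exp (2 * exp s)" for s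
  define q' where "q' s = (bump'' l s + bump' l s * (2 * exp s)) * exp (2 * exp s)" for s
  have q: "(q has_real_derivative q' s) (at s)" for s
    unfolding q_def[abs_def] q'_def using bump_has_derivative(2)[of l s] assms
    by (auto intro!: derivative_eq_intros simp: algebra_simps)
  have q_supp: "q s = 0" if "l < \<bar>s\<bar>" for s using bump_support[OF assms(1) that] by (simp add: q_def)
  have q'_supp: "q' s = 0" if "l < \<bar>s\<bar>" for s using derivative_support[OF q q_supp that] .
  have b: "\<And>s. (bump l has_real_derivative bump' l s) (at s)"
    using bump_has_derivative(1)[of l] assms by simp
  have q_smooth: "smooth_upto k q" for k
  proof -
    have "smooth_upto k (\<lambda>s. bump' l s * exp (2 * exp s))"
      by (intro smooth_upto_mult bump_smooth smooth_upto_compose[OF smooth_upto_exp]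
          smooth_upto_const smooth_upto_exp)
    then show ?thesis by (simp add: q_def[abs_def])
  qed
  have g: "(lift q has_real_derivative lift (\<lambda>s. q' s * speed s) \<rho>) (at \<rho>)" for \<rho>
    by (rule lift_has_derivative[OF q q_supp q'_supp])
  have g': "continuous_on UNIV (lift (\<lambda>s. q' s * speed s))"
  proof -
    obtain q2 where q2: "\<And>s. (q has_real_derivative q2 s) (at s)" "smooth_upto (Suc 0) q2"
      using q_smooth[of "Suc (Suc 0)"] unfolding smooth_upto.simps(2)[of "Suc 0"] by blast
    have "q2 = q'" using DERIV_unique[OF q2(1) q] by blast
    then have "smooth_upto (Suc 0) (\<lambda>s. q' s * speed s)"
      using q2(2) speed_smooth by (intro smooth_upto_mult) auto
    then have "smooth_upto 0 (lift (\<lambda>s. q' s * speed s))"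
      by (rule lift_smooth[where l=l]) (simp add: q'_supp)
    then show ?thesis by simp
  qed
  define \<phi> where "\<phi> x = lift (bump l) (x \<bullet> x)" for x :: "real^2"
  define \<phi>' where "\<phi>' x y = (2 * lift (\<lambda>s. bump' l s * speed s) (x \<bullet> x)) *\<^sub>R x \<bullet> y" for x y :: "real^2"
  have \<phi>: "(\<phi> has_derivative \<phi>' x) (at x)" for x
    unfolding \<phi>_def[abs_def] \<phi>'_def
    by (intro radial_has_derivative lift_has_derivative[OF b] bump_support assms)
  have "smooth_upto 0 (lift (\<lambda>s. bump' l s * speed s))"
    by (rule lift_smooth[where l=l, OF smooth_upto_mult[OF bump_smooth(2) speed_smooth]])
      (simp add: bump_support(2)[OF assms(1)])
  then have "continuous_on UNIV (\<lambda>x::real^2. lift (\<lambda>s. bump' l s * speed s) (x \<bullet> x))"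
    using C_diff_imp_continuous[OF C_diff_radial] by blast
  then have \<phi>': "continuous_on UNIV (\<lambda>x. \<phi>' x e)" for e
    unfolding \<phi>'_def by (intro continuous_intros)
  define R where "R = sqrt (exp (- 2 * exp (- l)))"
  have R: "R < 1" by (simp add: R_def)
  have supp: "\<phi> x = 0" if "R < norm x" for x
    unfolding \<phi>_def using lift_outside_disc[OF bump_support(1)[OF assms(1)]] that by (simp add: R_def)
  note flux = radial_flux[of "lift q" "lift (\<lambda>s. q' s * speed s)", OF g
      continuous_on_subset[OF g' subset_UNIV] \<phi> \<phi>' supp R]
  have AD: "lift q (x \<bullet> x) * \<phi>' x x = - E x \<and>
    \<phi> x * (real DIM(real^2) * lift q (x \<bullet> x) + 2 * (x \<bullet> x) * lift (\<lambda>s. q' s * speed s) (x \<bullet> x)) = - D x" for x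
  proof (cases "x = 0 \<or> 1 \<le> norm x")
    case True
    then show ?thesis
      by (simp add: lift_off_disc E_def D_def \<phi>_def)
  next
    case False
    then have x: "x \<noteq> 0" "norm x < 1" by auto
    define t where "t = log_height x"
    define s where "s = ln t"
    have t: "0 < t" using x by (simp add: t_def)
    note L = lift_at_log_height[OF x, folded t_def, folded s_def]
    note sp = speed_log_height[OF x, folded t_def, folded s_def]
    have es: "exp s = t" using t by (simp add: s_def)
    have r: "0 < norm x" using x by simp
    have "lift q (x \<bullet> x) * \<phi>' x x = - E x"
      unfolding \<phi>'_def E_def L t_def[symmetric] using r t
      by (simp add: q_def sp dot_square_norm power2_eq_square)
    moreover have "\<phi> x * (2 * q s + 2 * (norm x)\<^sup>2 * (q' s * speed s)) = - D x"
      unfolding \<phi>_def D_def L t_def[symmetric] q_def q'_def sp unfolding es using r t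
      by (simp add: field_simps)
    ultimately show ?thesis
      unfolding L by (simp add: dot_square_norm)
  qed
  have "integrable lborel (\<lambda>x. - D x)" "(\<integral>x. - E x + - D x \<partial>lborel) = 0"
    using flux(2,3) unfolding AD[THEN conjunct1] AD[THEN conjunct2] by auto
  moreover have "(\<integral>x. - E x + - D x \<partial>lborel) = - (\<integral>x. E x + D x \<partial>lborel)"
    by (subst integral_minus[symmetric]) (simp add: algebra_simps)
  ultimately show "integrable lborel D" "(\<integral>x. E x + D x \<partial>lborel) = 0" by simp_all
qed

text \<open>Integration by parts and the bound \<open>- w'' \<le> 27 / l^2 * w\<close> for the bump give
\<open>\<integral> w'^2 ds \<le> 27 / l^2 * \<integral> w^2 ds\<close>, and \<open>l\<close> is at our disposal.\<close>

lemma no_spectral_gap: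
  assumes "0 < \<delta>"
  shows "\<exists>\<phi>\<in>test_functions. 0 < weight_form \<phi> \<phi> \<and> ground_form \<phi> \<phi> \<le> \<delta> * weight_form \<phi> \<phi>"
proof -
  define l where "l = sqrt (27 / \<delta>)"
  have l: "0 < l" "27 / l\<^sup>2 = \<delta>" using assms by (simp_all add: l_def)
  let ?\<phi> = "test_bump l"
  have T: "?\<phi> \<in> test_functions" by (rule test_bump_in_test_functions[OF l(1)])
  define N where "N x = 1 / ((norm x)\<^sup>2 * log_height x)" for x :: "real^2"
  define D where "D x = lift (bump l) (x \<bullet> x) * lift (bump'' l) (x \<bullet> x) / ((norm x)\<^sup>2 * log_height x)"
    for x :: "real^2"
  have W: "hardy_weight x * (?\<phi> x * ?\<phi> x) = (lift (bump l) (x \<bullet> x))\<^sup>2 / ((norm x)\<^sup>2 * log_height x)" for x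
    using test_bump_forms(1)[OF l(1), of x] by (simp add: power2_eq_square mult_ac)
  have le: "- D x \<le> \<delta> * (hardy_weight x * (?\<phi> x * ?\<phi> x))" for x
  proof (cases "x = 0 \<or> 1 \<le> norm x")
    case True
    then show ?thesis unfolding W by (simp add: D_def lift_off_disc)
  next
    case False
    then have x: "x \<noteq> 0" "norm x < 1" by auto
    define s where "s = ln (log_height x)"
    have "0 \<le> N x"
      unfolding N_def using x by (intro divide_nonneg_nonneg mult_nonneg_nonneg) auto
    have "- bump'' l s \<le> \<delta> * bump l s"
      using bump_supersolution[OF l(1), of s] unfolding l(2) .
    then have "bump l s * - bump'' l s * N x \<le> bump l s * (\<delta> * bump l s) * N x"
      using \<open>0 \<le> N x\<close> bump_nonneg by (intro mult_right_mono mult_left_mono) auto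
    then show ?thesis
      unfolding W by (simp add: D_def lift_at_log_height[OF x] s_def[symmetric] N_def power2_eq_square mult_ac)
  qed
  have "ground_form ?\<phi> ?\<phi> = (\<integral>x. - D x \<partial>lborel)"
  proof -
    have "integrable lborel (\<lambda>x::real^2. (lift (bump' l) (x \<bullet> x))\<^sup>2 / ((norm x)\<^sup>2 * log_height x))"
      using integrable_ground_square[OF T] by (simp add: test_bump_forms(2)[OF l(1)])
    then show ?thesis
      using test_bump_flux[OF l(1), folded D_def]
      by (simp add: ground_form_def test_bump_forms(2)[OF l(1)])
  qed
  also have "\<dots> \<le> (\<integral>x. \<delta> * (hardy_weight x * (?\<phi> x * ?\<phi> x)) \<partial>lborel)"
    using test_bump_flux(1)[OF l(1), folded D_def] integrable_weighted_product[OF T T] le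
    by (intro integral_mono) auto
  finally have ground: "ground_form ?\<phi> ?\<phi> \<le> \<delta> * weight_form ?\<phi> ?\<phi>" by (simp add: weight_form_def)
  have "weight_form ?\<phi> ?\<phi> \<noteq> 0"
  proof
    assume "weight_form ?\<phi> ?\<phi> = 0"
    then have "AE x in lborel. hardy_weight x * (?\<phi> x * ?\<phi> x) = 0"
      unfolding weight_form_def
      by (subst (asm) integral_nonneg_eq_0_iff_AE)
        (auto simp: integrable_weighted_product T hardy_weight_nonneg)
    moreover have "hardy_weight x * (?\<phi> x * ?\<phi> x) = 0 \<longleftrightarrow> ?\<phi> x = 0" for x
    proof (cases "x = 0 \<or> 1 \<le> norm x")
      case False
      then show ?thesis by (auto simp: hardy_weight_def)
    qed (auto simp: test_bump_def lift_off_disc)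
    ultimately have "AE x in lborel. ?\<phi> x = 0" by simp
    then have "{x. ?\<phi> x \<noteq> 0} \<in> null_sets lborel"
      using test_functions_measurable(1)[OF T] by (simp add: AE_iff_null_sets)
    then have "negligible {x. ?\<phi> x \<noteq> 0}"
      by (simp add: negligible_iff_null_sets null_sets_completionI)
    moreover have "open {x. ?\<phi> x \<noteq> 0}"
      using test_functions_continuous[OF T] by (intro open_Collect_neq continuous_on_const)
    moreover have "{x. ?\<phi> x \<noteq> 0} \<noteq> {}"
    proof -
      \<comment> \<open>a point with \<open>s = 0\<close>, the centre of the bump\<close>
      define y :: "real^2" where "y = exp (- 1) *\<^sub>R axis 1 1"
      have "norm y = exp (- 1)" by (simp add: y_def norm_axis_1)
      then have y: "y \<noteq> 0" "norm y < 1" "log_height y = 1" by auto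
      have "?\<phi> y \<noteq> 0"
        unfolding test_bump_def lift_at_log_height[OF y(1,2)] y(3) by (simp add: bump_def flat_def)
      then show ?thesis by blast
    qed
    ultimately show False using open_not_negligible by blast
  qed
  moreover have "0 \<le> weight_form ?\<phi> ?\<phi>" by (simp add: weight_form_def hardy_weight_nonneg)
  ultimately show ?thesis using T ground by (intro bexI[of _ ?\<phi>]) auto
qed

interpretation hardy: degenerate_form_pair test_functions ground_form weight_form
proof unfold_locales
  show "\<exists>K. \<forall>u\<in>test_functions.
      (weight_form u \<psi>)\<^sup>2 \<le> K * (semi_inner_product.seminorm weight_form u * semi_inner_product.seminorm ground_form u)"
    if "\<psi> \<in> test_functions" for \<psi>
    by (rule weight_form_control[OF that])
  show "\<exists>\<phi>\<in>test_functions. 0 < weight_form \<phi> \<phi> \<and> ground_form \<phi> \<phi> \<le> \<delta> * weight_form \<phi> \<phi>" if "0 < \<delta>" for \<delta>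
    by (rule no_spectral_gap[OF that])
qed

section \<open>The completions\<close>

text \<open>The hypotheses say that the inclusion of \<open>A\<close> into \<open>B\<close> descends to the quotients and that the resulting
map is injective; its values are the classes of elements of \<open>A\<close>.\<close>

lemma quotient_inclusion:
  assumes A: "equiv A r" and B: "equiv B r'" and sub: "r \<subseteq> r'"
    and reflect: "\<And>s t. s \<in> A \<Longrightarrow> t \<in> A \<Longrightarrow> (s, t) \<in> r' \<Longrightarrow> (s, t) \<in> r"
  shows "inj_on (\<lambda>C. r' `` C) (A // r)" "(\<lambda>C. r' `` C) ` (A // r) \<subseteq> B // r'"
    and "\<And>s. s \<in> B \<Longrightarrow> (\<And>t. t \<in> A \<Longrightarrow> (t, s) \<notin> r') \<Longrightarrow> r' `` {s} \<notin> (\<lambda>C. r' `` C) ` (A // r)"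
proof -
  have AB: "s \<in> B" if "s \<in> A" for s
    using that sub equiv_class_self[OF A that] equiv_type[OF B] by blast
  have cls: "r' `` (r `` {s}) = r' `` {s}" if "s \<in> A" for s
  proof
    show "r' `` (r `` {s}) \<subseteq> r' `` {s}"
      using sub B unfolding equiv_def trans_def by blast
    show "r' `` {s} \<subseteq> r' `` (r `` {s})"
      using equiv_class_self[OF A that] by blast
  qed
  show "inj_on (\<lambda>C. r' `` C) (A // r)"
  proof (rule inj_onI)
    fix C D assume "C \<in> A // r" "D \<in> A // r" and eq: "r' `` C = r' `` D"
    then obtain s t where s: "s \<in> A" "C = r `` {s}" and t: "t \<in> A" "D = r `` {t}"
      by (auto elim!: quotientE)
    have "(s, t) \<in> r'"
      using eq cls s t eq_equiv_class[OF _ B AB] by metis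
    then show "C = D" using reflect s t equiv_class_eq[OF A] by blast
  qed
  show "(\<lambda>C. r' `` C) ` (A // r) \<subseteq> B // r'"
    using cls AB by (auto elim!: quotientE intro!: quotientI)
  show "r' `` {s} \<notin> (\<lambda>C. r' `` C) ` (A // r)" if "s \<in> B" "\<And>t. t \<in> A \<Longrightarrow> (t, s) \<notin> r'" for s
  proof
    assume "r' `` {s} \<in> (\<lambda>C. r' `` C) ` (A // r)"
    then obtain t where t: "t \<in> A" "r' `` {s} = r' `` {t}"
      using cls by (auto elim!: quotientE)
    then have "(t, s) \<in> r'" using equiv_class_self[OF B that(1)] by blast
    then show False using that(2)[OF t(1)] by blast
  qed
qed

lemma seminorms_zero: "ground.seminorm (\<lambda>x. 0) = 0" "weight.seminorm (\<lambda>x. 0) = 0"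
  using ground.seminorm_zero weight.seminorm_zero test_bump_in_test_functions[of 1] by auto

lemma hardy_norm_critical: "u \<in> test_functions \<Longrightarrow> hardy_norm (- (1/4)) u = ground.seminorm u"
  by (simp add: hardy_norm_eq ground.seminorm_def)

lemma hardy_norm_bounds:
  assumes "u \<in> test_functions" "-1/4 < \<mu>"
  shows "ground.seminorm u \<le> hardy_norm \<mu> u"
    and "sqrt (\<mu> + 1/4) * weight.seminorm u \<le> hardy_norm \<mu> u"
    and "hardy_norm \<mu> u \<le> ground.seminorm u + sqrt (\<mu> + 1/4) * weight.seminorm u"
proof -
  have "0 \<le> (\<mu> + 1/4) * weight_form u u"
    using assms weight.form_nonneg by simp
  then show "ground.seminorm u \<le> hardy_norm \<mu> u"
    "sqrt (\<mu> + 1/4) * weight.seminorm u \<le> hardy_norm \<mu> u"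
    "hardy_norm \<mu> u \<le> ground.seminorm u + sqrt (\<mu> + 1/4) * weight.seminorm u"
    using ground.form_nonneg[OF assms(1)]
    by (auto simp: hardy_norm_eq assms(1) ground.seminorm_def weight.seminorm_def
        real_sqrt_mult[symmetric] intro: sqrt_add_le_add_sqrt)
qed

lemma Cauchy_seqs_critical:
  "s \<in> Cauchy_seqs (- (1/4)) \<longleftrightarrow> (\<forall>n. s n \<in> test_functions) \<and> ground.Cauchy_seq s"
  unfolding Cauchy_seqs_def ground.Cauchy_seq_def
  by (auto simp: hardy_norm_critical test_functions_diff)

lemma Cauchy_seqs_subcritical:
  assumes "-1/4 < \<mu>"
  shows "s \<in> Cauchy_seqs \<mu> \<longleftrightarrow>
    (\<forall>n. s n \<in> test_functions) \<and> ground.Cauchy_seq s \<and> weight.Cauchy_seq s"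
proof (cases "\<forall>n. s n \<in> test_functions")
  case True
  define k where "k = sqrt (\<mu> + 1/4)"
  have k: "0 < k" using assms by (simp add: k_def)
  have d: "(\<lambda>x. s m x - s n x) \<in> test_functions" for m n
    using True by (intro test_functions_diff) auto
  note bounds = hardy_norm_bounds[OF d assms, folded k_def]
  show ?thesis
  proof
    assume "s \<in> Cauchy_seqs \<mu>"
    then have C: "\<And>e. 0 < e \<Longrightarrow> \<exists>N. \<forall>m\<ge>N. \<forall>n\<ge>N. hardy_norm \<mu> (\<lambda>x. s m x - s n x) < e"
      by (simp add: Cauchy_seqs_def)
    have "ground.Cauchy_seq s"
      unfolding ground.Cauchy_seq_def using C bounds(1) by (meson le_less_trans)
    moreover have "weight.Cauchy_seq s"
      unfolding weight.Cauchy_seq_def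
    proof (intro allI impI)
      fix e :: real assume "0 < e"
      then obtain N where N: "\<And>m n. N \<le> m \<Longrightarrow> N \<le> n \<Longrightarrow> hardy_norm \<mu> (\<lambda>x. s m x - s n x) < k * e"
        using C[of "k * e"] k by auto
      have "weight.seminorm (\<lambda>x. s m x - s n x) < e" if "N \<le> m" "N \<le> n" for m n
        using le_less_trans[OF bounds(2) N[OF that]] k by simp
      then show "\<exists>N. \<forall>m\<ge>N. \<forall>n\<ge>N. weight.seminorm (\<lambda>x. s m x - s n x) < e" by blast
    qed
    ultimately show "(\<forall>n. s n \<in> test_functions) \<and> ground.Cauchy_seq s \<and> weight.Cauchy_seq s"
      using True by blast
  next
    assume C: "(\<forall>n. s n \<in> test_functions) \<and> ground.Cauchy_seq s \<and> weight.Cauchy_seq s"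
    have "\<exists>N. \<forall>m\<ge>N. \<forall>n\<ge>N. hardy_norm \<mu> (\<lambda>x. s m x - s n x) < e" if "0 < e" for e
    proof -
      have e: "0 < e / 2" "0 < e / (2 * k)" using that k by auto
      obtain N1 where N1: "\<And>m n. N1 \<le> m \<Longrightarrow> N1 \<le> n \<Longrightarrow> ground.seminorm (\<lambda>x. s m x - s n x) < e / 2"
        using C e(1) unfolding ground.Cauchy_seq_def by meson
      obtain N2 where N2: "\<And>m n. N2 \<le> m \<Longrightarrow> N2 \<le> n \<Longrightarrow> weight.seminorm (\<lambda>x. s m x - s n x) < e / (2 * k)"
        using C e(2) unfolding weight.Cauchy_seq_def by meson
      have "hardy_norm \<mu> (\<lambda>x. s m x - s n x) < e" if "max N1 N2 \<le> m" "max N1 N2 \<le> n" for m n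
      proof -
        have "k * weight.seminorm (\<lambda>x. s m x - s n x) < e / 2"
          using N2[of m n] that k by (simp add: field_simps)
        then show ?thesis using bounds(3)[of m n] N1[of m n] that by simp
      qed
      then show ?thesis by blast
    qed
    then show "s \<in> Cauchy_seqs \<mu>" using C by (simp add: Cauchy_seqs_def)
  qed
qed (auto simp: Cauchy_seqs_def)

lemma null_rel_critical:
  "(s, t) \<in> null_rel (- (1/4)) \<longleftrightarrow> s \<in> Cauchy_seqs (- (1/4)) \<and> t \<in> Cauchy_seqs (- (1/4)) \<and>
     (\<lambda>n. ground.seminorm (\<lambda>x. s n x - t n x)) \<longlonglongrightarrow> 0"
  unfolding null_rel_def
  by (auto simp: hardy_norm_critical test_functions_diff Cauchy_seqs_critical)

lemma null_rel_subcritical: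
  assumes "-1/4 < \<mu>"
  shows "(s, t) \<in> null_rel \<mu> \<longleftrightarrow> s \<in> Cauchy_seqs \<mu> \<and> t \<in> Cauchy_seqs \<mu> \<and>
     (\<lambda>n. ground.seminorm (\<lambda>x. s n x - t n x)) \<longlonglongrightarrow> 0 \<and>
     (\<lambda>n. weight.seminorm (\<lambda>x. s n x - t n x)) \<longlonglongrightarrow> 0"
proof (cases "s \<in> Cauchy_seqs \<mu> \<and> t \<in> Cauchy_seqs \<mu>")
  case True
  define k where "k = sqrt (\<mu> + 1/4)"
  have k: "0 < k" using assms by (simp add: k_def)
  have d: "(\<lambda>x. s n x - t n x) \<in> test_functions" for n
    using True by (intro test_functions_diff) (auto simp: Cauchy_seqs_def)
  note bounds = hardy_norm_bounds[OF d assms, folded k_def]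
  have "(\<lambda>n. hardy_norm \<mu> (\<lambda>x. s n x - t n x)) \<longlonglongrightarrow> 0 \<longleftrightarrow>
     (\<lambda>n. ground.seminorm (\<lambda>x. s n x - t n x)) \<longlonglongrightarrow> 0 \<and>
     (\<lambda>n. weight.seminorm (\<lambda>x. s n x - t n x)) \<longlonglongrightarrow> 0" (is "?H \<longleftrightarrow> ?G \<and> ?W")
  proof (intro iffI conjI)
    assume H: ?H
    show ?G
      by (rule Lim_null_comparison[OF always_eventually H])
        (use bounds(1) ground.seminorm_nonneg[OF d] in auto)
    have "(\<lambda>n. hardy_norm \<mu> (\<lambda>x. s n x - t n x) / k) \<longlonglongrightarrow> 0"
      using tendsto_divide[OF H tendsto_const[of k]] k by simp
    then show ?W
      by (rule Lim_null_comparison[OF always_eventually, rotated])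
        (use bounds(2) weight.seminorm_nonneg[OF d] k in \<open>auto simp: field_simps\<close>)
  next
    assume GW: "?G \<and> ?W"
    then have "(\<lambda>n. ground.seminorm (\<lambda>x. s n x - t n x) + k * weight.seminorm (\<lambda>x. s n x - t n x)) \<longlonglongrightarrow> 0 + k * 0"
      by (intro tendsto_add tendsto_mult tendsto_const) auto
    then have lim: "(\<lambda>n. ground.seminorm (\<lambda>x. s n x - t n x) + k * weight.seminorm (\<lambda>x. s n x - t n x)) \<longlonglongrightarrow> 0"
      by simp
    have "0 \<le> hardy_norm \<mu> (\<lambda>x. s n x - t n x)" for n
      using bounds(1)[of n] ground.seminorm_nonneg[OF d, of n] by linarith
    then show ?H
      by (intro Lim_null_comparison[OF always_eventually lim]) (use bounds(3) in auto)
  qed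
  then show ?thesis using True by (simp add: null_rel_def)
qed (auto simp: null_rel_def)

lemma H1_mu_subcritical:
  assumes "-1/4 < \<mu>" "-1/4 < \<nu>"
  shows "H1_mu \<mu> = H1_mu \<nu>"
proof -
  have C: "Cauchy_seqs \<mu> = Cauchy_seqs \<nu>"
    using Cauchy_seqs_subcritical[OF assms(1)] Cauchy_seqs_subcritical[OF assms(2)] by blast
  have "null_rel \<mu> = null_rel \<nu>"
    by (auto simp: null_rel_subcritical[OF assms(1)] null_rel_subcritical[OF assms(2)] C)
  then show ?thesis by (simp add: H1_mu_def C)
qed

lemma equiv_null_rel_critical: "equiv (Cauchy_seqs (- (1/4))) (null_rel (- (1/4)))"
proof (rule equivI)
  show "null_rel (- (1/4)) \<subseteq> Cauchy_seqs (- (1/4)) \<times> Cauchy_seqs (- (1/4))"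
    by (auto simp: null_rel_def)
  show "refl_on (Cauchy_seqs (- (1/4))) (null_rel (- (1/4)))"
    by (rule refl_onI) (auto simp: null_rel_critical Cauchy_seqs_critical seminorms_zero)
  show "sym (null_rel (- (1/4)))"
    by (rule symI) (auto simp: null_rel_critical Cauchy_seqs_critical intro: ground.null_diff_sym)
  show "trans (null_rel (- (1/4)))"
    by (rule transI) (auto simp: null_rel_critical Cauchy_seqs_critical intro: ground.null_diff_trans)
qed

lemma equiv_null_rel_zero: "equiv (Cauchy_seqs 0) (null_rel 0)"
proof (rule equivI)
  have 0: "-1/4 < (0::real)" by simp
  note simps = null_rel_subcritical[OF 0] Cauchy_seqs_subcritical[OF 0]
  show "null_rel 0 \<subseteq> Cauchy_seqs 0 \<times> Cauchy_seqs 0"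
    by (auto simp: null_rel_def)
  show "refl_on (Cauchy_seqs 0) (null_rel 0)"
    by (rule refl_onI) (auto simp: simps seminorms_zero)
  show "sym (null_rel 0)"
    by (rule symI) (auto simp: simps intro: ground.null_diff_sym weight.null_diff_sym)
  show "trans (null_rel 0)"
    by (rule transI) (auto simp: simps intro: ground.null_diff_trans weight.null_diff_trans)
qed

theorem theorem3p1:
  shows "(\<forall>\<mu>::real. \<mu> > -1/4 \<longrightarrow> H1_mu \<mu> = H1_zero) \<and>
    (canonically_included 0 (-1/4) \<and> canonical (-1/4) ` H1_zero \<subset> H1_hat)"
proof -
  have 0: "-1/4 < (0::real)" by simp
  note simps = null_rel_subcritical[OF 0] Cauchy_seqs_subcritical[OF 0]
    null_rel_critical Cauchy_seqs_critical
  have sub: "null_rel 0 \<subseteq> null_rel (- (1/4))" by (auto simp: simps)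
  have reflect: "(s, t) \<in> null_rel 0"
    if s: "s \<in> Cauchy_seqs 0" and t: "t \<in> Cauchy_seqs 0" and st: "(s, t) \<in> null_rel (- (1/4))" for s t
  proof -
    have lim: "(\<lambda>n. ground.seminorm (\<lambda>x. s n x - t n x)) \<longlonglongrightarrow> 0"
      using st by (simp add: null_rel_critical)
    have "(\<lambda>n. weight.seminorm (\<lambda>x. s n x - t n x)) \<longlonglongrightarrow> 0"
      using s t lim by (intro hardy.closable weight.Cauchy_seq_diff test_functions_diff) (auto simp: simps)
    then show ?thesis using s t lim by (simp add: simps)
  qed
  note incl = quotient_inclusion[OF equiv_null_rel_zero equiv_null_rel_critical sub]
  have hat: "H1_hat = H1_mu (- (1/4))" by (simp add: H1_hat_def)
  have canon: "canonical (- (1/4)) = (\<lambda>C. null_rel (- (1/4)) `` C)"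
    by (simp add: canonical_def fun_eq_iff)
  obtain s where s: "\<And>n. s n \<in> test_functions" "ground.Cauchy_seq s"
    "\<And>t M. (\<And>n. t n \<in> test_functions) \<Longrightarrow> (\<And>n. weight.seminorm (t n) \<le> M) \<Longrightarrow>
       \<not> (\<lambda>n. ground.seminorm (\<lambda>x. s n x - t n x)) \<longlonglongrightarrow> 0"
    using hardy.not_surjective by blast
  have sC: "s \<in> Cauchy_seqs (- (1/4))" using s by (simp add: Cauchy_seqs_critical)
  have not_related: "(t, s) \<notin> null_rel (- (1/4))" if t: "t \<in> Cauchy_seqs 0" for t
  proof
    assume "(t, s) \<in> null_rel (- (1/4))"
    then have "(\<lambda>n. ground.seminorm (\<lambda>x. s n x - t n x)) \<longlonglongrightarrow> 0"
      using ground.null_diff_sym[of t s] s(1) t by (simp add: simps)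
    moreover obtain M where "\<And>n. weight.seminorm (t n) \<le> M"
      using weight.Cauchy_seq_bounded[of t] t by (auto simp: simps)
    ultimately show False using s(3)[of t M] t by (auto simp: simps)
  qed
  have "null_rel (- (1/4)) `` {s} \<in> H1_hat"
    using sC by (simp add: hat H1_mu_def quotientI)
  moreover have "null_rel (- (1/4)) `` {s} \<notin> canonical (- (1/4)) ` H1_zero"
    unfolding canon H1_zero_def H1_mu_def by (rule incl(3)) (fact reflect sC not_related)+
  moreover have "canonical (- (1/4)) ` H1_zero \<subseteq> H1_hat"
    unfolding canon H1_zero_def hat H1_mu_def by (rule incl(2)) (fact reflect)
  moreover have "canonically_included 0 (- (1/4))"
    unfolding canonically_included_def canon H1_mu_def
    by (intro conjI sub incl(1,2)) (fact reflect)+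
  ultimately have "canonically_included 0 (- (1/4)) \<and> canonical (- (1/4)) ` H1_zero \<subset> H1_hat"
    by blast
  moreover have "\<forall>\<mu>. \<mu> > -1/4 \<longrightarrow> H1_mu \<mu> = H1_zero"
    using H1_mu_subcritical[OF _ 0] unfolding H1_zero_def by blast
  ultimately show ?thesis by simp
qed

end
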